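(* Let $\mathcal{H}$ be a separable real Hilbert space and $V:\mathcal{H}\to\mathcal{H}$ a monotone and $L_V$-Lipschitz continuous operator with $\operatorname{zer}V=\{y\in\mathcal{H}:V(y)=0\}\neq\emptyset$. Let $t_0\ge 0$, $\lambda>0$, let $\mu:[t_0,+\infty)\to(0,+\infty)$ be continuously differentiable and nondecreasing, $\gamma:[t_0,+\infty)\to(0,+\infty)$ continuous, and $\sigma_Y:[t_0,+\infty)\to\mathcal{L}(\mathcal{H},\mathcal{H})$ measurable. Consider on $[t_0,+\infty)$ the system $$\begin{cases} dY(t)=\big(Z(t)-\mu(t)V(Y(t))\big)dt\\ dZ(t)=\big(-\lambda Z(t)+(\lambda\mu(t)-\gamma(t)+\dot\mu(t))V(Y(t))\big)dt+\sigma_Y(t)\,dW(t)\\ Y(t_0)=Y_0,\quad Z(t_0)=X_0+\mu(t_0)V(Y_0).\end{cases}$$ If there is a constant $\sigma_*$ with $\|\sigma_Y(t)\|_{HS}\le\sigma_*$ for every $t\ge t_0$, then this system has a unique strong solution $(Y,Z)$. In addition, $(Y,Z)\in S^\nu_{\mathcal{H}\times\mathcal{H}}$ for every $\nu\ge 2$.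
   Context: The system is defined on a filtered probability space $(\Omega,\mathcal{F},\{\mathcal{F}_t\}_{t\ge t_0},\mathbb{P})$, $W$ is an $\mathcal{H}$-valued Brownian motion, and $Y_0,X_0\in\mathcal{H}$. $\|\cdot\|_{HS}$ is the Hilbert–Schmidt norm on $\mathcal{L}(\mathcal{H},\mathcal{H})$. $V$ monotone means $\langle V(y)-V(x),y-x\rangle\ge 0$ for all $x,y\in\mathcal{H}$. Strong solution: for a stochastic differential equation $dX(t)=F(t,X(t))dt+G(t,X(t))dW(t)$, $X(t_0)=X_0$ on $[t_0,+\infty)$ in a Hilbert space, a stochastic process $X$ is a strong solution if (i) $X$ is continuous on $[t_0,+\infty)$ almost surely; (ii) for every $t\ge t_0$, $\int_{t_0}^t(\|F(s,X(s))\|+\|G(s,X(s))\|_{HS}^2)ds<+\infty$ almost surely; (iii) for every $t\ge t_0$, $X(t)=X(t_0)+\int_{t_0}^tF(s,X(s))ds+\int_{t_0}^tG(s,X(s))dW(s)$ almost surely. Here this is applied to the pair $(Y,Z)$ in $\mathcal{H}\times\mathcal{H}$. Uniqueness is in the usual pathwise sense. For a Hilbert space $\mathcal{K}$ and $\nu>0$, $S^\nu_{\mathcal{K}}$ is the class of progressively measurable continuous $\mathcal{K}$-valued processes $X$ on $[t_0,+\infty)$ (up to the usual identification of processes) such that $\mathbb{E}\big(\sup_{t\in[t_0,T]}\|X(t)\|^\nu\big)<+\infty$ for every $T\ge t_0$. *)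

theory Defs
  imports "HOL-Probability.Probability"
begin

text \<open>
  Separable real Hilbert spaces are types of sort
  \<open>{real_inner, banach, second_countable_topology}\<close>; bounded operators are \<open>'a \<Rightarrow>\<^sub>L 'b\<close>.
\<close>

section \<open>Hilbert--Schmidt norm\<close>

definition orthonormal_basis :: "'a::real_inner set \<Rightarrow> bool" where
  "orthonormal_basis B \<longleftrightarrow>
     pairwise orthogonal B \<and> (\<forall>e\<in>B. norm e = 1) \<and> closure (span B) = UNIV"

text \<open>
  The value does not depend on the basis. It is \<open>\<infinity>\<close> exactly when the operator is not
  Hilbert--Schmidt, so an inequality \<open>hs_norm A \<le> ennreal c\<close> includes the statement that
  \<open>A\<close> is Hilbert--Schmidt.
\<close>

definition hs_norm ::
  "('a::{real_inner,banach,second_countable_topology} \<Rightarrow>\<^sub>L 'b::real_inner) \<Rightarrow> ennreal" where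
  "hs_norm A =
     (let s = (\<Sum>\<^sub>\<infinity>e\<in>(SOME B. orthonormal_basis B). ennreal ((norm (blinfun_apply A e))\<^sup>2))
      in if s = \<infinity> then \<infinity> else ennreal (sqrt (enn2real s)))"

section \<open>Filtrations and processes on a half line\<close>

text \<open>
  Time is \<open>real\<close>; values at times before \<open>t0\<close> are irrelevant everywhere below.
  No completeness or right-continuity of the filtration is required; accordingly, path
  continuity is always understood almost surely.
\<close>

definition filtration_from :: "'w measure \<Rightarrow> real \<Rightarrow> (real \<Rightarrow> 'w measure) \<Rightarrow> bool" where
  "filtration_from M t0 Fil \<longleftrightarrow>
     (\<forall>t\<ge>t0. subalgebra M (Fil t)) \<and>
     (\<forall>s t. t0 \<le> s \<longrightarrow> s \<le> t \<longrightarrow> subalgebra (Fil t) (Fil s))"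

definition progressively_measurable ::
  "real \<Rightarrow> (real \<Rightarrow> 'w measure) \<Rightarrow> (real \<Rightarrow> 'w \<Rightarrow> 'a::topological_space) \<Rightarrow> bool" where
  "progressively_measurable t0 Fil X \<longleftrightarrow>
     (\<forall>T\<ge>t0. (\<lambda>(s, \<omega>). X s \<omega>)
        \<in> borel_measurable (restrict_space borel {t0..T} \<Otimes>\<^sub>M Fil T))"

definition S_class ::
  "'w measure \<Rightarrow> real \<Rightarrow> (real \<Rightarrow> 'w measure) \<Rightarrow> real
    \<Rightarrow> (real \<Rightarrow> 'w \<Rightarrow> 'a::real_normed_vector) set" where
  "S_class M t0 Fil \<nu> =
     {X. progressively_measurable t0 Fil X \<and>
         (AE \<omega> in M. continuous_on {t0..} (\<lambda>t. X t \<omega>)) \<and>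
         (\<forall>T\<ge>t0. (\<integral>\<^sup>+\<omega>. (SUP t\<in>{t0..T}. ennreal (norm (X t \<omega>) powr \<nu>)) \<partial>M) < \<infinity>)}"

definition indistinguishable_from ::
  "'w measure \<Rightarrow> real \<Rightarrow> (real \<Rightarrow> 'w \<Rightarrow> 'a) \<Rightarrow> (real \<Rightarrow> 'w \<Rightarrow> 'a) \<Rightarrow> bool" where
  "indistinguishable_from M t0 X X' \<longleftrightarrow> (AE \<omega> in M. \<forall>t\<ge>t0. X t \<omega> = X' t \<omega>)"

section \<open>Brownian motion\<close>

text \<open>The degenerate law at variance 0 is a point mass and has no density.\<close>

definition centred_gaussian :: "'w measure \<Rightarrow> ('w \<Rightarrow> real) \<Rightarrow> real \<Rightarrow> bool" where
  "centred_gaussian M X v \<longleftrightarrow>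
     X \<in> borel_measurable M \<and>
     (if v = 0 then (AE \<omega> in M. X \<omega> = 0)
      else v > 0 \<and> distributed M lborel X (normal_density 0 (sqrt v)))"

text \<open>
  A Brownian motion on a Hilbert space, with covariance operator \<open>Q\<close>, is given through its
  coordinate processes: \<open>W t h \<omega>\<close> stands for the inner product of \<open>W(t)\<close> with \<open>h\<close>.
  If \<open>Q\<close> is the identity this is (cylindrical) Brownian motion, which for finite-dimensional
  spaces is standard Brownian motion and in infinite dimension has no values in the space
  itself. A space-valued Brownian motion \<open>B\<close> (then \<open>Q\<close> is of trace class) is the instance
  \<open>W t h \<omega> = B t \<omega> \<bullet> h\<close>.

  By linearity in \<open>h\<close>, independence of every single coordinate increment from the past gives
  independence of the whole family of coordinate increments from the past.
\<close>

definition brownian_motion ::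
  "'w measure \<Rightarrow> real \<Rightarrow> (real \<Rightarrow> 'w measure) \<Rightarrow> ('h::real_inner \<Rightarrow> 'h)
    \<Rightarrow> (real \<Rightarrow> 'h \<Rightarrow> 'w \<Rightarrow> real) \<Rightarrow> bool" where
  "brownian_motion M t0 Fil Q W \<longleftrightarrow>
     bounded_linear Q \<and> (\<forall>h k. Q h \<bullet> k = h \<bullet> Q k) \<and>
     (\<forall>t\<ge>t0. \<forall>a b h k. AE \<omega> in M.
        W t (a *\<^sub>R h + b *\<^sub>R k) \<omega> = a * W t h \<omega> + b * W t k \<omega>) \<and>
     (\<forall>h. AE \<omega> in M. W t0 h \<omega> = 0) \<and>
     (\<forall>h. AE \<omega> in M. continuous_on {t0..} (\<lambda>t. W t h \<omega>)) \<and>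
     (\<forall>t\<ge>t0. \<forall>h. W t h \<in> borel_measurable (Fil t)) \<and>
     (\<forall>s t h. t0 \<le> s \<longrightarrow> s < t \<longrightarrow>
        centred_gaussian M (\<lambda>\<omega>. W t h \<omega> - W s h \<omega>) ((t - s) * (Q h \<bullet> h)) \<and>
        prob_space.indep_set M (sets (Fil s))
          {(\<lambda>\<omega>. W t h \<omega> - W s h \<omega>) -` B \<inter> space M |B. B \<in> sets borel})"

section \<open>Stochastic integral\<close>

text \<open>
  A list of tuples \<open>(a, b, \<xi>, h, k)\<close> encodes the elementary operator-valued process
  \<open>\<Sum> 1\<^bsub>(a,b]\<^esub>(s) \<xi>(\<omega>) k \<otimes> h\<close>, where \<open>(k \<otimes> h) x = (x \<bullet> h) k\<close> and \<open>\<xi>\<close> is bounded and known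
  at time \<open>a\<close>.
\<close>

type_synonym ('w, 'h, 'k) elementary = "(real \<times> real \<times> ('w \<Rightarrow> real) \<times> 'h \<times> 'k) list"

definition elementary_process ::
  "'w measure \<Rightarrow> real \<Rightarrow> (real \<Rightarrow> 'w measure) \<Rightarrow> ('w, 'h, 'k) elementary \<Rightarrow> bool" where
  "elementary_process M t0 Fil E \<longleftrightarrow>
     (\<forall>(a, b, \<xi>, h, k)\<in>set E.
        t0 \<le> a \<and> a \<le> b \<and> \<xi> \<in> borel_measurable (Fil a) \<and> bounded (\<xi> ` space M))"

definition elementary_value ::
  "('w, 'h::real_inner, 'k::real_normed_vector) elementary \<Rightarrow> real \<Rightarrow> 'w \<Rightarrow> ('h \<Rightarrow>\<^sub>L 'k)" where
  "elementary_value E s \<omega> =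
     (\<Sum>(a, b, \<xi>, h, k)\<leftarrow>E.
        (indicator {a<..b} s * \<xi> \<omega>) *\<^sub>R (blinfun_scaleR_left k o\<^sub>L blinfun_inner_left h))"

definition elementary_integral ::
  "(real \<Rightarrow> 'h \<Rightarrow> 'w \<Rightarrow> real) \<Rightarrow> ('w, 'h, 'k::real_normed_vector) elementary
    \<Rightarrow> real \<Rightarrow> 'w \<Rightarrow> 'k" where
  "elementary_integral W E t \<omega> =
     (\<Sum>(a, b, \<xi>, h, k)\<leftarrow>E. (\<xi> \<omega> * (W (min b t) h \<omega> - W (min a t) h \<omega>)) *\<^sub>R k)"

definition vanishes_in_probability :: "'w measure \<Rightarrow> (nat \<Rightarrow> 'w \<Rightarrow> ennreal) \<Rightarrow> bool" where
  "vanishes_in_probability M D \<longleftrightarrow>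
     (\<forall>n. D n \<in> borel_measurable M) \<and>
     (\<forall>\<epsilon>>0. (\<lambda>n. measure M {\<omega> \<in> space M. D n \<omega> > ennreal \<epsilon>}) \<longlonglongrightarrow> 0)"

text \<open>
  \<open>has_ito_integral M t0 Fil W \<Phi> t I\<close>: the random variable \<open>I\<close> is a version of
  \<open>\<integral>\<^bsub>t0\<^esub>\<^bsup>t\<^esup> \<Phi>(s) dW(s)\<close>, i.e. the limit in probability of the integrals of elementary processes
  that approximate \<open>\<Phi>\<close> in the Hilbert--Schmidt \<open>L\<^sup>2\<close> sense, in probability. It is unique up to
  null sets. Measurability of the integrand is required pointwise, since the space of bounded
  operators with the operator norm is not separable; on the (separable) Hilbert--Schmidt class
  the two notions agree.
\<close>

definition has_ito_integral ::
  "'w measure \<Rightarrow> real \<Rightarrow> (real \<Rightarrow> 'w measure) \<Rightarrow> (real \<Rightarrow> 'h \<Rightarrow> 'w \<Rightarrow> real)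
    \<Rightarrow> (real \<Rightarrow> 'w \<Rightarrow> ('h::{real_inner,banach,second_countable_topology} \<Rightarrow>\<^sub>L
                      'k::{real_inner,banach,second_countable_topology}))
    \<Rightarrow> real \<Rightarrow> ('w \<Rightarrow> 'k) \<Rightarrow> bool" where
  "has_ito_integral M t0 Fil W \<Phi> t I \<longleftrightarrow>
     (\<forall>h. progressively_measurable t0 Fil (\<lambda>s \<omega>. blinfun_apply (\<Phi> s \<omega>) h)) \<and>
     I \<in> borel_measurable M \<and>
     (\<exists>E. (\<forall>n. elementary_process M t0 Fil (E n)) \<and>
          vanishes_in_probability M
            (\<lambda>n \<omega>. \<integral>\<^sup>+s\<in>{t0..t}. (hs_norm (elementary_value (E n) s \<omega> - \<Phi> s \<omega>))\<^sup>2 \<partial>lborel) \<and>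
          vanishes_in_probability M
            (\<lambda>n \<omega>. ennreal (dist (elementary_integral W (E n) t \<omega>) (I \<omega>))))"

section \<open>Strong solutions\<close>

text \<open>
  Strong solutions of \<open>dX = F(t,X) dt + G(t,X) dW\<close>, \<open>X(t0) = x0\<close>. Integrability of the drift is
  \<open>set_integrable\<close>, i.e. measurability together with finiteness of the integral of the norm.
\<close>

definition strong_solution ::
  "'w measure \<Rightarrow> real \<Rightarrow> (real \<Rightarrow> 'w measure) \<Rightarrow> (real \<Rightarrow> 'h \<Rightarrow> 'w \<Rightarrow> real)
    \<Rightarrow> (real \<Rightarrow> 'k \<Rightarrow> 'k)
    \<Rightarrow> (real \<Rightarrow> 'k \<Rightarrow> ('h::{real_inner,banach,second_countable_topology} \<Rightarrow>\<^sub>L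
                      'k::{real_inner,banach,second_countable_topology}))
    \<Rightarrow> 'k \<Rightarrow> (real \<Rightarrow> 'w \<Rightarrow> 'k) \<Rightarrow> bool" where
  "strong_solution M t0 Fil W F G x0 X \<longleftrightarrow>
     (\<forall>t\<ge>t0. X t \<in> borel_measurable (Fil t)) \<and>
     (AE \<omega> in M. X t0 \<omega> = x0) \<and>
     (AE \<omega> in M. continuous_on {t0..} (\<lambda>t. X t \<omega>)) \<and>
     (\<forall>t\<ge>t0. AE \<omega> in M.
        set_integrable lborel {t0..t} (\<lambda>s. F s (X s \<omega>)) \<and>
        (\<integral>\<^sup>+s\<in>{t0..t}. (hs_norm (G s (X s \<omega>)))\<^sup>2 \<partial>lborel) < \<infinity>) \<and>
     (\<forall>t\<ge>t0. \<exists>I. has_ito_integral M t0 Fil W (\<lambda>s \<omega>. G s (X s \<omega>)) t I \<and>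
        (AE \<omega> in M. X t \<omega> = X t0 \<omega> + (LINT s:{t0..t}|lborel. F s (X s \<omega>)) + I \<omega>))"

section \<open>The system\<close>

text \<open>\<open>\<mu>'\<close> is the derivative of \<open>\<mu>\<close>.\<close>

definition system_drift ::
  "('h::real_vector \<Rightarrow> 'h) \<Rightarrow> real \<Rightarrow> (real \<Rightarrow> real) \<Rightarrow> (real \<Rightarrow> real) \<Rightarrow> (real \<Rightarrow> real)
    \<Rightarrow> real \<Rightarrow> 'h \<times> 'h \<Rightarrow> 'h \<times> 'h" where
  "system_drift V lam \<mu> \<mu>' \<gamma> t = (\<lambda>(y, z).
     (z - \<mu> t *\<^sub>R V y, - lam *\<^sub>R z + (lam * \<mu> t - \<gamma> t + \<mu>' t) *\<^sub>R V y))"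

definition system_diffusion ::
  "(real \<Rightarrow> ('h::real_normed_vector \<Rightarrow>\<^sub>L 'h)) \<Rightarrow> real \<Rightarrow> 'h \<times> 'h \<Rightarrow> ('h \<Rightarrow>\<^sub>L ('h \<times> 'h))" where
  "system_diffusion \<sigma> t = (\<lambda>_. Blinfun (\<lambda>h. (0, blinfun_apply (\<sigma> t) h)))"

lemma system_diffusion_apply:
  "blinfun_apply (system_diffusion \<sigma> t x) h = (0, blinfun_apply (\<sigma> t) h)"
  unfolding system_diffusion_def
  by (simp add: bounded_linear_Blinfun_apply bounded_linear_Pair blinfun.bounded_linear_right)

end

theory Submission
  imports Defs
begin

text \<open>
  The noise is additive with a deterministic integrand, so the whole stochastic content lies in the
  process \<open>I(t) = \<integral> \<Phi> dW\<close>: once \<open>I\<close> is known to be continuous with moments of all orders, the equation is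
  an ordinary integral equation for almost every path. It has a locally Lipschitz drift and is solved
  by Picard iteration, which preserves progressive measurability; Gronwall's inequality gives
  uniqueness and the bound of \<open>sup \<bar>X\<bar>\<close> by \<open>sup \<bar>I\<bar>\<close>.

  All estimates for stochastic integrals \<open>J\<close> of elementary processes come from the exponential
  supermartingale \<open>exp (J \<bullet> k - \<kappa>/2 \<integral> \<bar>u\<bar>\<^sup>2)\<close>, where \<open>u\<close> is the adjoint of the integrand applied to \<open>k\<close>
  and \<open>\<kappa>\<close> bounds the covariance \<open>Q\<close>. By Markov's inequality it shows that the stochastic integral
  is well defined; for deterministic integrands Doob's
  \<open>L\<^sup>2\<close> inequality for \<open>2 cosh (J \<bullet> f / sqrt v)\<close> bounds all moments of the supremum, first in each
  coordinate and then, by Jensen's inequality, in norm. Hence the integrals of elementary processes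
  approximating \<open>\<Phi>\<close> fast enough converge uniformly on compact time intervals.

  The filtration is not assumed complete. Adapted almost surely continuous processes are therefore
  replaced by limits of left-endpoint step processes, which are progressively measurable everywhere.
\<close>

section \<open>Orthonormal bases and the Hilbert--Schmidt norm\<close>

text \<open>The exponential is convenient because it asks for nothing but Laplace transforms of
  single coordinates of \<open>W\<close>. A combination of coordinate increments with fixed
  coefficients is almost surely one increment in the combined direction, so joint laws and an
  isometry never enter, and of \<open>Q\<close> only the bounds
  \<open>0 \<le> Q h \<bullet> h\<close> and
  \<open>Q h \<bullet> h \<le> \<kappa> * (norm h)\<^sup>2\<close> are used. Conditional
  expectations do not enter either: a super- or submartingale inequality from s to t is an
  inequality of integrals against every nonnegative weight \<open>\<zeta>\<close> known at time s,
  and such inequalities compose along a partition.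

  \<open>has_ito_integral\<close> admits random elementary approximants even when the integrand is
  deterministic. Uniqueness of the integral therefore has to treat random coefficients, while
  existence may choose deterministic ones. Hence the upper bound for the exponential is proved for
  all elementary processes, and the lower bound behind Doob's inequality for those with
  \<open>det_process\<close>.\<close>

text \<open>Gram-Schmidt along a dense sequence \<open>d\<close>. When \<open>d n\<close> lies in
  the span of its predecessors, the remainder is 0 and \<open>nrm 0 = 0\<close>; these zeros are
  discarded from \<open>B\<close> at the end.\<close>

lemma orthonormal_basis_exists:
  "\<exists>B::'a::{real_inner,second_countable_topology} set. orthonormal_basis B"
proof -
  obtain D :: "'a set" where D: "countable D" "\<And>X. open X \<Longrightarrow> X \<noteq> {} \<Longrightarrow> \<exists>d\<in>D. d \<in> X"
    using countable_dense_exists by blast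
  then have "D \<noteq> {}"
    by (metis UNIV_not_empty empty_iff open_UNIV)
  define d where "d = from_nat_into D"
  have rd: "range d = D"
    unfolding d_def using D(1) \<open>D \<noteq> {}\<close> by (rule range_from_nat_into[rotated])
  define nrm :: "'a \<Rightarrow> 'a" where "nrm x = x /\<^sub>R norm x" for x
  define step :: "'a list \<Rightarrow> nat \<Rightarrow> 'a" where
    "step xs n = nrm (d n - (\<Sum>x\<leftarrow>xs. (d n \<bullet> x) *\<^sub>R x))" for xs n
  \<comment> \<open>Carrying the whole list of earlier vectors makes the course-of-values recursion
    primitive recursive; \<open>g\<close> reads off the n-th vector.\<close>
  define gs where "gs = rec_nat [] (\<lambda>n xs. xs @ [step xs n])"
  have gs0: "gs 0 = []" and gsS: "gs (Suc n) = gs n @ [step (gs n) n]" for n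
    by (simp_all add: gs_def)
  define g where "g n = step (gs n) n" for n
  have gs_eq: "gs n = map g [0..<n]" for n
    by (induction n) (simp_all add: gs0 gsS g_def)
  have g_eq: "g n = nrm (d n - (\<Sum>k<n. (d n \<bullet> g k) *\<^sub>R g k))" for n
    by (simp add: g_def[of n] step_def gs_eq sum_list_distinct_conv_sum_set atLeast0LessThan o_def)
  have inner_nrm: "nrm x \<bullet> y = (x \<bullet> y) / norm x" for x y
    by (simp add: nrm_def divide_inverse mult.commute)
  have norm_g: "norm (g n) = 1 \<or> g n = 0" for n
    unfolding g_eq[of n] nrm_def by auto
  have ortho: "\<forall>k<n. g n \<bullet> g k = 0" for n
  proof (induction n rule: less_induct)
    case (less n)
    have "(d n - (\<Sum>k<n. (d n \<bullet> g k) *\<^sub>R g k)) \<bullet> g j = 0" if "j < n" for j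
    proof -
      have "(\<Sum>k<n. (d n \<bullet> g k) *\<^sub>R g k) \<bullet> g j = (\<Sum>k<n. (d n \<bullet> g k) * (g k \<bullet> g j))"
        by (simp add: inner_sum_left)
      also have "\<dots> = (\<Sum>k<n. if k = j then (d n \<bullet> g j) * (g j \<bullet> g j) else 0)"
      proof (intro sum.cong refl)
        fix k assume "k \<in> {..<n}"
        then have "k \<noteq> j \<Longrightarrow> g k \<bullet> g j = 0"
          using less \<open>j < n\<close> by (metis inner_commute lessThan_iff linorder_neqE_nat)
        then show "(d n \<bullet> g k) * (g k \<bullet> g j) = (if k = j then (d n \<bullet> g j) * (g j \<bullet> g j) else 0)"
          by auto
      qed
      also have "\<dots> = (d n \<bullet> g j) * (g j \<bullet> g j)"
        using that by simp
      also have "\<dots> = d n \<bullet> g j"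
        using norm_g[of j] by (auto simp: dot_square_norm)
      finally show ?thesis
        by (simp add: inner_diff_left)
    qed
    then show ?case
      by (simp add: g_eq[of n] inner_nrm)
  qed
  define B where "B = range g - {0}"
  have pw: "pairwise orthogonal B"
    unfolding pairwise_def orthogonal_def B_def
  proof safe
    fix x i j assume "g i \<noteq> g j"
    then have "i < j \<or> j < i"
      by (metis linorder_neqE_nat)
    then show "g i \<bullet> g j = 0"
      using ortho by (metis inner_commute)
  qed
  have gspan: "g n \<in> span B" for n
    by (cases "g n = 0") (auto simp: B_def span_zero intro: span_base)
  have "d n \<in> span B" for n
  proof -
    define r where "r = d n - (\<Sum>k<n. (d n \<bullet> g k) *\<^sub>R g k)"
    have "r = norm r *\<^sub>R g n"
      unfolding g_eq[of n] r_def[symmetric] nrm_def by (cases "r = 0") auto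
    then have "r \<in> span B"
      using gspan by (metis span_scale)
    moreover have "(\<Sum>k<n. (d n \<bullet> g k) *\<^sub>R g k) \<in> span B"
      by (intro span_sum span_scale gspan)
    ultimately have "r + (\<Sum>k<n. (d n \<bullet> g k) *\<^sub>R g k) \<in> span B"
      by (rule span_add)
    then show ?thesis by (simp add: r_def)
  qed
  then have "D \<subseteq> span B"
    using rd by auto
  moreover have "closure D = UNIV"
  proof -
    have "x \<in> closure D" for x
    proof (rule ccontr)
      assume "x \<notin> closure D"
      then obtain y where "y \<in> D" "y \<in> - closure D"
        using D(2)[of "- closure D"] by auto
      then show False
        using closure_subset by auto
    qed
    then show ?thesis by auto
  qed
  ultimately have "closure (span B) = UNIV"
    by (metis closure_mono top.extremum_uniqueI)
  then have "orthonormal_basis B"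
    using pw norm_g by (auto simp: orthonormal_basis_def B_def)
  then show ?thesis ..
qed

text \<open>The same choice term as inside \<open>hs_norm\<close>, so the two can be compared
  without showing independence of the basis.\<close>

definition the_basis :: "'a::{real_inner,banach,second_countable_topology} set" where
  "the_basis = (SOME B. orthonormal_basis B)"

lemma the_basis: "orthonormal_basis the_basis"
  unfolding the_basis_def by (rule someI_ex) (rule orthonormal_basis_exists)

lemma orthonormal_basis_inner:
  assumes "orthonormal_basis B" "e \<in> B" "f \<in> B"
  shows "e \<bullet> f = (if e = f then 1 else 0)"
  using assms by (auto simp: orthonormal_basis_def pairwise_def orthogonal_def dot_square_norm)

text \<open>Distinct members have distance \<open>sqrt 2 > 1\<close>, so the balls of radius 1/2
  around them are disjoint, and a separable space has only countably many disjoint open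
  sets.\<close>

lemma orthonormal_basis_countable:
  fixes B :: "'a::{real_inner,second_countable_topology} set"
  assumes "orthonormal_basis B"
  shows "countable B"
proof -
  have dist: "dist e f > 1" if "e \<in> B" "f \<in> B" "e \<noteq> f" for e f
  proof -
    have "(norm (e - f))\<^sup>2 = 2"
      using that orthonormal_basis_inner[OF assms]
      by (simp add: power2_norm_eq_inner inner_diff_left inner_diff_right)
    then show ?thesis
      by (smt (verit) dist_norm norm_ge_zero power2_eq_square mult_le_one)
  qed
  let ?F = "(\<lambda>e. ball e (1/2)) ` B"
  have "disjoint_family_on (\<lambda>e. ball e (1/2)) B"
    unfolding disjoint_family_on_def
  proof (safe, goal_cases)
    case (1 e f x)
    then have "dist e f < 1"
      by (metis dist_commute dist_triangle_half_r mem_ball)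
    then show ?case using dist 1 by fastforce
  qed
  then have "countable ?F"
    by (intro countable_disjoint_open_subsets) (auto simp: disjoint_family_on_disjoint_image)
  moreover have "inj_on (\<lambda>e. ball e (1/2)) B"
  proof (rule inj_onI, rule ccontr)
    fix e f assume *: "e \<in> B" "f \<in> B" "ball e (1/2) = ball f (1/2)" "e \<noteq> f"
    have "e \<in> ball f (1/2)"
      unfolding *(3)[symmetric] by simp
    then show False
      using dist[OF *(1,2,4)] by (simp add: dist_commute)
  qed
  ultimately show ?thesis
    by (rule countable_image_inj_on)
qed

lemma countable_the_basis: "countable the_basis"
  by (rule orthonormal_basis_countable[OF the_basis])

text \<open>Completing the square in every coefficient. With \<open>c e = x \<bullet> e\<close> this
  is Bessel's inequality; for general \<open>c\<close> it says that no other coefficients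
  approximate \<open>x\<close> better, which gives the converse half of Parseval.\<close>

lemma orthonormal_finite_sum:
  assumes B: "orthonormal_basis B" and A: "finite A" "A \<subseteq> B"
  shows "(norm (x - (\<Sum>e\<in>A. c e *\<^sub>R e)))\<^sup>2
      = (norm x)\<^sup>2 - (\<Sum>e\<in>A. (x \<bullet> e)\<^sup>2) + (\<Sum>e\<in>A. (c e - x \<bullet> e)\<^sup>2)"
proof -
  let ?s = "\<Sum>e\<in>A. c e *\<^sub>R e"
  have 1: "x \<bullet> ?s = (\<Sum>e\<in>A. c e * (x \<bullet> e))"
    by (simp add: inner_sum_right)
  have 2: "?s \<bullet> ?s = (\<Sum>e\<in>A. (c e)\<^sup>2)"
  proof -
    have "?s \<bullet> ?s = (\<Sum>e\<in>A. \<Sum>f\<in>A. c e * c f * (e \<bullet> f))"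
      by (simp add: inner_sum_right inner_sum_left sum_distrib_left mult_ac inner_commute)
    also have "\<dots> = (\<Sum>e\<in>A. \<Sum>f\<in>A. if f = e then (c e)\<^sup>2 else 0)"
      using A by (intro sum.cong refl) (auto simp: orthonormal_basis_inner[OF B] subset_iff power2_eq_square)
    also have "\<dots> = (\<Sum>e\<in>A. (c e)\<^sup>2)"
      using A(1) by simp
    finally show ?thesis .
  qed
  have "(norm (x - ?s))\<^sup>2 = x \<bullet> x - 2 * (x \<bullet> ?s) + ?s \<bullet> ?s"
    by (simp add: power2_norm_eq_inner inner_diff_left inner_diff_right inner_commute)
  also have "\<dots> = (norm x)\<^sup>2 - (\<Sum>e\<in>A. (x \<bullet> e)\<^sup>2) + (\<Sum>e\<in>A. (c e - x \<bullet> e)\<^sup>2)"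
    unfolding 1 2 power2_norm_eq_inner
    by (simp add: power2_diff sum.distrib sum_subtractf sum_distrib_left mult_ac)
  finally show ?thesis .
qed

section \<open>Basis sums as integrals over counting measure; Parseval's identity\<close>

lemma nn_integral_count_space_finite_le:
  fixes f :: "'a \<Rightarrow> ennreal"
  assumes "\<And>A. finite A \<Longrightarrow> A \<subseteq> B \<Longrightarrow> (\<Sum>x\<in>A. f x) \<le> c" and "countable B"
  shows "(\<integral>\<^sup>+x. f x \<partial>count_space B) \<le> c"
proof (cases "finite B")
  case True
  then show ?thesis using assms by (simp add: nn_integral_count_space_finite)
next
  case False
  have bij: "bij_betw (from_nat_into B) UNIV B"
    using bij_betw_from_nat_into assms(2) False by blast
  have "(\<integral>\<^sup>+x. f x \<partial>count_space B) = (\<integral>\<^sup>+n. f (from_nat_into B n) \<partial>count_space UNIV)"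
    by (rule nn_integral_bij_count_space[OF bij, symmetric])
  also have "\<dots> = (\<Sum>n. f (from_nat_into B n))"
    by (rule nn_integral_count_space_nat)
  also have "\<dots> \<le> c"
  proof (rule suminf_le_const)
    fix n
    have inj: "inj_on (from_nat_into B) {..<n}"
      using bij by (meson bij_betw_def inj_on_subset subset_UNIV)
    have "(\<Sum>n<n. f (from_nat_into B n)) = (\<Sum>x\<in>from_nat_into B ` {..<n}. f x)"
      by (simp add: sum.reindex[OF inj])
    also have "\<dots> \<le> c"
      using bij by (intro assms) (auto simp: bij_betw_def)
    finally show "(\<Sum>n<n. f (from_nat_into B n)) \<le> c" .
  qed auto
  finally show ?thesis .
qed

lemma nn_integral_count_space_ge_sum:
  fixes f :: "'a \<Rightarrow> ennreal"
  assumes "finite A" "A \<subseteq> B"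
  shows "(\<Sum>x\<in>A. f x) \<le> (\<integral>\<^sup>+x. f x \<partial>count_space B)"
proof -
  have "(\<Sum>x\<in>A. f x) = (\<integral>\<^sup>+x. f x \<partial>count_space A)"
    by (simp add: nn_integral_count_space_finite assms)
  also have "\<dots> = (\<integral>\<^sup>+x. f x * indicator A x \<partial>count_space B)"
    using assms by (simp add: nn_integral_restrict_space[symmetric] restrict_count_space Int_absorb2)
  also have "\<dots> \<le> (\<integral>\<^sup>+x. f x \<partial>count_space B)"
    by (intro nn_integral_mono) (auto simp: indicator_def)
  finally show ?thesis .
qed

text \<open>Bessel's inequality is one direction. For the other, finite combinations are dense and
  the Fourier coefficients do at least as well as theirs. The integral form lets Tonelli interchange
  several basis sums later.\<close>

lemma parseval:
  fixes B :: "'a::{real_inner,second_countable_topology} set"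
  assumes B: "orthonormal_basis B"
  shows "(\<integral>\<^sup>+e. ennreal ((x \<bullet> e)\<^sup>2) \<partial>count_space B) = ennreal ((norm x)\<^sup>2)"
proof (rule antisym)
  show "(\<integral>\<^sup>+e. ennreal ((x \<bullet> e)\<^sup>2) \<partial>count_space B) \<le> ennreal ((norm x)\<^sup>2)"
  proof (rule nn_integral_count_space_finite_le[OF _ orthonormal_basis_countable[OF B]])
    fix A assume A: "finite A" "A \<subseteq> B"
    have "0 \<le> (norm (x - (\<Sum>e\<in>A. (x \<bullet> e) *\<^sub>R e)))\<^sup>2"
      by simp
    then have "0 \<le> (norm x)\<^sup>2 - (\<Sum>e\<in>A. (x \<bullet> e)\<^sup>2)"
      unfolding orthonormal_finite_sum[OF B A] by simp
    then show "(\<Sum>e\<in>A. ennreal ((x \<bullet> e)\<^sup>2)) \<le> ennreal ((norm x)\<^sup>2)"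
      by (simp add: sum_ennreal ennreal_leI)
  qed
  show "ennreal ((norm x)\<^sup>2) \<le> (\<integral>\<^sup>+e. ennreal ((x \<bullet> e)\<^sup>2) \<partial>count_space B)"
  proof (rule ennreal_le_epsilon)
    fix \<epsilon> :: real assume "\<epsilon> > 0"
    have "x \<in> closure (span B)" using B by (simp add: orthonormal_basis_def)
    then obtain y where y: "y \<in> span B" "dist y x < sqrt \<epsilon>"
      unfolding closure_approachable using \<open>\<epsilon> > 0\<close> by (meson real_sqrt_gt_zero)
    obtain A c where A: "finite A" "A \<subseteq> B" "y = (\<Sum>e\<in>A. c e *\<^sub>R e)"
      using y(1) unfolding span_explicit by blast
    have "(norm x)\<^sup>2 - (\<Sum>e\<in>A. (x \<bullet> e)\<^sup>2) \<le> (norm (x - y))\<^sup>2"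
      unfolding A(3) orthonormal_finite_sum[OF B A(1,2)] by (simp add: sum_nonneg)
    also have "\<dots> \<le> \<epsilon>"
      using y(2) \<open>\<epsilon> > 0\<close> by (metis dist_commute dist_norm less_eq_real_def norm_ge_zero
          real_sqrt_pow2 power_mono)
    finally have "(norm x)\<^sup>2 \<le> (\<Sum>e\<in>A. (x \<bullet> e)\<^sup>2) + \<epsilon>" by simp
    then have "ennreal ((norm x)\<^sup>2) \<le> (\<Sum>e\<in>A. ennreal ((x \<bullet> e)\<^sup>2)) + ennreal \<epsilon>"
      using \<open>\<epsilon> > 0\<close> by (simp add: sum_ennreal sum_nonneg flip: ennreal_plus)
    also have "\<dots> \<le> (\<integral>\<^sup>+e. ennreal ((x \<bullet> e)\<^sup>2) \<partial>count_space B) + ennreal \<epsilon>"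
      by (intro add_right_mono nn_integral_count_space_ge_sum A)
    finally show "ennreal ((norm x)\<^sup>2) \<le> (\<integral>\<^sup>+e. ennreal ((x \<bullet> e)\<^sup>2) \<partial>count_space B) + ennreal \<epsilon>" .
  qed
qed

lemma infsum_ennreal_eq_nn_integral:
  fixes f :: "'a \<Rightarrow> ennreal"
  assumes "countable B"
  shows "infsum f B = (\<integral>\<^sup>+x. f x \<partial>count_space B)"
proof (cases "finite B")
  case True
  then show ?thesis by (simp add: nn_integral_count_space_finite)
next
  case False
  have bij: "bij_betw (from_nat_into B) UNIV B"
    using bij_betw_from_nat_into assms False by blast
  have "(\<integral>\<^sup>+x. f x \<partial>count_space B) = (\<integral>\<^sup>+n. f (from_nat_into B n) \<partial>count_space UNIV)"
    by (rule nn_integral_bij_count_space[OF bij, symmetric])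
  also have "\<dots> = (\<Sum>n. f (from_nat_into B n))"
    by (rule nn_integral_count_space_nat)
  also have "\<dots> = infsum (\<lambda>n. f (from_nat_into B n)) UNIV"
    by (intro sums_unique[symmetric] has_sum_imp_sums has_sum_infsum nonneg_summable_on_complete) auto
  also have "\<dots> = infsum f B"
    by (rule infsum_reindex_bij_betw[OF bij])
  finally show ?thesis by simp
qed

text \<open>The square of \<open>hs_norm\<close> without its case distinction at infinity, in a form
  to which Tonelli applies.\<close>

definition hs_sq ::
  "('a::{real_inner,banach,second_countable_topology} \<Rightarrow>\<^sub>L 'b::real_inner) \<Rightarrow> ennreal" where
  "hs_sq A = (\<integral>\<^sup>+e. ennreal ((norm (blinfun_apply A e))\<^sup>2) \<partial>count_space the_basis)"

lemma hs_norm_power2: "(hs_norm A)\<^sup>2 = hs_sq A"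
proof -
  have *: "(\<Sum>\<^sub>\<infinity>e\<in>(SOME B. orthonormal_basis B). ennreal ((norm (blinfun_apply A e))\<^sup>2)) = hs_sq A"
    unfolding the_basis_def[symmetric] hs_sq_def
    by (rule infsum_ennreal_eq_nn_integral[OF countable_the_basis])
  show ?thesis
    unfolding hs_norm_def * Let_def
    by (cases "hs_sq A = \<infinity>")
       (simp_all add: power2_eq_square less_top flip: ennreal_mult)
qed

section \<open>Exponential estimates for elementary integrals\<close>

lemma borel_measurable_sum_list [measurable (raw)]:
  fixes f :: "'i \<Rightarrow> 'a \<Rightarrow> 'b::{second_countable_topology, topological_comm_monoid_add}"
  assumes "\<And>x. x \<in> set xs \<Longrightarrow> f x \<in> borel_measurable M"
  shows "(\<lambda>\<omega>. \<Sum>x\<leftarrow>xs. f x \<omega>) \<in> borel_measurable M"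
  using assms by (induction xs) auto

text \<open>The identity map, read as a random element of \<open>F\<close> and of the sigma-algebra
  generated by \<open>X\<close>, turns independence of sigma-algebras into a product law for the
  pair; Tonelli then factorises the integral, with no integrability condition.\<close>

lemma (in prob_space) nn_integral_indep_product:
  fixes X :: "'a \<Rightarrow> real"
  assumes sub: "subalgebra M F" and X: "X \<in> borel_measurable M"
    and ind: "indep_set (sets F) {X -` B \<inter> space M |B. B \<in> sets borel}"
    and \<zeta>[measurable]: "\<zeta> \<in> borel_measurable F" and g[measurable]: "g \<in> borel_measurable borel"
  shows "(\<integral>\<^sup>+\<omega>. \<zeta> \<omega> * g (X \<omega>) \<partial>M) = (\<integral>\<^sup>+\<omega>. \<zeta> \<omega> \<partial>M) * (\<integral>\<^sup>+\<omega>. (g (X \<omega>) :: ennreal) \<partial>M)"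
proof -
  have sp: "space F = space M" and ss: "sets F \<subseteq> sets M"
    using sub by (auto simp: subalgebra_def)
  have id[measurable]: "(\<lambda>\<omega>. \<omega>) \<in> measurable M F"
    using sub by (auto simp: measurable_def subalgebra_def sets.Int_space_eq2)
  note X[measurable]
  define G where "G = vimage_algebra (space M) X borel"
  have setsG: "sets G = {X -` B \<inter> space M |B. B \<in> sets borel}" and spG: "space G = space M"
    by (simp_all add: G_def sets_vimage_algebra2)
  have XG[measurable]: "X \<in> borel_measurable G"
    unfolding G_def by (rule measurable_vimage_algebra1) simp
  have idG[measurable]: "(\<lambda>\<omega>. \<omega>) \<in> measurable M G"
    by (rule measurableI) (auto simp: spG setsG intro: measurable_sets[OF X])
  have *: "sigma_sets (space M) {(\<lambda>\<omega>. \<omega>) -` A \<inter> space M |A. A \<in> sets N} = sets N"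
    if N: "space N = space M" for N :: "'a measure"
  proof -
    have "{(\<lambda>\<omega>. \<omega>) -` A \<inter> space M |A. A \<in> sets N} = sets N"
      using sets.sets_into_space[of _ N] unfolding N
      by (auto simp: Int_absorb2)
    then show ?thesis
      using sets.sigma_sets_eq[of N] unfolding N by simp
  qed
  have "indep_var F (\<lambda>\<omega>. \<omega>) G (\<lambda>\<omega>. \<omega>)"
    unfolding indep_var_eq *[OF sp] *[OF spG] unfolding setsG using ind by simp
  then have eq: "distr M F (\<lambda>\<omega>. \<omega>) \<Otimes>\<^sub>M distr M G (\<lambda>\<omega>. \<omega>) = distr M (F \<Otimes>\<^sub>M G) (\<lambda>x. (x, x))"
    by (simp add: indep_var_distribution_eq)
  interpret X: prob_space "distr M G (\<lambda>\<omega>. \<omega>)" by (rule prob_space_distr) simp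
  have "(\<integral>\<^sup>+\<omega>. \<zeta> \<omega> * g (X \<omega>) \<partial>M)
      = (\<integral>\<^sup>+z. \<zeta> (fst z) * g (X (snd z)) \<partial>distr M (F \<Otimes>\<^sub>M G) (\<lambda>x. (x, x)))"
    by (subst nn_integral_distr) (auto simp: split_beta')
  also have "\<dots> = (\<integral>\<^sup>+\<omega>. \<integral>\<^sup>+x. \<zeta> \<omega> * g (X x) \<partial>distr M G (\<lambda>\<omega>. \<omega>) \<partial>distr M F (\<lambda>\<omega>. \<omega>))"
    unfolding eq[symmetric] by (subst X.nn_integral_fst[symmetric]) simp_all
  also have "\<dots> = (\<integral>\<^sup>+\<omega>. \<zeta> \<omega> * (\<integral>\<^sup>+x. g (X x) \<partial>distr M G (\<lambda>\<omega>. \<omega>)) \<partial>distr M F (\<lambda>\<omega>. \<omega>))"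
    by (simp add: nn_integral_cmult)
  also have "\<dots> = (\<integral>\<^sup>+\<omega>. \<zeta> \<omega> \<partial>distr M F (\<lambda>\<omega>. \<omega>)) * (\<integral>\<^sup>+x. g (X x) \<partial>distr M G (\<lambda>\<omega>. \<omega>))"
    by (rule nn_integral_multc) simp
  also have "\<dots> = (\<integral>\<^sup>+\<omega>. \<zeta> \<omega> \<partial>M) * (\<integral>\<^sup>+\<omega>. g (X \<omega>) \<partial>M)"
    by (simp add: nn_integral_distr)
  finally show ?thesis .
qed

text \<open>Exponential tilting: the centred density times \<open>exp x\<close> is
  \<open>exp (v / 2)\<close> times the normal density with the same variance and mean
  \<open>v\<close>.\<close>

lemma (in prob_space) nn_integral_exp_centred_gaussian:
  assumes "centred_gaussian M X v"
  shows "(\<integral>\<^sup>+\<omega>. ennreal (exp (X \<omega>)) \<partial>M) = ennreal (exp (v / 2))"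
proof (cases "v = 0")
  case True
  then have "AE \<omega> in M. ennreal (exp (X \<omega>)) = 1"
    using assms by (auto simp: centred_gaussian_def elim!: eventually_mono)
  then have "(\<integral>\<^sup>+\<omega>. ennreal (exp (X \<omega>)) \<partial>M) = (\<integral>\<^sup>+\<omega>. 1 \<partial>M)"
    by (rule nn_integral_cong_AE)
  then show ?thesis using True by (simp add: emeasure_space_1)
next
  case False
  then have v: "v > 0" and d: "distributed M lborel X (normal_density 0 (sqrt v))"
    using assms by (auto simp: centred_gaussian_def)
  have *: "normal_density 0 (sqrt v) x * exp x = exp (v / 2) * normal_density v (sqrt v) x" for x
  proof -
    have "- x\<^sup>2 / (2 * v) + x = v / 2 + (- (x - v)\<^sup>2 / (2 * v))"
      using v by (simp add: power2_eq_square field_simps)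
    then have "exp (- x\<^sup>2 / (2 * v)) * exp x = exp (v / 2) * exp (- (x - v)\<^sup>2 / (2 * v))"
      by (simp flip: exp_add)
    then show ?thesis
      using v by (simp add: normal_density_def)
  qed
  interpret N: prob_space "density lborel (normal_density v (sqrt v))"
    using v by (intro prob_space_normal_density) simp
  have "(\<integral>\<^sup>+\<omega>. ennreal (exp (X \<omega>)) \<partial>M)
      = (\<integral>\<^sup>+x. ennreal (normal_density 0 (sqrt v) x) * ennreal (exp x) \<partial>lborel)"
    by (rule distributed_nn_integral[OF d, symmetric]) simp
  also have "\<dots> = (\<integral>\<^sup>+x. ennreal (exp (v / 2)) * ennreal (normal_density v (sqrt v) x) \<partial>lborel)"
    by (simp add: * normal_density_nonneg flip: ennreal_mult)
  also have "\<dots> = ennreal (exp (v / 2)) * (\<integral>\<^sup>+x. ennreal (normal_density v (sqrt v) x) \<partial>lborel)"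
    by (rule nn_integral_cmult) simp
  also have "(\<integral>\<^sup>+x. ennreal (normal_density v (sqrt v) x) \<partial>lborel) = 1"
    using N.emeasure_space_1 by (simp add: emeasure_density)
  finally show ?thesis by simp
qed

text \<open>\<open>\<kappa>\<close> may be any positive bound for the quadratic form of
  \<open>Q\<close>; the theorem takes a bound for its operator norm.\<close>

locale bm_setting = prob_space M
  for M :: "'w measure" +
  fixes t0 :: real and Fil :: "real \<Rightarrow> 'w measure"
    and Q :: "'h::{real_inner,banach,second_countable_topology} \<Rightarrow> 'h"
    and W :: "real \<Rightarrow> 'h \<Rightarrow> 'w \<Rightarrow> real" and \<kappa> :: real
  assumes filt: "filtration_from M t0 Fil" and bm: "brownian_motion M t0 Fil Q W"
    and kappa_pos: "\<kappa> > 0" and kappa: "Q h \<bullet> h \<le> \<kappa> * (norm h)\<^sup>2"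
begin

lemma sub: "t0 \<le> t \<Longrightarrow> subalgebra M (Fil t)"
  using filt by (auto simp: filtration_from_def)

lemma meas_M: "t0 \<le> t \<Longrightarrow> f \<in> measurable (Fil t) N \<Longrightarrow> f \<in> measurable M N"
  using sub measurable_from_subalg by blast

lemma meas_mono: "t0 \<le> s \<Longrightarrow> s \<le> t \<Longrightarrow> f \<in> measurable (Fil s) N \<Longrightarrow> f \<in> measurable (Fil t) N"
  using filt measurable_from_subalg unfolding filtration_from_def by blast

lemma W_meas: "t0 \<le> s \<Longrightarrow> s \<le> t \<Longrightarrow> W s h \<in> borel_measurable (Fil t)"
  by (rule meas_mono[of s t]) (use bm in \<open>auto simp: brownian_motion_def\<close>)

lemma W_meas_M: "t0 \<le> s \<Longrightarrow> W s h \<in> borel_measurable M"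
  using W_meas[of s s] meas_M by blast

lemma W_lin: "t0 \<le> t \<Longrightarrow> AE \<omega> in M. W t (a *\<^sub>R h + b *\<^sub>R k) \<omega> = a * W t h \<omega> + b * W t k \<omega>"
  using bm unfolding brownian_motion_def by blast

lemma W_sum_list:
  assumes "t0 \<le> t"
  shows "AE \<omega> in M. W t (\<Sum>x\<leftarrow>xs. c x *\<^sub>R h x) \<omega> = (\<Sum>x\<leftarrow>xs. c x * W t (h x) \<omega>)"
proof (induction xs)
  case Nil
  show ?case using W_lin[OF assms, of 0 0 0 0] by simp
next
  case (Cons x xs)
  show ?case
    using W_lin[OF assms, of "c x" "h x" 1 "\<Sum>x\<leftarrow>xs. c x *\<^sub>R h x"] Cons
    by eventually_elim simp
qed

lemma W_continuous: "AE \<omega> in M. continuous_on {t0..} (\<lambda>t. W t h \<omega>)"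
  using bm unfolding brownian_motion_def by blast

lemma W_gauss: "t0 \<le> s \<Longrightarrow> s < t \<Longrightarrow>
    centred_gaussian M (\<lambda>\<omega>. W t h \<omega> - W s h \<omega>) ((t - s) * (Q h \<bullet> h))"
  and W_indep: "t0 \<le> s \<Longrightarrow> s < t \<Longrightarrow> indep_set (sets (Fil s))
          {(\<lambda>\<omega>. W t h \<omega> - W s h \<omega>) -` B \<inter> space M |B. B \<in> sets borel}"
  using bm unfolding brownian_motion_def by blast+

text \<open>Positivity is not listed in \<open>brownian_motion\<close>; it is read off from the
  variance of an increment over unit time.\<close>

lemma Q_nonneg: "Q h \<bullet> h \<ge> 0"
  using W_gauss[of t0 "t0 + 1" h] by (auto simp: centred_gaussian_def split: if_splits)

lemma incr_exp:
  assumes st: "t0 \<le> s" "s \<le> t" and \<zeta>: "\<zeta> \<in> borel_measurable (Fil s)" "\<And>\<omega>. 0 \<le> (\<zeta> \<omega> :: real)"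
  shows "(\<integral>\<^sup>+\<omega>. ennreal (\<zeta> \<omega> * exp (W t h \<omega> - W s h \<omega>)) \<partial>M)
    = (\<integral>\<^sup>+\<omega>. ennreal (\<zeta> \<omega>) \<partial>M) * ennreal (exp ((t - s) * (Q h \<bullet> h) / 2))"
proof (cases "s = t")
  case False
  then have lt: "s < t" using st by simp
  have "(\<integral>\<^sup>+\<omega>. ennreal (\<zeta> \<omega> * exp (W t h \<omega> - W s h \<omega>)) \<partial>M)
      = (\<integral>\<^sup>+\<omega>. ennreal (\<zeta> \<omega>) * ennreal (exp (W t h \<omega> - W s h \<omega>)) \<partial>M)"
    by (simp add: ennreal_mult \<zeta>(2))
  also have "\<dots> = (\<integral>\<^sup>+\<omega>. ennreal (\<zeta> \<omega>) \<partial>M) * (\<integral>\<^sup>+\<omega>. ennreal (exp (W t h \<omega> - W s h \<omega>)) \<partial>M)"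
    by (rule nn_integral_indep_product[OF sub[OF st(1)] _ W_indep[OF st(1) lt],
          where g = "\<lambda>x. ennreal (exp x)"])
       (use \<zeta> W_meas_M st in auto)
  finally show ?thesis
    by (simp add: nn_integral_exp_centred_gaussian[OF W_gauss[OF st(1) lt]])
qed simp

text \<open>
  The directions of the increments are random, but only single coordinates of \<open>W\<close> are known to be
  independent of the past. Each random coefficient is therefore discretised, frozen on the events
  where it takes a given value, and absorbed into the deterministic direction \<open>h0\<close>.
\<close>

lemma exp_increments_le:
  assumes st: "t0 \<le> s" "s \<le> t"
    and A: "\<And>\<eta> h. (\<eta>, h) \<in> set A \<Longrightarrow> \<eta> \<in> borel_measurable (Fil s)"
    and \<zeta>: "\<zeta> \<in> borel_measurable (Fil s)" "\<And>\<omega>. 0 \<le> (\<zeta> \<omega> :: real)"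
  shows "(\<integral>\<^sup>+\<omega>. ennreal (\<zeta> \<omega> * exp ((W t h0 \<omega> - W s h0 \<omega>)
        + (\<Sum>(\<eta>, h)\<leftarrow>A. \<eta> \<omega> * (W t h \<omega> - W s h \<omega>))
        - \<kappa> / 2 * (t - s) * (norm (h0 + (\<Sum>(\<eta>, h)\<leftarrow>A. \<eta> \<omega> *\<^sub>R h)))\<^sup>2)) \<partial>M)
    \<le> (\<integral>\<^sup>+\<omega>. ennreal (\<zeta> \<omega>) \<partial>M)"
  using A \<zeta>
proof (induction A arbitrary: h0 \<zeta>)
  case Nil
  define c where "c = \<kappa> / 2 * (t - s) * (norm h0)\<^sup>2"
  have "(\<integral>\<^sup>+\<omega>. ennreal (\<zeta> \<omega> * exp ((W t h0 \<omega> - W s h0 \<omega>) - c)) \<partial>M)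
      = (\<integral>\<^sup>+\<omega>. ennreal (exp (- c)) * ennreal (\<zeta> \<omega> * exp (W t h0 \<omega> - W s h0 \<omega>)) \<partial>M)"
    by (intro nn_integral_cong) (simp add: exp_diff exp_minus Nil divide_inverse mult_ac flip: ennreal_mult)
  also have "\<dots> = ennreal (exp (- c)) * (\<integral>\<^sup>+\<omega>. ennreal (\<zeta> \<omega> * exp (W t h0 \<omega> - W s h0 \<omega>)) \<partial>M)"
    using Nil W_meas_M st meas_M[OF st(1) Nil(2)] by (intro nn_integral_cmult) auto
  also have "\<dots> = (\<integral>\<^sup>+\<omega>. ennreal (\<zeta> \<omega>) \<partial>M) * ennreal (exp ((t - s) * (Q h0 \<bullet> h0) / 2 - c))"
  proof -
    have *: "exp ((t - s) * (Q h0 \<bullet> h0) / 2 - c) = exp (- c) * exp ((t - s) * (Q h0 \<bullet> h0) / 2)"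
      by (simp flip: exp_add)
    show ?thesis
      unfolding incr_exp[OF st Nil(2,3)] * by (subst ennreal_mult) (simp_all only: exp_ge_zero mult_ac)
  qed
  also have "\<dots> \<le> (\<integral>\<^sup>+\<omega>. ennreal (\<zeta> \<omega>) \<partial>M) * 1"
  proof (intro mult_left_mono)
    have "(t - s) * (Q h0 \<bullet> h0) \<le> (t - s) * (\<kappa> * (norm h0)\<^sup>2)"
      using st kappa by (intro mult_left_mono) auto
    then show "ennreal (exp ((t - s) * (Q h0 \<bullet> h0) / 2 - c)) \<le> 1"
      by (auto simp: c_def field_simps)
  qed simp
  finally show ?case by (simp add: c_def)
next
  case (Cons p A)
  obtain \<eta> h where p: "p = (\<eta>, h)" by force
  have \<eta>F: "\<eta> \<in> borel_measurable (Fil s)" by (rule Cons.prems(1)[of _ h]) (simp add: p)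
  have AF: "\<And>\<eta> h. (\<eta>, h) \<in> set A \<Longrightarrow> \<eta> \<in> borel_measurable (Fil s)"
    by (rule Cons.prems(1)) auto
  have spM: "space (Fil s) = space M" using sub[OF st(1)] by (simp add: subalgebra_def)
  define X where "X k \<omega> = W t k \<omega> - W s k \<omega>" for k \<omega>
  define R where "R \<omega> = (\<Sum>(\<eta>, h)\<leftarrow>A. \<eta> \<omega> * X h \<omega>)" for \<omega>
  define U where "U \<omega> = (\<Sum>(\<eta>, h)\<leftarrow>A. \<eta> \<omega> *\<^sub>R h)" for \<omega>
  define \<Psi> where "\<Psi> z \<omega> = exp (X h0 \<omega> + (z * X h \<omega> + R \<omega>)
      - \<kappa> / 2 * (t - s) * (norm (h0 + (z *\<^sub>R h + U \<omega>)))\<^sup>2)" for z \<omega>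
  have Xm[measurable]: "X k \<in> borel_measurable M" for k
    unfolding X_def using W_meas_M st by auto
  have AM: "(fst x) \<in> borel_measurable M" if "x \<in> set A" for x
    using AF[of "fst x" "snd x"] that meas_M[OF st(1)] by auto
  have Rm[measurable]: "R \<in> borel_measurable M"
    unfolding R_def by (intro borel_measurable_sum_list) (auto dest!: AM)
  have Um[measurable]: "U \<in> borel_measurable M"
    unfolding U_def by (intro borel_measurable_sum_list) (auto dest!: AM)
  have \<Psi>m[measurable (raw)]: "f \<in> borel_measurable M \<Longrightarrow> (\<lambda>\<omega>. \<Psi> (f \<omega>) \<omega>) \<in> borel_measurable M" for f
  proof -
    assume [measurable]: "f \<in> borel_measurable M"
    show ?thesis unfolding \<Psi>_def by measurable
  qed
  have [measurable]: "\<Psi> z \<in> borel_measurable M" for z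
    using \<Psi>m[of "\<lambda>_. z"] by simp
  have \<zeta>m[measurable]: "\<zeta> \<in> borel_measurable M"
    using Cons.prems meas_M[OF st(1)] by auto
  have \<eta>m[measurable]: "\<eta> \<in> borel_measurable M"
    using \<eta>F meas_M[OF st(1)] by auto
  \<comment> \<open>For a constant coefficient \<open>z\<close> the increments along
    \<open>h0\<close> and \<open>h\<close> merge almost surely into the one along
    \<open>h0 + z *\<^sub>R h\<close>. This is why the induction hypothesis covers all
    \<open>h0\<close> and all weights.\<close>
  have const: "(\<integral>\<^sup>+\<omega>. ennreal (\<zeta>' \<omega> * \<Psi> z \<omega>) \<partial>M) \<le> (\<integral>\<^sup>+\<omega>. ennreal (\<zeta>' \<omega>) \<partial>M)"
    if \<zeta>': "\<zeta>' \<in> borel_measurable (Fil s)" "\<And>\<omega>. 0 \<le> \<zeta>' \<omega>" for \<zeta>' z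
  proof -
    have "AE \<omega> in M. X (h0 + z *\<^sub>R h) \<omega> = X h0 \<omega> + z * X h \<omega>"
      using W_lin[of t 1 h0 z h] W_lin[of s 1 h0 z h] st unfolding X_def
      by (auto elim!: eventually_elim2 simp: algebra_simps)
    then have "AE \<omega> in M. ennreal (\<zeta>' \<omega> * \<Psi> z \<omega>) = ennreal (\<zeta>' \<omega> * exp (X (h0 + z *\<^sub>R h) \<omega>
        + R \<omega> - \<kappa> / 2 * (t - s) * (norm ((h0 + z *\<^sub>R h) + U \<omega>))\<^sup>2))"
      by eventually_elim (simp add: \<Psi>_def algebra_simps)
    then have "(\<integral>\<^sup>+\<omega>. ennreal (\<zeta>' \<omega> * \<Psi> z \<omega>) \<partial>M) = (\<integral>\<^sup>+\<omega>. ennreal (\<zeta>' \<omega> * exp (X (h0 + z *\<^sub>R h) \<omega>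
        + R \<omega> - \<kappa> / 2 * (t - s) * (norm ((h0 + z *\<^sub>R h) + U \<omega>))\<^sup>2)) \<partial>M)"
      by (rule nn_integral_cong_AE)
    also have "\<dots> \<le> (\<integral>\<^sup>+\<omega>. ennreal (\<zeta>' \<omega>) \<partial>M)"
      unfolding R_def U_def X_def by (rule Cons.IH) (use AF \<zeta>' in auto)
    finally show ?thesis .
  qed
  \<comment> \<open>The event that \<open>k\<close> takes the value \<open>i\<close> is known at
    time \<open>s\<close>, so its indicator may be made part of the weight; Tonelli sums over
    \<open>i\<close>.\<close>
  have discr: "(\<integral>\<^sup>+\<omega>. ennreal (\<zeta> \<omega> * \<Psi> (q (k \<omega>)) \<omega>) \<partial>M) \<le> (\<integral>\<^sup>+\<omega>. ennreal (\<zeta> \<omega>) \<partial>M)"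
    if k: "k \<in> measurable (Fil s) (count_space UNIV)" for k :: "'w \<Rightarrow> int" and q :: "int \<Rightarrow> real"
  proof -
    have kM: "k \<in> measurable M (count_space UNIV)"
      using k meas_M[OF st(1)] by auto
    have [measurable]: "(\<lambda>\<omega>. indicator {i} (k \<omega>) :: real) \<in> borel_measurable M" for i
      by (rule measurable_compose[OF kM]) simp
    have kF[measurable]: "(\<lambda>\<omega>. indicator {i} (k \<omega>) :: real) \<in> borel_measurable (Fil s)" for i
      by (rule measurable_compose[OF k]) simp
    have split: "ennreal a = (\<integral>\<^sup>+i. ennreal (indicator {i} j * a) \<partial>count_space (UNIV::int set))" for a j
    proof -
      have "(\<integral>\<^sup>+i. ennreal (indicator {i} j * a) \<partial>count_space (UNIV::int set))
          = (\<integral>\<^sup>+i. ennreal a * indicator {j} i \<partial>count_space UNIV)"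
        by (intro nn_integral_cong) (auto simp: indicator_def)
      then show ?thesis by simp
    qed
    have "(\<integral>\<^sup>+\<omega>. ennreal (\<zeta> \<omega> * \<Psi> (q (k \<omega>)) \<omega>) \<partial>M)
        = (\<integral>\<^sup>+\<omega>. \<integral>\<^sup>+i. ennreal (indicator {i} (k \<omega>) * (\<zeta> \<omega> * \<Psi> (q (k \<omega>)) \<omega>)) \<partial>count_space UNIV \<partial>M)"
      by (intro nn_integral_cong split)
    also have "\<dots> = (\<integral>\<^sup>+\<omega>. \<integral>\<^sup>+i. ennreal ((indicator {i} (k \<omega>) * \<zeta> \<omega>) * \<Psi> (q i) \<omega>) \<partial>count_space UNIV \<partial>M)"
      by (intro nn_integral_cong) (auto simp: indicator_def)
    also have "\<dots> = (\<integral>\<^sup>+i. \<integral>\<^sup>+\<omega>. ennreal ((indicator {i} (k \<omega>) * \<zeta> \<omega>) * \<Psi> (q i) \<omega>) \<partial>M \<partial>count_space UNIV)"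
      by (rule nn_integral_count_space_nn_integral) (simp, measurable)
    also have "\<dots> \<le> (\<integral>\<^sup>+i. \<integral>\<^sup>+\<omega>. ennreal (indicator {i} (k \<omega>) * \<zeta> \<omega>) \<partial>M \<partial>count_space UNIV)"
    proof (rule nn_integral_mono)
      fix i
      have [measurable]: "\<zeta> \<in> borel_measurable (Fil s)"
        using Cons.prems by auto
      have m: "(\<lambda>\<omega>. indicator {i} (k \<omega>) * \<zeta> \<omega>) \<in> borel_measurable (Fil s)"
        by measurable
      show "(\<integral>\<^sup>+\<omega>. ennreal ((indicator {i} (k \<omega>) * \<zeta> \<omega>) * \<Psi> (q i) \<omega>) \<partial>M)
          \<le> (\<integral>\<^sup>+\<omega>. ennreal (indicator {i} (k \<omega>) * \<zeta> \<omega>) \<partial>M)"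
        by (rule const[OF m]) (simp add: Cons.prems)
    qed
    also have "\<dots> = (\<integral>\<^sup>+\<omega>. \<integral>\<^sup>+i. ennreal (indicator {i} (k \<omega>) * \<zeta> \<omega>) \<partial>count_space UNIV \<partial>M)"
      by (rule nn_integral_count_space_nn_integral[symmetric]) (simp, measurable)
    also have "\<dots> = (\<integral>\<^sup>+\<omega>. ennreal (\<zeta> \<omega>) \<partial>M)"
      by (intro nn_integral_cong split[symmetric])
    finally show ?thesis .
  qed
  define a where "a n \<omega> = real_of_int \<lfloor>real (Suc n) * \<eta> \<omega>\<rfloor> / real (Suc n)" for n \<omega>
  have am[measurable]: "a n \<in> borel_measurable M" for n
    unfolding a_def by measurable
  have le: "(\<integral>\<^sup>+\<omega>. ennreal (\<zeta> \<omega> * \<Psi> (a n \<omega>) \<omega>) \<partial>M) \<le> (\<integral>\<^sup>+\<omega>. ennreal (\<zeta> \<omega>) \<partial>M)" for n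
  proof -
    have [measurable]: "\<eta> \<in> borel_measurable (Fil s)" by (rule \<eta>F)
    have "(\<lambda>\<omega>. \<lfloor>real (Suc n) * \<eta> \<omega>\<rfloor>) \<in> measurable (Fil s) (count_space UNIV)" by measurable
    from discr[OF this, of "\<lambda>i. real_of_int i / real (Suc n)"] show ?thesis
      by (simp add: a_def)
  qed
  have lim: "(\<lambda>n. a n \<omega>) \<longlonglongrightarrow> \<eta> \<omega>" for \<omega>
  proof (rule Lim_null[THEN iffD2, OF Lim_null_comparison])
    show "\<forall>\<^sub>F n in sequentially. norm (a n \<omega> - \<eta> \<omega>) \<le> 1 / real (Suc n)"
    proof (intro always_eventually allI)
      fix n
      have "a n \<omega> - \<eta> \<omega> = (real_of_int \<lfloor>real (Suc n) * \<eta> \<omega>\<rfloor> - real (Suc n) * \<eta> \<omega>) / real (Suc n)"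
        by (simp add: a_def field_simps)
      moreover have "\<bar>real_of_int \<lfloor>real (Suc n) * \<eta> \<omega>\<rfloor> - real (Suc n) * \<eta> \<omega>\<bar> \<le> 1"
        by linarith
      ultimately show "norm (a n \<omega> - \<eta> \<omega>) \<le> 1 / real (Suc n)"
        by (simp add: abs_divide divide_right_mono)
    qed
    show "(\<lambda>n. 1 / real (Suc n)) \<longlonglongrightarrow> 0"
      using LIMSEQ_inverse_real_of_nat by (simp add: inverse_eq_divide)
  qed
  have lim\<Psi>: "(\<lambda>n. ennreal (\<zeta> \<omega> * \<Psi> (a n \<omega>) \<omega>)) \<longlonglongrightarrow> ennreal (\<zeta> \<omega> * \<Psi> (\<eta> \<omega>) \<omega>)" for \<omega>
    unfolding \<Psi>_def by (intro tendsto_intros tendsto_ennrealI lim)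
  have "(\<integral>\<^sup>+\<omega>. ennreal (\<zeta> \<omega> * \<Psi> (\<eta> \<omega>) \<omega>) \<partial>M)
      = (\<integral>\<^sup>+\<omega>. liminf (\<lambda>n. ennreal (\<zeta> \<omega> * \<Psi> (a n \<omega>) \<omega>)) \<partial>M)"
    by (intro nn_integral_cong lim_imp_Liminf[symmetric] lim\<Psi>) simp
  \<comment> \<open>Fatou's lemma requires no domination but preserves only an upper bound, so
    random coefficients yield the supermartingale inequality alone.\<close>
  also have "\<dots> \<le> liminf (\<lambda>n. \<integral>\<^sup>+\<omega>. ennreal (\<zeta> \<omega> * \<Psi> (a n \<omega>) \<omega>) \<partial>M)"
    by (rule nn_integral_liminf) measurable
  also have "\<dots> \<le> liminf (\<lambda>n. \<integral>\<^sup>+\<omega>. ennreal (\<zeta> \<omega>) \<partial>M)"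
    by (intro Liminf_mono always_eventually allI le)
  also have "\<dots> = (\<integral>\<^sup>+\<omega>. ennreal (\<zeta> \<omega>) \<partial>M)"
    by (rule Liminf_const) simp
  finally show ?case
    by (simp add: p \<Psi>_def X_def R_def U_def)
qed

end

text \<open>The Hilbert space adjoint of \<open>elementary_value E s \<omega>\<close> applied to
  \<open>k\<close>, written out for a sum of rank-one operators.\<close>

definition dual_value ::
  "('w, 'h::real_inner, 'k::real_inner) elementary \<Rightarrow> 'k \<Rightarrow> real \<Rightarrow> 'w \<Rightarrow> 'h" where
  "dual_value E k s \<omega> =
     (\<Sum>(a, b, \<xi>, h, k')\<leftarrow>E. (indicator {a<..b} s * \<xi> \<omega> * (k' \<bullet> k)) *\<^sub>R h)"

lemma blinfun_apply_sum_list: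
  "blinfun_apply (\<Sum>x\<leftarrow>xs. f x) v = (\<Sum>x\<leftarrow>xs. blinfun_apply (f x) v)"
  by (induction xs) (auto simp: blinfun.add_left)

lemma inner_sum_list_left: "(\<Sum>x\<leftarrow>xs. f x) \<bullet> v = (\<Sum>x\<leftarrow>xs. f x \<bullet> v)"
  by (induction xs) (auto simp: inner_add_left)

lemma elementary_value_apply:
  "blinfun_apply (elementary_value E s \<omega>) v
    = (\<Sum>(a, b, \<xi>, h, k)\<leftarrow>E. (indicator {a<..b} s * \<xi> \<omega> * (v \<bullet> h)) *\<^sub>R k)"
  unfolding elementary_value_def blinfun_apply_sum_list
  by (intro arg_cong[where f = sum_list] map_cong refl)
     (auto simp: blinfun.scaleR_left inner_commute)

lemma dual_value_inner: "dual_value E k s \<omega> \<bullet> v = blinfun_apply (elementary_value E s \<omega>) v \<bullet> k"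
  unfolding dual_value_def elementary_value_apply inner_sum_list_left
  by (intro arg_cong[where f = sum_list] map_cong refl) (auto simp: inner_commute)

text \<open>Parseval for the adjoint vector with Cauchy-Schwarz in each coordinate. It turns
  Hilbert-Schmidt closeness of integrands into smallness of \<open>quad\<close> in every
  direction.\<close>

lemma dual_value_le_hs_sq:
  "ennreal ((norm (dual_value E k s \<omega>))\<^sup>2) \<le> ennreal ((norm k)\<^sup>2) * hs_sq (elementary_value E s \<omega>)"
proof -
  have "ennreal ((norm (dual_value E k s \<omega>))\<^sup>2)
      = (\<integral>\<^sup>+e. ennreal ((dual_value E k s \<omega> \<bullet> e)\<^sup>2) \<partial>count_space the_basis)"
    by (rule parseval[OF the_basis, symmetric])
  also have "\<dots> \<le> (\<integral>\<^sup>+e. ennreal ((norm k)\<^sup>2) * ennreal ((norm (elementary_value E s \<omega> e))\<^sup>2)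
      \<partial>count_space the_basis)"
  proof (intro nn_integral_mono)
    fix e
    have "(dual_value E k s \<omega> \<bullet> e)\<^sup>2 \<le> (norm (elementary_value E s \<omega> e) * norm k)\<^sup>2"
      unfolding dual_value_inner using Cauchy_Schwarz_ineq2 by (intro power2_le_iff_abs_le[THEN iffD2]) auto
    then show "ennreal ((dual_value E k s \<omega> \<bullet> e)\<^sup>2)
        \<le> ennreal ((norm k)\<^sup>2) * ennreal ((norm (elementary_value E s \<omega> e))\<^sup>2)"
      by (simp add: power_mult_distrib mult.commute flip: ennreal_mult)
  qed
  also have "\<dots> = ennreal ((norm k)\<^sup>2) * hs_sq (elementary_value E s \<omega>)"
    unfolding hs_sq_def by (rule nn_integral_cmult) simp
  finally show ?thesis .
qed

text \<open>Squared matrix entries summed by columns instead of by rows: an operator and its adjoint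
  have the same Hilbert-Schmidt norm. It later bounds the sum of the variances of all
  coordinates.\<close>

lemma nn_integral_dual_value_basis:
  "(\<integral>\<^sup>+f. ennreal ((norm (dual_value E f s \<omega>))\<^sup>2) \<partial>count_space the_basis)
    = hs_sq (elementary_value E s \<omega>)"
proof -
  have "(\<integral>\<^sup>+f. ennreal ((norm (dual_value E f s \<omega>))\<^sup>2) \<partial>count_space the_basis)
     = (\<integral>\<^sup>+f. \<integral>\<^sup>+e. ennreal ((dual_value E f s \<omega> \<bullet> e)\<^sup>2) \<partial>count_space the_basis \<partial>count_space the_basis)"
    by (simp add: parseval[OF the_basis])
  also have "\<dots> = (\<integral>\<^sup>+e. \<integral>\<^sup>+f. ennreal ((dual_value E f s \<omega> \<bullet> e)\<^sup>2) \<partial>count_space the_basis \<partial>count_space the_basis)"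
    by (rule nn_integral_count_space_nn_integral) (auto simp: countable_the_basis)
  also have "\<dots> = hs_sq (elementary_value E s \<omega>)"
    unfolding dual_value_inner hs_sq_def by (simp add: parseval[OF the_basis])
  finally show ?thesis .
qed

section \<open>Elementary processes on intervals without interior endpoints\<close>

definition endpoints :: "('w, 'h, 'k) elementary \<Rightarrow> real set" where
  "endpoints E = (\<Union>(a, b, \<xi>, h, k)\<in>set E. {a, b})"

lemma finite_endpoints: "finite (endpoints E)"
  unfolding endpoints_def by (intro finite_UN_I) auto

text \<open>If no endpoint lies strictly between \<open>s\<close> and \<open>t\<close>, every entry
  either covers the whole of (s, t] or misses it; these are the ones that cover it.\<close>

definition active_on :: "real \<Rightarrow> real \<Rightarrow> real \<times> real \<times> ('w \<Rightarrow> real) \<times> 'h \<times> 'k \<Rightarrow> bool" where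
  "active_on s t = (\<lambda>(a, b, \<xi>, h, k). a \<le> s \<and> t \<le> b)"

lemma sum_list_filter: "(\<Sum>x\<leftarrow>filter P xs. f x) = (\<Sum>x\<leftarrow>xs. if P x then f x else (0::'b::monoid_add))"
  by (induction xs) auto

lemma elementary_integral_diff_gap:
  assumes E: "elementary_process M t0 Fil E" and st: "s < t" "endpoints E \<inter> {s<..<t} = {}"
  shows "(elementary_integral W E t \<omega> - elementary_integral W E s \<omega>) \<bullet> k
    = (\<Sum>(a, b, \<xi>, h, k')\<leftarrow>filter (active_on s t) E. (\<xi> \<omega> * (k' \<bullet> k)) * (W t h \<omega> - W s h \<omega>))"
proof -
  have "(elementary_integral W E t \<omega> - elementary_integral W E s \<omega>) \<bullet> k
     = (\<Sum>x\<leftarrow>E. (case x of (a, b, \<xi>, h, k') \<Rightarrow>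
         (\<xi> \<omega> * (k' \<bullet> k)) * ((W (min b t) h \<omega> - W (min a t) h \<omega>) - (W (min b s) h \<omega> - W (min a s) h \<omega>))))"
    unfolding elementary_integral_def inner_diff_left inner_sum_list_left sum_list_subtractf[symmetric]
    by (intro arg_cong[where f = sum_list] map_cong refl) (auto simp: algebra_simps)
  also have "\<dots> = (\<Sum>x\<leftarrow>E. if active_on s t x then (case x of (a, b, \<xi>, h, k') \<Rightarrow>
         (\<xi> \<omega> * (k' \<bullet> k)) * (W t h \<omega> - W s h \<omega>)) else 0)"
  proof (intro arg_cong[where f = sum_list] map_cong refl, goal_cases)
    case (1 x)
    obtain a b \<xi> h k' where x: "x = (a, b, \<xi>, h, k')" by (cases x) auto
    have ab: "a \<le> b" using E 1 x by (auto simp: elementary_process_def)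
    have "a \<in> endpoints E" "b \<in> endpoints E"
      using 1 x unfolding endpoints_def by force+
    then have "a \<notin> {s<..<t}" "b \<notin> {s<..<t}" using st by auto
    then have "(a \<le> s \<and> t \<le> b) \<or> (b \<le> s) \<or> t \<le> a"
      by auto
    then show ?case using ab st(1) by (auto simp: x active_on_def min_def)
  qed
  finally show ?thesis
    by (simp add: sum_list_filter)
qed

lemma dual_value_gap:
  assumes E: "elementary_process M t0 Fil E" and st: "endpoints E \<inter> {s<..<t} = {}" and r: "s < r" "r \<le> t"
  shows "dual_value E k r \<omega> = (\<Sum>(a, b, \<xi>, h, k')\<leftarrow>filter (active_on s t) E. (\<xi> \<omega> * (k' \<bullet> k)) *\<^sub>R h)"
proof -
  have "dual_value E k r \<omega> = (\<Sum>x\<leftarrow>E. if active_on s t x then (case x of (a, b, \<xi>, h, k') \<Rightarrow>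
         (\<xi> \<omega> * (k' \<bullet> k)) *\<^sub>R h) else 0)"
    unfolding dual_value_def
  proof (intro arg_cong[where f = sum_list] map_cong refl, goal_cases)
    case (1 x)
    obtain a b \<xi> h k' where x: "x = (a, b, \<xi>, h, k')" by (cases x) auto
    have ab: "a \<le> b" using E 1 x by (auto simp: elementary_process_def)
    have "a \<in> endpoints E" "b \<in> endpoints E"
      using 1 x unfolding endpoints_def by force+
    then have "a \<notin> {s<..<t}" "b \<notin> {s<..<t}" using st by auto
    then have "(a \<le> s \<and> t \<le> b) \<or> (b \<le> s) \<or> t \<le> a"
      by auto
    then show ?case using ab r by (auto simp: x active_on_def indicator_def)
  qed
  then show ?thesis
    by (simp add: sum_list_filter)
qed

lemma dual_value_measurable_time [measurable]: "(\<lambda>r. dual_value E k r \<omega>) \<in> borel_measurable borel"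
  for k :: "'k::real_inner"
    and E :: "('w, 'h::{real_inner,second_countable_topology}, 'k) elementary"
  unfolding dual_value_def
  by (intro borel_measurable_sum_list) (auto simp: split_beta')

lemma dual_value_bounded: "\<exists>c. \<forall>r. norm (dual_value E k r \<omega>) \<le> c"
proof (induction E)
  case Nil
  then show ?case by (auto simp: dual_value_def)
next
  case (Cons x E)
  obtain a b \<xi> h k' where x: "x = (a, b, \<xi>, h, k')" by (cases x) auto
  obtain c where c: "\<And>r. norm (dual_value E k r \<omega>) \<le> c" using Cons by auto
  have "norm (dual_value (x # E) k r \<omega>) \<le> norm ((\<xi> \<omega> * (k' \<bullet> k)) *\<^sub>R h) + c" for r
  proof -
    have "dual_value (x # E) k r \<omega> = (indicator {a<..b} r * \<xi> \<omega> * (k' \<bullet> k)) *\<^sub>R h + dual_value E k r \<omega>"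
      by (simp add: dual_value_def x)
    also have "norm \<dots> \<le> norm ((indicator {a<..b} r * \<xi> \<omega> * (k' \<bullet> k)) *\<^sub>R h) + c"
      using c by (intro norm_triangle_mono) auto
    also have "norm ((indicator {a<..b} r * \<xi> \<omega> * (k' \<bullet> k)) *\<^sub>R h) \<le> norm ((\<xi> \<omega> * (k' \<bullet> k)) *\<^sub>R h)"
      by (auto simp: indicator_def)
    finally show ?thesis by simp
  qed
  then show ?case by blast
qed

text \<open>If \<open>Q\<close> is the identity, this is the quadratic variation over (s, t] of the
  scalar process \<open>J \<bullet> k\<close>, where \<open>J\<close> is the elementary integral; in
  general \<open>\<kappa>\<close> times it is an upper bound for that variation.\<close>

definition quad :: "('w, 'h::{real_inner,second_countable_topology}, 'k::real_inner) elementary \<Rightarrow> 'k \<Rightarrow> real \<Rightarrow> real \<Rightarrow> 'w \<Rightarrow> real" where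
  "quad E k s t \<omega> = (LINT r:{s<..t}|lborel. (norm (dual_value E k r \<omega>))\<^sup>2)"

lemma quad_integrable: "set_integrable lborel {s<..t} (\<lambda>r. (norm (dual_value E k r \<omega>))\<^sup>2)"
  for E :: "('w, 'h::{real_inner,second_countable_topology}, 'k::real_inner) elementary"
proof -
  obtain c where "\<And>r. norm (dual_value E k r \<omega>) \<le> c"
    using dual_value_bounded by metis
  then have "\<And>r. (norm (dual_value E k r \<omega>))\<^sup>2 \<le> c\<^sup>2"
    by (intro power_mono) auto
  moreover have "emeasure lborel {s<..t} < \<infinity>"
    by (cases "s \<le> t") auto
  ultimately show ?thesis
    unfolding set_integrable_def
    by (intro integrableI_bounded_set[where A = "{s<..t}" and B = "c\<^sup>2"])
       auto
qed

lemma quad_add: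
  assumes "s \<le> u" "u \<le> t"
  shows "quad E k s t \<omega> = quad E k s u \<omega> + quad E k u t \<omega>"
proof -
  have "{s<..t} = {s<..u} \<union> {u<..t}" using assms by auto
  then show ?thesis
    unfolding quad_def by (simp add: set_integral_Un quad_integrable Int_commute)
qed

lemma quad_nonneg: "quad E k s t \<omega> \<ge> 0"
  unfolding quad_def set_lebesgue_integral_def by (intro Bochner_Integration.integral_nonneg) auto

lemma quad_nn_integral:
  "ennreal (quad E k s t \<omega>) = (\<integral>\<^sup>+r\<in>{s<..t}. ennreal ((norm (dual_value E k r \<omega>))\<^sup>2) \<partial>lborel)"
proof -
  have "(\<integral>\<^sup>+r\<in>{s<..t}. ennreal ((norm (dual_value E k r \<omega>))\<^sup>2) \<partial>lborel)
     = (\<integral>\<^sup>+r. ennreal (indicator {s<..t} r *\<^sub>R (norm (dual_value E k r \<omega>))\<^sup>2) \<partial>lborel)"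
    by (intro nn_integral_cong) (auto simp: indicator_def)
  also have "\<dots> = ennreal (quad E k s t \<omega>)"
    unfolding quad_def set_lebesgue_integral_def
    by (rule nn_integral_eq_integral[OF quad_integrable[unfolded set_integrable_def]]) simp
  finally show ?thesis by simp
qed

section \<open>The exponential of an elementary integral as a super- and a submartingale\<close>

context bm_setting
begin

lemma elementary_integral_measurable:
  fixes E :: "('w, 'h, 'k::{real_inner,second_countable_topology}) elementary"
  assumes E: "elementary_process M t0 Fil E" and ut: "t0 \<le> u" "u \<le> t"
  shows "elementary_integral W E u \<in> borel_measurable (Fil t)"
  unfolding elementary_integral_def
proof (intro borel_measurable_sum_list, goal_cases)
  case (1 x)
  obtain a b \<xi> h k' where x: "x = (a, b, \<xi>, h, k')" by (cases x) auto
  have ab: "t0 \<le> a" "a \<le> b" and \<xi>: "\<xi> \<in> borel_measurable (Fil a)"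
    using E 1 x by (auto simp: elementary_process_def)
  show ?case
  proof (cases "a \<le> t")
    case True
    have [measurable]: "\<xi> \<in> borel_measurable (Fil t)"
      using meas_mono[OF ab(1) True \<xi>] .
    have [measurable]: "W (min b u) h \<in> borel_measurable (Fil t)" "W (min a u) h \<in> borel_measurable (Fil t)"
      using ab ut by (auto intro!: W_meas)
    show ?thesis unfolding x split by measurable
  next
    \<comment> \<open>The coefficient of an entry that starts after \<open>t\<close> is not known at
      \<open>t\<close>, but both clipped times equal \<open>u\<close> and the summand
      vanishes.\<close>
    case False
    then show ?thesis using ab ut by (simp add: x min_def)
  qed
qed

lemma quad_measurable:
  fixes E :: "('w, 'h, 'k::{real_inner,second_countable_topology}) elementary"
  assumes E: "elementary_process M t0 Fil E"
  shows "quad E k s t \<in> borel_measurable (Fil t)"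
proof -
  \<comment> \<open>The indicator is pulled into the sum because only then is each summand
    measurable for \<open>Fil t\<close>: entries starting after \<open>t\<close> are annihilated by
    it.\<close>
  have "(\<lambda>(\<omega>, r). indicator {s<..t} r *\<^sub>R dual_value E k r \<omega>) \<in> borel_measurable (Fil t \<Otimes>\<^sub>M borel)"
  proof -
    have "(\<lambda>z. \<Sum>x\<leftarrow>E. (case x of (a, b, \<xi>, h, k') \<Rightarrow> (indicator {s<..t} (snd z)
         * (indicator {a<..b} (snd z) * \<xi> (fst z) * (k' \<bullet> k))) *\<^sub>R h)) \<in> borel_measurable (Fil t \<Otimes>\<^sub>M borel)"
    proof (intro borel_measurable_sum_list, goal_cases)
      case (1 x)
      obtain a b \<xi> h k' where x: "x = (a, b, \<xi>, h, k')" by (cases x) auto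
      have ab: "t0 \<le> a" "a \<le> b" and \<xi>: "\<xi> \<in> borel_measurable (Fil a)"
        using E 1 x by (auto simp: elementary_process_def)
      show ?case
      proof (cases "a \<le> t")
        case True
        have [measurable]: "\<xi> \<in> borel_measurable (Fil t)"
          using meas_mono[OF ab(1) True \<xi>] .
        show ?thesis unfolding x split by measurable
      next
        case False
        then have "(indicator {s<..t} r * (indicator {a<..b} r * c * d)) *\<^sub>R h = 0" for r c d :: real
          using ab by (auto simp: indicator_def)
        then show ?thesis by (simp only: x split borel_measurable_const)
      qed
    qed
    also have "(\<lambda>z. \<Sum>x\<leftarrow>E. (case x of (a, b, \<xi>, h, k') \<Rightarrow> (indicator {s<..t} (snd z)
         * (indicator {a<..b} (snd z) * \<xi> (fst z) * (k' \<bullet> k))) *\<^sub>R h))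
       = (\<lambda>(\<omega>, r). indicator {s<..t} r *\<^sub>R dual_value E k r \<omega>)"
    proof
      fix z :: "'w \<times> real"
      show "(\<Sum>x\<leftarrow>E. (case x of (a, b, \<xi>, h, k') \<Rightarrow> (indicator {s<..t} (snd z)
         * (indicator {a<..b} (snd z) * \<xi> (fst z) * (k' \<bullet> k))) *\<^sub>R h))
         = (case z of (\<omega>, r) \<Rightarrow> indicator {s<..t} r *\<^sub>R dual_value E k r \<omega>)"
        by (cases "snd z \<in> {s<..t}") (auto simp: dual_value_def split_beta' simp flip: map_replicate_const
            sum_list_triv cong: map_cong)
    qed
    finally show ?thesis .
  qed
  then have [measurable]: "(\<lambda>z. indicator {s<..t} (snd z) *\<^sub>R dual_value E k (snd z) (fst z)) \<in> borel_measurable (Fil t \<Otimes>\<^sub>M lborel)"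
    by (simp add: split_beta' cong: measurable_cong_sets)
  have "quad E k s t = (\<lambda>\<omega>. LINT r|lborel. (norm (indicator {s<..t} r *\<^sub>R dual_value E k r \<omega>))\<^sup>2)"
    unfolding quad_def set_lebesgue_integral_def
    by (intro ext Bochner_Integration.integral_cong) (auto simp: indicator_def)
  also have "\<dots> \<in> borel_measurable (Fil t)"
  proof -
    have "(\<lambda>z. (norm (indicator {s<..t} (snd z) *\<^sub>R dual_value E k (snd z) (fst z)))\<^sup>2) \<in> borel_measurable (Fil t \<Otimes>\<^sub>M lborel)"
      by measurable
    then show ?thesis
      using lborel.borel_measurable_lebesgue_integral[of "\<lambda>\<omega> r. (norm (indicator {s<..t} r *\<^sub>R dual_value E k r \<omega>))\<^sup>2" "Fil t"]
      by (simp add: split_beta')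
  qed
  finally show ?thesis .
qed

text \<open>Splitting at an interior point of \<open>PP\<close> strictly lowers the number of such
  points on both sides. A property that composes over adjacent intervals thus needs to be checked
  only where nothing happens in between.\<close>

lemma gap_induct:
  fixes PP :: "real set"
  assumes "s \<le> t"
    and gap: "\<And>s t. t0 \<le> s \<Longrightarrow> s < t \<Longrightarrow> PP \<inter> {s<..<t} = {} \<Longrightarrow> R s t"
    and split: "\<And>s u t. t0 \<le> s \<Longrightarrow> s < u \<Longrightarrow> u < t \<Longrightarrow> R s u \<Longrightarrow> R u t \<Longrightarrow> R s t"
    and refl: "\<And>s. R s s" and fin: "finite PP" and t0: "t0 \<le> s"
  shows "R s t"
proof -
  have "t0 \<le> s \<Longrightarrow> s < t \<Longrightarrow> R s t"
  proof (induction "card (PP \<inter> {s<..<t})" arbitrary: s t rule: less_induct)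
    case less
    show ?case
    proof (cases "PP \<inter> {s<..<t} = {}")
      case True
      then show ?thesis using less gap by blast
    next
      case False
      then obtain u where u: "u \<in> PP" "s < u" "u < t" by auto
      have "card (PP \<inter> {s<..<u}) < card (PP \<inter> {s<..<t})" "card (PP \<inter> {u<..<t}) < card (PP \<inter> {s<..<t})"
        using u fin by (auto intro!: psubset_card_mono)
      then have "R s u" "R u t"
        using less u by auto
      then show ?thesis using split less u by blast
    qed
  qed
  then show ?thesis using assms refl by (cases "s = t") auto
qed

text \<open>On an interval without interior endpoints the active entries have started by time
  \<open>s\<close>, so their coefficients are known there and \<open>exp_increments_le\<close>
  applies. Adjacent intervals compose because \<open>\<zeta> * Z s u\<close> is again an admissible
  weight at time \<open>u\<close>; hence the quantification over all weights inside
  \<open>R\<close>.\<close>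

lemma exp_elementary_le:
  fixes E :: "('w, 'h, 'k::{real_inner,second_countable_topology}) elementary"
  assumes E: "elementary_process M t0 Fil E" and st: "t0 \<le> s" "s \<le> t"
    and \<zeta>: "\<zeta> \<in> borel_measurable (Fil s)" "\<And>\<omega>. 0 \<le> (\<zeta> \<omega> :: real)"
  shows "(\<integral>\<^sup>+\<omega>. ennreal (\<zeta> \<omega> * exp ((elementary_integral W E t \<omega> - elementary_integral W E s \<omega>) \<bullet> k
            - \<kappa> / 2 * quad E k s t \<omega>)) \<partial>M) \<le> (\<integral>\<^sup>+\<omega>. ennreal (\<zeta> \<omega>) \<partial>M)"
proof -
  define J where "J = elementary_integral W E"
  define Z where "Z s t \<omega> = exp ((J t \<omega> - J s \<omega>) \<bullet> k - \<kappa> / 2 * quad E k s t \<omega>)" for s t \<omega>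
  define R where "R s t \<longleftrightarrow> (\<forall>\<zeta>. \<zeta> \<in> borel_measurable (Fil s) \<longrightarrow> (\<forall>\<omega>. 0 \<le> \<zeta> \<omega>) \<longrightarrow>
     (\<integral>\<^sup>+\<omega>. ennreal (\<zeta> \<omega> * Z s t \<omega>) \<partial>M) \<le> (\<integral>\<^sup>+\<omega>. ennreal (\<zeta> \<omega>) \<partial>M))" for s t
  have "R s t"
    using st(2)
  proof (rule gap_induct[where PP = "endpoints E"])
    fix s t assume st: "t0 \<le> s" "s < t" and gap: "endpoints E \<inter> {s<..<t} = {}"
    define A where "A = map (\<lambda>(a, b, \<xi>, h, k'). (\<lambda>\<omega>. \<xi> \<omega> * (k' \<bullet> k), h)) (filter (active_on s t) E)"
    have AF: "\<eta> \<in> borel_measurable (Fil s)" if mem: "(\<eta>, h) \<in> set A" for \<eta> h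
    proof -
      obtain a b \<xi> k' where x: "(a, b, \<xi>, h, k') \<in> set E" "a \<le> s" "\<eta> = (\<lambda>\<omega>. \<xi> \<omega> * (k' \<bullet> k))"
      proof -
        from mem obtain x where x: "x \<in> set (filter (active_on s t) E)"
          "(\<eta>, h) = (case x of (a, b, \<xi>, h, k') \<Rightarrow> (\<lambda>\<omega>. \<xi> \<omega> * (k' \<bullet> k), h))"
          unfolding A_def by auto
        obtain a b \<xi> h' k' where "x = (a, b, \<xi>, h', k')" by (cases x) auto
        with x show thesis
          using that[of a b \<xi> k'] by (auto simp: active_on_def)
      qed
      then have "t0 \<le> a" "\<xi> \<in> borel_measurable (Fil a)"
        using E by (auto simp: elementary_process_def)
      then have [measurable]: "\<xi> \<in> borel_measurable (Fil s)"
        using meas_mono x(2) by blast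
      show ?thesis unfolding x(3) by measurable
    qed
    \<comment> \<open>All directions come from the entries, so \<open>h0 = 0\<close>; its coordinate
      \<open>W t 0\<close> vanishes only almost surely, which is why the identity is
      conditional.\<close>
    have Zeq: "Z s t \<omega> = exp ((W t 0 \<omega> - W s 0 \<omega>) + (\<Sum>(\<eta>, h)\<leftarrow>A. \<eta> \<omega> * (W t h \<omega> - W s h \<omega>))
        - \<kappa> / 2 * (t - s) * (norm (0 + (\<Sum>(\<eta>, h)\<leftarrow>A. \<eta> \<omega> *\<^sub>R h)))\<^sup>2)"
      if "W t 0 \<omega> = 0" "W s 0 \<omega> = 0" for \<omega>
    proof -
      have "quad E k s t \<omega> = (LINT r:{s<..t}|lborel. (norm (\<Sum>(\<eta>, h)\<leftarrow>A. \<eta> \<omega> *\<^sub>R h))\<^sup>2)"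
        unfolding quad_def
        by (intro set_lebesgue_integral_cong)
           (auto simp: dual_value_gap[OF E gap] A_def o_def split_beta')
      also have "\<dots> = (t - s) * (norm (\<Sum>(\<eta>, h)\<leftarrow>A. \<eta> \<omega> *\<^sub>R h))\<^sup>2"
        using st by (simp add: set_lebesgue_integral_def)
      finally have q: "quad E k s t \<omega> = (t - s) * (norm (\<Sum>(\<eta>, h)\<leftarrow>A. \<eta> \<omega> *\<^sub>R h))\<^sup>2" .
      have "(J t \<omega> - J s \<omega>) \<bullet> k = (\<Sum>(\<eta>, h)\<leftarrow>A. \<eta> \<omega> * (W t h \<omega> - W s h \<omega>))"
        unfolding J_def elementary_integral_diff_gap[OF E st(2) gap]
        by (simp add: A_def o_def split_beta')
      with q show ?thesis by (simp add: Z_def that)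
    qed
    have AE0: "AE \<omega> in M. W t 0 \<omega> = 0 \<and> W s 0 \<omega> = 0"
      using W_lin[of t 0 0 0 0] W_lin[of s 0 0 0 0] st by auto
    show "R s t"
      unfolding R_def
    proof safe
      fix \<zeta> :: "'w \<Rightarrow> real" assume \<zeta>: "\<zeta> \<in> borel_measurable (Fil s)" "\<forall>\<omega>. 0 \<le> \<zeta> \<omega>"
      have "(\<integral>\<^sup>+\<omega>. ennreal (\<zeta> \<omega> * Z s t \<omega>) \<partial>M)
        = (\<integral>\<^sup>+\<omega>. ennreal (\<zeta> \<omega> * exp ((W t 0 \<omega> - W s 0 \<omega>) + (\<Sum>(\<eta>, h)\<leftarrow>A. \<eta> \<omega> * (W t h \<omega> - W s h \<omega>))
        - \<kappa> / 2 * (t - s) * (norm (0 + (\<Sum>(\<eta>, h)\<leftarrow>A. \<eta> \<omega> *\<^sub>R h)))\<^sup>2)) \<partial>M)"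
        using AE0 by (intro nn_integral_cong_AE) (auto elim!: eventually_mono simp only: Zeq)
      also have "\<dots> \<le> (\<integral>\<^sup>+\<omega>. ennreal (\<zeta> \<omega>) \<partial>M)"
        by (rule exp_increments_le) (use st AF \<zeta> in auto)
      finally show "(\<integral>\<^sup>+\<omega>. ennreal (\<zeta> \<omega> * Z s t \<omega>) \<partial>M) \<le> (\<integral>\<^sup>+\<omega>. ennreal (\<zeta> \<omega>) \<partial>M)" .
    qed
  next
    fix s u t assume *: "t0 \<le> s" "s < u" "u < t" "R s u" "R u t"
    show "R s t"
      unfolding R_def
    proof safe
      fix \<zeta> :: "'w \<Rightarrow> real" assume \<zeta>: "\<zeta> \<in> borel_measurable (Fil s)" "\<forall>\<omega>. 0 \<le> \<zeta> \<omega>"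
      have [measurable]: "J s \<in> borel_measurable (Fil u)" "J u \<in> borel_measurable (Fil u)"
        "quad E k s u \<in> borel_measurable (Fil u)" "\<zeta> \<in> borel_measurable (Fil u)"
        unfolding J_def
        by (rule elementary_integral_measurable[OF E] quad_measurable[OF E]
            meas_mono[OF *(1) less_imp_le[OF *(2)] \<zeta>(1)]; use * in simp)+
      have \<zeta>': "(\<lambda>\<omega>. \<zeta> \<omega> * Z s u \<omega>) \<in> borel_measurable (Fil u)" "\<And>\<omega>. 0 \<le> \<zeta> \<omega> * Z s u \<omega>"
        using \<zeta> unfolding Z_def by (measurable, auto)
      have "Z s t \<omega> = Z s u \<omega> * Z u t \<omega>" for \<omega>
        unfolding Z_def using * by (simp add: quad_add[of s u t] algebra_simps flip: exp_add)
      then have "(\<integral>\<^sup>+\<omega>. ennreal (\<zeta> \<omega> * Z s t \<omega>) \<partial>M) = (\<integral>\<^sup>+\<omega>. ennreal ((\<zeta> \<omega> * Z s u \<omega>) * Z u t \<omega>) \<partial>M)"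
        by (simp add: mult.assoc)
      also have "\<dots> \<le> (\<integral>\<^sup>+\<omega>. ennreal (\<zeta> \<omega> * Z s u \<omega>) \<partial>M)"
        using *(5) \<zeta>' unfolding R_def by blast
      also have "\<dots> \<le> (\<integral>\<^sup>+\<omega>. ennreal (\<zeta> \<omega>) \<partial>M)"
        using *(4) \<zeta> unfolding R_def by blast
      finally show "(\<integral>\<^sup>+\<omega>. ennreal (\<zeta> \<omega> * Z s t \<omega>) \<partial>M) \<le> (\<integral>\<^sup>+\<omega>. ennreal (\<zeta> \<omega>) \<partial>M)" .
    qed
  qed (auto simp: R_def Z_def quad_def set_lebesgue_integral_def finite_endpoints st)
  then show ?thesis
    using \<zeta> unfolding R_def Z_def J_def by blast
qed

text \<open>The value of such a process does not depend on the sample point; below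
  \<open>undefined\<close> serves as a dummy one.\<close>

definition det_process :: "('w, 'h, 'k) elementary \<Rightarrow> bool" where
  "det_process E \<longleftrightarrow> (\<forall>(a, b, \<xi>, h, k)\<in>set E. t0 \<le> a \<and> a \<le> b \<and> (\<exists>c. \<xi> = (\<lambda>_. c)))"

lemma det_process_elementary: "det_process E \<Longrightarrow> elementary_process M t0 Fil E"
proof -
  have "bounded ((\<lambda>_. c) ` space M)" for c :: real
    by (rule boundedI[where B = "\<bar>c\<bar>"]) auto
  then show "det_process E \<Longrightarrow> elementary_process M t0 Fil E"
    by (fastforce simp: det_process_def elementary_process_def)
qed

text \<open>With deterministic coefficients the increment over a gap is almost surely a single
  coordinate increment in a fixed direction \<open>H\<close>, whose exponential has mean
  \<open>exp ((t - s) * (Q H \<bullet> H) / 2)\<close>, which is at least 1 since the form of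
  \<open>Q\<close> is nonnegative.\<close>

lemma exp_det_ge:
  fixes E :: "('w, 'h, 'k::{real_inner,second_countable_topology}) elementary"
  assumes det: "det_process E" and st: "t0 \<le> s" "s \<le> t"
    and \<zeta>: "\<zeta> \<in> borel_measurable (Fil s)" "\<And>\<omega>. 0 \<le> (\<zeta> \<omega> :: real)"
  shows "(\<integral>\<^sup>+\<omega>. ennreal (\<zeta> \<omega>) \<partial>M)
    \<le> (\<integral>\<^sup>+\<omega>. ennreal (\<zeta> \<omega> * exp ((elementary_integral W E t \<omega> - elementary_integral W E s \<omega>) \<bullet> k)) \<partial>M)"
proof -
  note E = det_process_elementary[OF det]
  define J where "J = elementary_integral W E"
  define Z where "Z s t \<omega> = exp ((J t \<omega> - J s \<omega>) \<bullet> k)" for s t \<omega>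
  define R where "R s t \<longleftrightarrow> (\<forall>\<zeta>. \<zeta> \<in> borel_measurable (Fil s) \<longrightarrow> (\<forall>\<omega>. 0 \<le> \<zeta> \<omega>) \<longrightarrow>
     (\<integral>\<^sup>+\<omega>. ennreal (\<zeta> \<omega>) \<partial>M) \<le> (\<integral>\<^sup>+\<omega>. ennreal (\<zeta> \<omega> * Z s t \<omega>) \<partial>M))" for s t
  have "R s t"
    using st(2)
  proof (rule gap_induct[where PP = "endpoints E"])
    fix s t assume st: "t0 \<le> s" "s < t" and gap: "endpoints E \<inter> {s<..<t} = {}"
    define A where "A = filter (active_on s t) E"
    define c where "c x = (case x of (a, b, \<xi>, h, k') \<Rightarrow> \<xi> undefined * (k' \<bullet> k))"
      for x :: "real \<times> real \<times> ('w \<Rightarrow> real) \<times> 'h \<times> 'k"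
    define hh where "hh x = (case x of (a, b, \<xi>, h, k') \<Rightarrow> h)"
      for x :: "real \<times> real \<times> ('w \<Rightarrow> real) \<times> 'h \<times> 'k"
    define H where "H = (\<Sum>x\<leftarrow>A. c x *\<^sub>R hh x)"
    have "AE \<omega> in M. W t H \<omega> - W s H \<omega> = (J t \<omega> - J s \<omega>) \<bullet> k"
    proof -
      have eq: "(J t \<omega> - J s \<omega>) \<bullet> k = (\<Sum>x\<leftarrow>A. c x * W t (hh x) \<omega>) - (\<Sum>x\<leftarrow>A. c x * W s (hh x) \<omega>)" for \<omega>
        unfolding J_def elementary_integral_diff_gap[OF E st(2) gap] A_def[symmetric]
          sum_list_subtractf[symmetric]
      proof (intro arg_cong[where f = sum_list] map_cong refl, goal_cases)
        case (1 x)
        obtain a b \<xi> h k' where x: "x = (a, b, \<xi>, h, k')" by (cases x) auto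
        then have "\<exists>c. \<xi> = (\<lambda>_. c)" using det 1 by (auto simp: det_process_def A_def)
        then show ?case by (auto simp: x c_def hh_def algebra_simps)
      qed
      show ?thesis
        using W_sum_list[of t c hh A] W_sum_list[of s c hh A] st unfolding eq H_def
        by (auto elim!: eventually_elim2)
    qed
    then have AEZ: "AE \<omega> in M. Z s t \<omega> = exp (W t H \<omega> - W s H \<omega>)"
      by eventually_elim (simp add: Z_def)
    show "R s t"
      unfolding R_def
    proof safe
      fix \<zeta> :: "'w \<Rightarrow> real" assume \<zeta>: "\<zeta> \<in> borel_measurable (Fil s)" "\<forall>\<omega>. 0 \<le> \<zeta> \<omega>"
      have "(\<integral>\<^sup>+\<omega>. ennreal (\<zeta> \<omega>) \<partial>M) * 1
          \<le> (\<integral>\<^sup>+\<omega>. ennreal (\<zeta> \<omega>) \<partial>M) * ennreal (exp ((t - s) * (Q H \<bullet> H) / 2))"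
        using st Q_nonneg[of H] by (intro mult_left_mono) (auto simp: one_le_exp_iff)
      also have "\<dots> = (\<integral>\<^sup>+\<omega>. ennreal (\<zeta> \<omega> * exp (W t H \<omega> - W s H \<omega>)) \<partial>M)"
        by (rule incr_exp[symmetric]) (use st \<zeta> in auto)
      also have "\<dots> = (\<integral>\<^sup>+\<omega>. ennreal (\<zeta> \<omega> * Z s t \<omega>) \<partial>M)"
        using AEZ by (intro nn_integral_cong_AE) (auto elim!: eventually_mono)
      finally show "(\<integral>\<^sup>+\<omega>. ennreal (\<zeta> \<omega>) \<partial>M) \<le> (\<integral>\<^sup>+\<omega>. ennreal (\<zeta> \<omega> * Z s t \<omega>) \<partial>M)" by simp
    qed
  next
    fix s u t assume *: "t0 \<le> s" "s < u" "u < t" "R s u" "R u t"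
    show "R s t"
      unfolding R_def
    proof safe
      fix \<zeta> :: "'w \<Rightarrow> real" assume \<zeta>: "\<zeta> \<in> borel_measurable (Fil s)" "\<forall>\<omega>. 0 \<le> \<zeta> \<omega>"
      have [measurable]: "J s \<in> borel_measurable (Fil u)" "J u \<in> borel_measurable (Fil u)"
        "\<zeta> \<in> borel_measurable (Fil u)"
        unfolding J_def
        by (rule elementary_integral_measurable[OF E]
            meas_mono[OF *(1) less_imp_le[OF *(2)] \<zeta>(1)]; use * in simp)+
      have \<zeta>': "(\<lambda>\<omega>. \<zeta> \<omega> * Z s u \<omega>) \<in> borel_measurable (Fil u)" "\<And>\<omega>. 0 \<le> \<zeta> \<omega> * Z s u \<omega>"
        using \<zeta> unfolding Z_def by (measurable, auto)
      have "Z s t \<omega> = Z s u \<omega> * Z u t \<omega>" for \<omega>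
        unfolding Z_def by (simp add: inner_diff_left flip: exp_add)
      then have eq: "(\<integral>\<^sup>+\<omega>. ennreal (\<zeta> \<omega> * Z s t \<omega>) \<partial>M) = (\<integral>\<^sup>+\<omega>. ennreal ((\<zeta> \<omega> * Z s u \<omega>) * Z u t \<omega>) \<partial>M)"
        by (simp add: mult.assoc)
      have "(\<integral>\<^sup>+\<omega>. ennreal (\<zeta> \<omega>) \<partial>M) \<le> (\<integral>\<^sup>+\<omega>. ennreal (\<zeta> \<omega> * Z s u \<omega>) \<partial>M)"
        using *(4) \<zeta> unfolding R_def by blast
      also have "\<dots> \<le> (\<integral>\<^sup>+\<omega>. ennreal ((\<zeta> \<omega> * Z s u \<omega>) * Z u t \<omega>) \<partial>M)"
        using *(5) \<zeta>' unfolding R_def by blast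
      finally show "(\<integral>\<^sup>+\<omega>. ennreal (\<zeta> \<omega>) \<partial>M) \<le> (\<integral>\<^sup>+\<omega>. ennreal (\<zeta> \<omega> * Z s t \<omega>) \<partial>M)"
        unfolding eq .
    qed
  qed (auto simp: R_def Z_def finite_endpoints st)
  then show ?thesis
    using \<zeta> unfolding R_def Z_def J_def by blast
qed

end

section \<open>Uniqueness of the stochastic integral\<close>

lemma borel_measurable_nn_integral_count_space:
  fixes f :: "'i \<Rightarrow> 'a \<Rightarrow> ennreal"
  assumes B: "countable B" and [measurable]: "\<And>e. e \<in> B \<Longrightarrow> f e \<in> borel_measurable N"
  shows "(\<lambda>x. \<integral>\<^sup>+e. f e x \<partial>count_space B) \<in> borel_measurable N"
proof (cases "finite B")
  case True
  then show ?thesis by (simp add: nn_integral_count_space_finite)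
next
  case False
  have bij: "bij_betw (from_nat_into B) UNIV B"
    using bij_betw_from_nat_into B False by blast
  have "(\<integral>\<^sup>+e. f e x \<partial>count_space B) = (\<Sum>n. f (from_nat_into B n) x)" for x
    by (simp add: nn_integral_bij_count_space[OF bij, symmetric] nn_integral_count_space_nat)
  moreover have "f (from_nat_into B n) \<in> borel_measurable N" for n
    using bij by (intro assms) (auto simp: bij_betw_def)
  ultimately show ?thesis by simp
qed

text \<open>Pointwise measurability suffices because the Hilbert-Schmidt norm is a countable sum
  over the basis.\<close>

lemma hs_sq_measurable:
  fixes A :: "'x \<Rightarrow> ('h::{real_inner,banach,second_countable_topology} \<Rightarrow>\<^sub>L 'k::{real_inner,second_countable_topology})"
  assumes "\<And>h. (\<lambda>x. blinfun_apply (A x) h) \<in> borel_measurable N"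
  shows "(\<lambda>x. hs_sq (A x)) \<in> borel_measurable N"
  unfolding hs_sq_def
  by (intro borel_measurable_nn_integral_count_space countable_the_basis)
     (use assms in measurable)

lemma norm_add_power2_le: "(norm (a + b))\<^sup>2 \<le> 2 * (norm a)\<^sup>2 + 2 * (norm (b::'a::real_normed_vector))\<^sup>2"
proof -
  have "(norm (a + b))\<^sup>2 \<le> (norm a + norm b)\<^sup>2"
    by (intro power_mono norm_triangle_ineq) simp
  also have "\<dots> \<le> 2 * (norm a)\<^sup>2 + 2 * (norm b)\<^sup>2"
    using sum_squares_bound[of "norm a" "norm b"] by (simp add: power2_sum)
  finally show ?thesis .
qed

lemma hs_sq_add_le: "hs_sq (A + B) \<le> 2 * hs_sq A + 2 * hs_sq B"
proof -
  have "hs_sq (A + B) \<le> (\<integral>\<^sup>+e. 2 * ennreal ((norm (blinfun_apply A e))\<^sup>2)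
      + 2 * ennreal ((norm (blinfun_apply B e))\<^sup>2) \<partial>count_space the_basis)"
    unfolding hs_sq_def
  proof (intro nn_integral_mono)
    fix e
    have "ennreal ((norm (blinfun_apply (A + B) e))\<^sup>2)
        \<le> ennreal (2 * (norm (blinfun_apply A e))\<^sup>2 + 2 * (norm (blinfun_apply B e))\<^sup>2)"
      unfolding blinfun.add_left by (intro ennreal_leI norm_add_power2_le)
    also have "\<dots> = 2 * ennreal ((norm (blinfun_apply A e))\<^sup>2) + 2 * ennreal ((norm (blinfun_apply B e))\<^sup>2)"
      by (simp add: ennreal_mult)
    finally show "ennreal ((norm (blinfun_apply (A + B) e))\<^sup>2)
        \<le> 2 * ennreal ((norm (blinfun_apply A e))\<^sup>2) + 2 * ennreal ((norm (blinfun_apply B e))\<^sup>2)" .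
  qed
  also have "\<dots> = 2 * hs_sq A + 2 * hs_sq B"
    unfolding hs_sq_def by (simp add: nn_integral_add nn_integral_cmult)
  finally show ?thesis .
qed

lemma hs_sq_uminus: "hs_sq (- A) = hs_sq A"
  unfolding hs_sq_def by (simp add: blinfun.minus_left)

text \<open>Together with list append as addition this makes the difference of two elementary
  processes elementary.\<close>

definition neg_elementary :: "('w, 'h, 'k) elementary \<Rightarrow> ('w, 'h, 'k) elementary" where
  "neg_elementary E = map (\<lambda>(a, b, \<xi>, h, k). (a, b, \<lambda>\<omega>. - \<xi> \<omega>, h, k)) E"

lemma elementary_process_append:
  "elementary_process M t0 Fil (E @ E') \<longleftrightarrow> elementary_process M t0 Fil E \<and> elementary_process M t0 Fil E'"
  unfolding elementary_process_def set_append ball_Un ..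

lemma elementary_process_neg: "elementary_process M t0 Fil E \<Longrightarrow> elementary_process M t0 Fil (neg_elementary E)"
proof -
  have "bounded ((\<lambda>\<omega>. - \<xi> \<omega> :: real) ` space M)" if "bounded (\<xi> ` space M)" for \<xi>
  proof -
    have "(\<lambda>\<omega>. - \<xi> \<omega> :: real) ` space M = uminus ` (\<xi> ` space M)" by auto
    then show ?thesis using that by simp
  qed
  then show "elementary_process M t0 Fil E \<Longrightarrow> elementary_process M t0 Fil (neg_elementary E)"
    by (fastforce simp: elementary_process_def neg_elementary_def)
qed

lemma elementary_integral_append:
  "elementary_integral W (E @ E') t \<omega> = elementary_integral W E t \<omega> + elementary_integral W E' t \<omega>"
  by (simp add: elementary_integral_def)

lemma elementary_value_append:
  "elementary_value (E @ E') t \<omega> = elementary_value E t \<omega> + elementary_value E' t \<omega>"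
  by (simp add: elementary_value_def)

lemma elementary_integral_neg: "elementary_integral W (neg_elementary E) t \<omega> = - elementary_integral W E t \<omega>"
  unfolding elementary_integral_def neg_elementary_def
  by (induction E) (auto simp: split_beta')

lemma elementary_value_neg: "elementary_value (neg_elementary E) t \<omega> = - elementary_value E t \<omega>"
  unfolding elementary_value_def neg_elementary_def
  by (induction E) (auto simp: split_beta')

lemma elementary_value_measurable_time [measurable]:
  fixes E :: "('w, 'h::{real_inner,second_countable_topology}, 'k::{real_inner,second_countable_topology}) elementary"
  shows "(\<lambda>s. blinfun_apply (elementary_value E s \<omega>) h) \<in> borel_measurable borel"
  unfolding elementary_value_apply
  by (intro borel_measurable_sum_list) (auto simp: split_beta')

lemma quad_scaleR: "quad E (c *\<^sub>R k) s t \<omega> = c\<^sup>2 * quad E k s t \<omega>"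
proof -
  have "dual_value E (c *\<^sub>R k) r \<omega> = c *\<^sub>R dual_value E k r \<omega>" for r
    unfolding dual_value_def by (induction E) (auto simp: algebra_simps)
  then show ?thesis
    unfolding quad_def by (simp add: power_mult_distrib)
qed

lemma progressively_measurable_section:
  assumes "progressively_measurable t0 Fil X" "t0 \<le> T" "\<omega> \<in> space (Fil T)"
  shows "(\<lambda>s. X s \<omega>) \<in> borel_measurable (restrict_space borel {t0..T})"
proof -
  have "(\<lambda>(s, \<omega>). X s \<omega>) \<in> borel_measurable (restrict_space borel {t0..T} \<Otimes>\<^sub>M Fil T)"
    using assms by (auto simp: progressively_measurable_def)
  from measurable_compose[OF measurable_Pair2'[OF assms(3)] this] show ?thesis
    by simp
qed

section \<open>Tail bound for elementary integrals and comparison of two approximations\<close>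

context bm_setting
begin

text \<open>Holds for every sample point, whatever the value of \<open>W t0\<close>: both clipped
  times are \<open>t0\<close> and the two terms cancel.\<close>

lemma elementary_integral_start:
  assumes "elementary_process M t0 Fil E"
  shows "elementary_integral W E t0 \<omega> = 0"
proof -
  have "(case x of (a, b, \<xi>, h, k) \<Rightarrow> (\<xi> \<omega> * (W (min b t0) h \<omega> - W (min a t0) h \<omega>)) *\<^sub>R k) = 0"
    if "x \<in> set E" for x
  proof -
    obtain a b \<xi> h k where x: "x = (a, b, \<xi>, h, k)" by (cases x) auto
    then have "t0 \<le> a" "a \<le> b" using assms that by (auto simp: elementary_process_def)
    then have "min a t0 = t0" "min b t0 = t0" by auto
    then show ?thesis by (simp add: x)
  qed
  then have "map (\<lambda>(a, b, \<xi>, h, k). (\<xi> \<omega> * (W (min b t0) h \<omega> - W (min a t0) h \<omega>)) *\<^sub>R k) E = map (\<lambda>_. 0) E"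
    by (intro map_cong refl)
  then show ?thesis
    unfolding elementary_integral_def by (simp only: sum_list_0)
qed

text \<open>Chernoff's bound with free parameter \<open>\<theta>\<close>; the directions
  \<open>k\<close> and \<open>- k\<close> give the factor 2. Localising to small \<open>quad\<close>
  makes the random compensator deterministic and fits the definition of the integral, where
  integrands converge only in probability.\<close>

lemma elementary_tail:
  fixes E :: "('w, 'h, 'k::{real_inner,second_countable_topology}) elementary"
  assumes E: "elementary_process M t0 Fil E" and t: "t0 \<le> t" and \<theta>: "\<theta> > 0"
  shows "prob {\<omega>\<in>space M. \<bar>elementary_integral W E t \<omega> \<bullet> k\<bar> > \<epsilon> \<and> quad E k t0 t \<omega> \<le> \<delta>}
    \<le> 2 * exp (\<kappa> / 2 * \<theta>\<^sup>2 * \<delta> - \<theta> * \<epsilon>)"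
proof -
  define J where "J = elementary_integral W E t"
  define q where "q = quad E k t0 t"
  have [measurable]: "J \<in> borel_measurable M" "q \<in> borel_measurable M"
    unfolding J_def q_def
    using meas_M[OF t elementary_integral_measurable[OF E t order_refl]] meas_M[OF t quad_measurable[OF E]] by auto
  have one: "emeasure M {\<omega>\<in>space M. J \<omega> \<bullet> k' > \<epsilon> \<and> q \<omega> \<le> \<delta>}
      \<le> ennreal (exp (\<kappa> / 2 * \<theta>\<^sup>2 * \<delta> - \<theta> * \<epsilon>))" if k': "k' = k \<or> k' = - k" for k'
  proof -
    define c where "c = exp (\<kappa> / 2 * \<theta>\<^sup>2 * \<delta> - \<theta> * \<epsilon>)"
    have q: "quad E (\<theta> *\<^sub>R k') t0 t \<omega> = \<theta>\<^sup>2 * q \<omega>" for \<omega>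
      using k' quad_scaleR[of E \<theta> k t0 t \<omega>] quad_scaleR[of E "- \<theta>" k t0 t \<omega>] by (auto simp: q_def)
    have "(\<integral>\<^sup>+\<omega>. ennreal (exp (J \<omega> \<bullet> (\<theta> *\<^sub>R k') - \<kappa> / 2 * (\<theta>\<^sup>2 * q \<omega>))) \<partial>M) \<le> (\<integral>\<^sup>+\<omega>. ennreal 1 \<partial>M)"
      using exp_elementary_le[OF E order_refl t, of "\<lambda>_. 1" "\<theta> *\<^sub>R k'"]
      by (simp add: elementary_integral_start[OF E] q J_def)
    also have "\<dots> = 1" by (simp add: emeasure_space_1)
    finally have int: "(\<integral>\<^sup>+\<omega>. ennreal (exp (J \<omega> \<bullet> (\<theta> *\<^sub>R k') - \<kappa> / 2 * (\<theta>\<^sup>2 * q \<omega>))) \<partial>M) \<le> 1" .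
    have "emeasure M {\<omega>\<in>space M. J \<omega> \<bullet> k' > \<epsilon> \<and> q \<omega> \<le> \<delta>}
        = (\<integral>\<^sup>+\<omega>. indicator {\<omega>\<in>space M. J \<omega> \<bullet> k' > \<epsilon> \<and> q \<omega> \<le> \<delta>} \<omega> \<partial>M)"
      by (subst nn_integral_indicator) auto
    also have "\<dots> \<le> (\<integral>\<^sup>+\<omega>. ennreal c * ennreal (exp (J \<omega> \<bullet> (\<theta> *\<^sub>R k') - \<kappa> / 2 * (\<theta>\<^sup>2 * q \<omega>))) \<partial>M)"
    proof (intro nn_integral_mono)
      fix \<omega>
      have "1 \<le> c * exp (J \<omega> \<bullet> (\<theta> *\<^sub>R k') - \<kappa> / 2 * (\<theta>\<^sup>2 * q \<omega>))"
        if "J \<omega> \<bullet> k' > \<epsilon>" "q \<omega> \<le> \<delta>"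
      proof -
        have "\<kappa> / 2 * (\<theta>\<^sup>2 * q \<omega>) \<le> \<kappa> / 2 * (\<theta>\<^sup>2 * \<delta>)"
          using that kappa_pos by (intro mult_left_mono) auto
        moreover have "\<theta> * \<epsilon> \<le> \<theta> * (J \<omega> \<bullet> k')"
          using that \<theta> by (intro mult_left_mono) auto
        ultimately have "0 \<le> (\<kappa> / 2 * \<theta>\<^sup>2 * \<delta> - \<theta> * \<epsilon>) + (J \<omega> \<bullet> (\<theta> *\<^sub>R k') - \<kappa> / 2 * (\<theta>\<^sup>2 * q \<omega>))"
          by (simp add: algebra_simps)
        then show ?thesis unfolding c_def exp_add[symmetric] by (simp add: one_le_exp_iff)
      qed
      then show "indicator {\<omega>\<in>space M. J \<omega> \<bullet> k' > \<epsilon> \<and> q \<omega> \<le> \<delta>} \<omega>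
          \<le> ennreal c * ennreal (exp (J \<omega> \<bullet> (\<theta> *\<^sub>R k') - \<kappa> / 2 * (\<theta>\<^sup>2 * q \<omega>)))"
        by (auto simp: indicator_def c_def simp flip: ennreal_mult)
    qed
    also have "\<dots> = ennreal c * (\<integral>\<^sup>+\<omega>. ennreal (exp (J \<omega> \<bullet> (\<theta> *\<^sub>R k') - \<kappa> / 2 * (\<theta>\<^sup>2 * q \<omega>))) \<partial>M)"
      by (rule nn_integral_cmult) measurable
    also have "\<dots> \<le> ennreal c * 1"
      by (intro mult_left_mono int) simp
    finally show ?thesis by (simp add: c_def)
  qed
  have "emeasure M {\<omega>\<in>space M. \<bar>J \<omega> \<bullet> k\<bar> > \<epsilon> \<and> q \<omega> \<le> \<delta>}
      \<le> emeasure M ({\<omega>\<in>space M. J \<omega> \<bullet> k > \<epsilon> \<and> q \<omega> \<le> \<delta>} \<union> {\<omega>\<in>space M. J \<omega> \<bullet> (- k) > \<epsilon> \<and> q \<omega> \<le> \<delta>})"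
    by (intro emeasure_mono) auto
  also have "\<dots> \<le> emeasure M {\<omega>\<in>space M. J \<omega> \<bullet> k > \<epsilon> \<and> q \<omega> \<le> \<delta>}
      + emeasure M {\<omega>\<in>space M. J \<omega> \<bullet> (- k) > \<epsilon> \<and> q \<omega> \<le> \<delta>}"
    by (intro emeasure_subadditive) auto
  also have "\<dots> \<le> ennreal (exp (\<kappa> / 2 * \<theta>\<^sup>2 * \<delta> - \<theta> * \<epsilon>)) + ennreal (exp (\<kappa> / 2 * \<theta>\<^sup>2 * \<delta> - \<theta> * \<epsilon>))"
    by (intro add_mono one) auto
  also have "\<dots> = ennreal (2 * exp (\<kappa> / 2 * \<theta>\<^sup>2 * \<delta> - \<theta> * \<epsilon>))"
    by (simp flip: ennreal_plus)
  finally show ?thesis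
    unfolding J_def q_def by (simp add: emeasure_eq_measure)
qed

text \<open>The difference \<open>G n\<close> of the two approximations is elementary. Its squared
  Hilbert-Schmidt norm, integrated over time, is small in probability, hence so is
  \<open>quad\<close> in each unit direction, and the tail bound makes the two elementary integrals
  close in that direction. Countably many basis directions and Parseval finish the proof.\<close>

lemma ito_integral_unique:
  fixes \<Phi> :: "real \<Rightarrow> 'w \<Rightarrow> ('h \<Rightarrow>\<^sub>L 'k::{real_inner,banach,second_countable_topology})"
  assumes I: "has_ito_integral M t0 Fil W \<Phi> t I" and I': "has_ito_integral M t0 Fil W \<Phi> t I'" and t: "t0 \<le> t"
  shows "AE \<omega> in M. I \<omega> = I' \<omega>"
proof -
  have prog: "progressively_measurable t0 Fil (\<lambda>s \<omega>. blinfun_apply (\<Phi> s \<omega>) h)" for h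
    using I by (auto simp: has_ito_integral_def)
  have [measurable]: "I \<in> borel_measurable M" "I' \<in> borel_measurable M"
    using I I' by (auto simp: has_ito_integral_def)
  obtain E where E: "\<And>n. elementary_process M t0 Fil (E n)"
    and EV: "vanishes_in_probability M
            (\<lambda>n \<omega>. \<integral>\<^sup>+s\<in>{t0..t}. (hs_norm (elementary_value (E n) s \<omega> - \<Phi> s \<omega>))\<^sup>2 \<partial>lborel)"
    and EI: "vanishes_in_probability M (\<lambda>n \<omega>. ennreal (dist (elementary_integral W (E n) t \<omega>) (I \<omega>)))"
    using I unfolding has_ito_integral_def by blast
  obtain E' where E': "\<And>n. elementary_process M t0 Fil (E' n)"
    and EV': "vanishes_in_probability M
            (\<lambda>n \<omega>. \<integral>\<^sup>+s\<in>{t0..t}. (hs_norm (elementary_value (E' n) s \<omega> - \<Phi> s \<omega>))\<^sup>2 \<partial>lborel)"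
    and EI': "vanishes_in_probability M (\<lambda>n \<omega>. ennreal (dist (elementary_integral W (E' n) t \<omega>) (I' \<omega>)))"
    using I' unfolding has_ito_integral_def by blast
  define D where "D F \<omega> = (\<integral>\<^sup>+s\<in>{t0..t}. hs_sq (elementary_value F s \<omega> - \<Phi> s \<omega>) \<partial>lborel)"
    for F :: "('w, 'h, 'k) elementary" and \<omega>
  have Dm[measurable]: "D (E n) \<in> borel_measurable M" "D (E' n) \<in> borel_measurable M" for n
    using EV EV' unfolding D_def vanishes_in_probability_def hs_norm_power2 by auto
  have [measurable]: "elementary_integral W F t \<in> borel_measurable M"
    if "elementary_process M t0 Fil F" for F :: "('w, 'h, 'k) elementary"
    using meas_M[OF t elementary_integral_measurable[OF that t order_refl]] .
  note [measurable] = this[OF E] this[OF E']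
  define G where "G n = E n @ neg_elementary (E' n)" for n
  have G: "elementary_process M t0 Fil (G n)" for n
    unfolding G_def elementary_process_append by (intro conjI E elementary_process_neg E')
  have Gq: "ennreal (quad (G n) f t0 t \<omega>) \<le> 2 * D (E n) \<omega> + 2 * D (E' n) \<omega>"
    if f: "norm f = 1" and \<omega>: "\<omega> \<in> space M" for f n \<omega>
  proof -
    have \<omega>': "\<omega> \<in> space (Fil t)" using sub[OF t] \<omega> by (simp add: subalgebra_def)
    have [measurable]: "(\<lambda>s. hs_sq (elementary_value F s \<omega> - \<Phi> s \<omega>)) \<in> borel_measurable (restrict_space borel {t0..t})"
      for F :: "('w, 'h, 'k) elementary"
    proof (rule hs_sq_measurable)
      fix h
      have [measurable]: "(\<lambda>s. blinfun_apply (\<Phi> s \<omega>) h) \<in> borel_measurable (restrict_space borel {t0..t})"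
        by (rule progressively_measurable_section[OF prog t \<omega>'])
      have [measurable]: "(\<lambda>s. blinfun_apply (elementary_value F s \<omega>) h) \<in> borel_measurable (restrict_space borel {t0..t})"
        by (rule measurable_restrict_space1) measurable
      show "(\<lambda>s. blinfun_apply (elementary_value F s \<omega> - \<Phi> s \<omega>) h) \<in> borel_measurable (restrict_space borel {t0..t})"
        unfolding blinfun.diff_left by measurable
    qed
    then have m: "(\<lambda>s. hs_sq (elementary_value F s \<omega> - \<Phi> s \<omega>) * indicator {t0..t} s) \<in> borel_measurable lborel"
      for F :: "('w, 'h, 'k) elementary"
      by (subst (asm) borel_measurable_restrict_space_iff_ennreal) auto
    have "ennreal (quad (G n) f t0 t \<omega>) = (\<integral>\<^sup>+r\<in>{t0<..t}. ennreal ((norm (dual_value (G n) f r \<omega>))\<^sup>2) \<partial>lborel)"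
      by (rule quad_nn_integral)
    also have "\<dots> \<le> (\<integral>\<^sup>+r. 2 * (hs_sq (elementary_value (E n) r \<omega> - \<Phi> r \<omega>) * indicator {t0..t} r)
        + 2 * (hs_sq (elementary_value (E' n) r \<omega> - \<Phi> r \<omega>) * indicator {t0..t} r) \<partial>lborel)"
    proof (intro nn_integral_mono)
      fix r
      have "elementary_value (G n) r \<omega> = (elementary_value (E n) r \<omega> - \<Phi> r \<omega>)
          + - (elementary_value (E' n) r \<omega> - \<Phi> r \<omega>)"
        by (simp add: G_def elementary_value_append elementary_value_neg)
      then have "ennreal ((norm (dual_value (G n) f r \<omega>))\<^sup>2)
          \<le> hs_sq ((elementary_value (E n) r \<omega> - \<Phi> r \<omega>) + - (elementary_value (E' n) r \<omega> - \<Phi> r \<omega>))"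
        using dual_value_le_hs_sq[of "G n" f r \<omega>] f by simp
      also have "\<dots> \<le> 2 * hs_sq (elementary_value (E n) r \<omega> - \<Phi> r \<omega>) + 2 * hs_sq (elementary_value (E' n) r \<omega> - \<Phi> r \<omega>)"
        using hs_sq_add_le[of "elementary_value (E n) r \<omega> - \<Phi> r \<omega>" "- (elementary_value (E' n) r \<omega> - \<Phi> r \<omega>)"]
        unfolding hs_sq_uminus .
      finally show "ennreal ((norm (dual_value (G n) f r \<omega>))\<^sup>2) * indicator {t0<..t} r
          \<le> 2 * (hs_sq (elementary_value (E n) r \<omega> - \<Phi> r \<omega>) * indicator {t0..t} r)
        + 2 * (hs_sq (elementary_value (E' n) r \<omega> - \<Phi> r \<omega>) * indicator {t0..t} r)"
        by (auto simp: indicator_def)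
    qed
    also have "\<dots> = 2 * D (E n) \<omega> + 2 * D (E' n) \<omega>"
      unfolding D_def using m by (subst nn_integral_add) (auto simp: nn_integral_cmult)
    finally show ?thesis .
  qed
  \<comment> \<open>The three errors are those of each integral against its own approximant and of
    the two approximants against each other.\<close>
  have zero: "AE \<omega> in M. \<bar>(I \<omega> - I' \<omega>) \<bullet> f\<bar> \<le> 3 * \<epsilon>" if f: "norm f = 1" and \<epsilon>: "\<epsilon> > 0" for f \<epsilon>
  proof -
    define B where "B = {\<omega>\<in>space M. \<bar>(I \<omega> - I' \<omega>) \<bullet> f\<bar> > 3 * \<epsilon>}"
    have [measurable]: "B \<in> sets M" unfolding B_def by measurable
    have "prob B \<le> 2 * exp (1 - \<theta> * \<epsilon>)" if \<theta>: "\<theta> > 0" for \<theta>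
    proof -
      \<comment> \<open>Solves \<open>\<kappa> / 2 * \<theta>\<^sup>2 * \<delta> = 1\<close>. Each
        of the two distances \<open>D\<close> enters \<open>Gq\<close> with factor 2, so each may
        use up \<open>\<delta> / 4\<close>.\<close>
      define \<delta> where "\<delta> = 2 / (\<kappa> * \<theta>\<^sup>2)"
      have \<delta>: "\<delta> > 0" using kappa_pos \<theta> by (simp add: \<delta>_def)
      define p where "p n = prob {\<omega>\<in>space M. ennreal (dist (elementary_integral W (E n) t \<omega>) (I \<omega>)) > ennreal \<epsilon>}
        + prob {\<omega>\<in>space M. ennreal (dist (elementary_integral W (E' n) t \<omega>) (I' \<omega>)) > ennreal \<epsilon>}
        + prob {\<omega>\<in>space M. D (E n) \<omega> > ennreal (\<delta> / 4)} + prob {\<omega>\<in>space M. D (E' n) \<omega> > ennreal (\<delta> / 4)}" for n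
      have "p \<longlonglongrightarrow> 0 + 0 + 0 + 0"
        unfolding p_def D_def using EV EV' EI EI' \<epsilon> \<delta>
        by (intro tendsto_add) (auto simp: vanishes_in_probability_def hs_norm_power2)
      moreover have "prob B \<le> p n + 2 * exp (1 - \<theta> * \<epsilon>)" for n
      proof -
        have [measurable]: "quad (G n) f t0 t \<in> borel_measurable M" "elementary_integral W (G n) t \<in> borel_measurable M"
          using meas_M[OF t quad_measurable[OF G]] meas_M[OF t elementary_integral_measurable[OF G t order_refl]] by auto
        let ?A1 = "{\<omega>\<in>space M. ennreal (dist (elementary_integral W (E n) t \<omega>) (I \<omega>)) > ennreal \<epsilon>}"
        let ?A2 = "{\<omega>\<in>space M. ennreal (dist (elementary_integral W (E' n) t \<omega>) (I' \<omega>)) > ennreal \<epsilon>}"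
        let ?A3 = "{\<omega>\<in>space M. D (E n) \<omega> > ennreal (\<delta> / 4)}"
        let ?A4 = "{\<omega>\<in>space M. D (E' n) \<omega> > ennreal (\<delta> / 4)}"
        let ?A5 = "{\<omega>\<in>space M. \<bar>elementary_integral W (G n) t \<omega> \<bullet> f\<bar> > \<epsilon> \<and> quad (G n) f t0 t \<omega> \<le> \<delta>}"
        have "B \<subseteq> ?A1 \<union> ?A2 \<union> ?A3 \<union> ?A4 \<union> ?A5"
        proof
          fix \<omega> assume "\<omega> \<in> B"
          then have \<omega>: "\<omega> \<in> space M" "\<bar>(I \<omega> - I' \<omega>) \<bullet> f\<bar> > 3 * \<epsilon>" by (auto simp: B_def)
          show "\<omega> \<in> ?A1 \<union> ?A2 \<union> ?A3 \<union> ?A4 \<union> ?A5"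
          proof (rule ccontr)
            assume "\<omega> \<notin> ?A1 \<union> ?A2 \<union> ?A3 \<union> ?A4 \<union> ?A5"
            then have d1: "dist (elementary_integral W (E n) t \<omega>) (I \<omega>) \<le> \<epsilon>"
              and d2: "dist (elementary_integral W (E' n) t \<omega>) (I' \<omega>) \<le> \<epsilon>"
              and D1: "D (E n) \<omega> \<le> ennreal (\<delta> / 4)" and D2: "D (E' n) \<omega> \<le> ennreal (\<delta> / 4)"
              and d5: "\<not> (\<bar>elementary_integral W (G n) t \<omega> \<bullet> f\<bar> > \<epsilon> \<and> quad (G n) f t0 t \<omega> \<le> \<delta>)"
              using \<omega>(1) \<epsilon> by (auto simp: not_less)
            have "ennreal (quad (G n) f t0 t \<omega>) \<le> 2 * ennreal (\<delta> / 4) + 2 * ennreal (\<delta> / 4)"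
              using Gq[OF f \<omega>(1), of n] D1 D2 by (meson add_mono mult_left_mono order_trans zero_le)
            also have "2 * ennreal (\<delta> / 4) = ennreal (\<delta> / 2)"
              using ennreal_mult[of 2 "\<delta> / 4"] \<delta> by simp
            also have "ennreal (\<delta> / 2) + ennreal (\<delta> / 2) = ennreal \<delta>"
              using \<delta> by (simp flip: ennreal_plus)
            finally have "quad (G n) f t0 t \<omega> \<le> \<delta>" using \<delta> by simp
            with d5 have d5: "\<bar>elementary_integral W (G n) t \<omega> \<bullet> f\<bar> \<le> \<epsilon>" by simp
            define x where "x = elementary_integral W (E n) t \<omega>"
            define y where "y = elementary_integral W (E' n) t \<omega>"
            have "\<bar>(I \<omega> - x) \<bullet> f\<bar> \<le> \<epsilon>" "\<bar>(I' \<omega> - y) \<bullet> f\<bar> \<le> \<epsilon>"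
              using Cauchy_Schwarz_ineq2[of "I \<omega> - x" f] Cauchy_Schwarz_ineq2[of "I' \<omega> - y" f] d1 d2 f
              by (auto simp: x_def y_def dist_norm norm_minus_commute)
            moreover have "\<bar>(x - y) \<bullet> f\<bar> \<le> \<epsilon>"
              using d5 by (simp add: x_def y_def G_def elementary_integral_append elementary_integral_neg)
            moreover have "(I \<omega> - I' \<omega>) \<bullet> f = (I \<omega> - x) \<bullet> f - (I' \<omega> - y) \<bullet> f + (x - y) \<bullet> f"
              by (simp add: inner_diff_left)
            ultimately show False using \<omega>(2) by linarith
          qed
        qed
        then have "prob B \<le> prob (?A1 \<union> ?A2 \<union> ?A3 \<union> ?A4 \<union> ?A5)"
          by (intro finite_measure_mono) auto
        also have "\<dots> \<le> prob ?A1 + prob ?A2 + prob ?A3 + prob ?A4 + prob ?A5"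
          by (intro order_trans[OF measure_Un_le] add_right_mono) auto
        also have "prob ?A5 \<le> 2 * exp (\<kappa> / 2 * \<theta>\<^sup>2 * \<delta> - \<theta> * \<epsilon>)"
          by (rule elementary_tail[OF G t \<theta>])
        also have "\<kappa> / 2 * \<theta>\<^sup>2 * \<delta> = 1"
          using kappa_pos \<theta> by (simp add: \<delta>_def)
        finally show ?thesis by (simp add: p_def)
      qed
      ultimately show ?thesis
        by (intro tendsto_lowerbound[of "\<lambda>n. p n + 2 * exp (1 - \<theta> * \<epsilon>)" _ sequentially])
           (auto intro!: tendsto_eq_intros)
    qed
    \<comment> \<open>The limit in \<open>n\<close> has been taken at fixed \<open>\<theta>\<close>,
      since \<open>\<delta>\<close> depends on it; only now may \<open>\<theta>\<close>
      grow.\<close>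
    moreover have "((\<lambda>\<theta>. 2 * exp (1 - \<theta> * \<epsilon>)) \<longlongrightarrow> 0) at_top"
      using \<epsilon> by real_asymp
    ultimately have "prob B \<le> 0"
      by (intro tendsto_lowerbound[of "\<lambda>\<theta>. 2 * exp (1 - \<theta> * \<epsilon>)" 0 at_top "prob B"])
         (auto intro: eventually_mono[OF eventually_gt_at_top[of 0]])
    then have "prob B = 0" using measure_nonneg[of M B] by linarith
    then have "B \<in> null_sets M"
      by (simp add: emeasure_eq_measure null_sets_def)
    from AE_not_in[OF this] show ?thesis
      using AE_space by eventually_elim (auto simp: B_def)
  qed
  have "AE \<omega> in M. \<forall>n. \<bar>(I \<omega> - I' \<omega>) \<bullet> f\<bar> \<le> 3 * (1 / real (Suc n))" if "norm f = 1" for f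
    unfolding AE_all_countable by (intro allI zero[OF that]) simp
  then have "AE \<omega> in M. (I \<omega> - I' \<omega>) \<bullet> f = 0" if "f \<in> the_basis" for f
  proof -
    have "norm f = 1" using the_basis that by (auto simp: orthonormal_basis_def)
    then have "AE \<omega> in M. \<forall>n. \<bar>(I \<omega> - I' \<omega>) \<bullet> f\<bar> \<le> 3 * (1 / real (Suc n))" by fact
    then show ?thesis
    proof eventually_elim
      case (elim \<omega>)
      have "(\<lambda>n. 3 * (1 / real (Suc n))) \<longlonglongrightarrow> 0"
        using tendsto_mult_left[OF LIMSEQ_inverse_real_of_nat, of 3] by (simp add: inverse_eq_divide)
      then have "\<bar>(I \<omega> - I' \<omega>) \<bullet> f\<bar> \<le> 0"
        by (rule tendsto_lowerbound) (use elim in auto)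
      then show ?case by simp
    qed
  qed
  then have "AE \<omega> in M. \<forall>f\<in>the_basis. (I \<omega> - I' \<omega>) \<bullet> f = 0"
    by (intro AE_ball_countable[OF countable_the_basis, THEN iffD2] ballI)
  then show ?thesis
  proof eventually_elim
    case (elim \<omega>)
    have "ennreal ((norm (I \<omega> - I' \<omega>))\<^sup>2) = (\<integral>\<^sup>+f. ennreal (((I \<omega> - I' \<omega>) \<bullet> f)\<^sup>2) \<partial>count_space the_basis)"
      by (rule parseval[OF the_basis, symmetric])
    also have "\<dots> = (\<integral>\<^sup>+f. 0 \<partial>count_space (the_basis :: 'k set))"
      using elim by (intro nn_integral_cong) auto
    finally show ?case by simp
  qed
qed

end

section \<open>Maximal inequality\<close>

primrec run_max :: "(nat \<Rightarrow> real) \<Rightarrow> nat \<Rightarrow> real" where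
  "run_max s 0 = s 0"
| "run_max s (Suc n) = max (run_max s n) (s (Suc n))"

lemma run_max_ge: "k \<le> n \<Longrightarrow> s k \<le> run_max s n"
  by (induction n) (auto simp: le_Suc_eq le_max_iff_disj)

lemma run_max_nonneg: "0 \<le> s 0 \<Longrightarrow> 0 \<le> run_max s n"
  using run_max_ge[of 0 n s] by linarith

lemma run_max_measurable:
  assumes "\<And>k. k \<le> n \<Longrightarrow> (\<lambda>\<omega>. s k \<omega>) \<in> borel_measurable N"
  shows "(\<lambda>\<omega>. run_max (\<lambda>k. s k \<omega>) n) \<in> borel_measurable N"
  using assms by (induction n) auto

lemma run_max_power2_le: "(run_max s n)\<^sup>2 \<le> (\<Sum>k\<le>n. (s k)\<^sup>2)"
proof -
  have "\<exists>k\<le>n. run_max s n = s k"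
    by (induction n) (auto simp: max_def intro: le_SucI)
  then obtain k where k: "k \<le> n" "run_max s n = s k" by blast
  show ?thesis
    unfolding k(2) by (rule member_le_sum[where f = "\<lambda>k. (s k)\<^sup>2"]) (use k in auto)
qed

text \<open>The pathwise form of Doob's inequality in square mean: up to a sum of predictable
  multiples of increments, the squared maximum is below four times the squared final value. Both
  sides are written without subtraction so that they can be integrated in
  \<open>ennreal\<close>.\<close>

lemma run_max_power2_pathwise:
  "(run_max s n)\<^sup>2 + (\<Sum>k<n. 4 * (run_max s k * s (Suc k)))
    \<le> 4 * (s n)\<^sup>2 + (\<Sum>k<n. 4 * (run_max s k * s k))"
proof -
  \<comment> \<open>Summation by parts: the maximum moves only at a new record, where it equals
    \<open>s\<close>, so the sum telescopes to a half square up to terms of favourable sign.\<close>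
  have *: "(\<Sum>k<n. run_max s k * (s (Suc k) - s k)) \<le> run_max s n * s n - (run_max s n)\<^sup>2 / 2"
  proof (induction n)
    case 0
    then show ?case by (simp add: power2_eq_square)
  next
    case (Suc n)
    let ?m = "run_max s n" let ?y = "s (Suc n)"
    have "?m * ?y - ?m\<^sup>2 / 2 \<le> max ?m ?y * ?y - (max ?m ?y)\<^sup>2 / 2"
      using sum_squares_bound[of ?m ?y] by (auto simp: max_def power2_eq_square)
    with Suc show ?case by (simp add: algebra_simps)
  qed
  have "(\<Sum>k<n. 4 * (run_max s k * s (Suc k))) - (\<Sum>k<n. 4 * (run_max s k * s k))
      = 4 * (\<Sum>k<n. run_max s k * (s (Suc k) - s k))"
    by (simp add: sum_distrib_left sum_subtractf[symmetric] algebra_simps)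
  also have "\<dots> \<le> 4 * (run_max s n * s n - (run_max s n)\<^sup>2 / 2)"
    using * by simp
  also have "\<dots> \<le> 4 * (s n)\<^sup>2 - (run_max s n)\<^sup>2"
    using zero_le_power2[of "run_max s n - 2 * s n"] by (simp add: power2_eq_square algebra_simps)
  finally show ?thesis by simp
qed

text \<open>The pathwise inequality is integrated. The submartingale property enters only through
  the weights \<open>run_max\<close>, in the integrated form that \<open>exp_det_ge\<close>
  supplies.\<close>

lemma doob_L2:
  assumes meas[measurable]: "\<And>k. s k \<in> borel_measurable M" and nonneg: "\<And>k \<omega>. 0 \<le> (s k \<omega> :: real)"
    and fin: "\<And>k. k \<le> n \<Longrightarrow> (\<integral>\<^sup>+\<omega>. ennreal ((s k \<omega>)\<^sup>2) \<partial>M) < \<infinity>"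
    and sub: "\<And>k. k < n \<Longrightarrow> (\<integral>\<^sup>+\<omega>. ennreal (run_max (\<lambda>k. s k \<omega>) k * s k \<omega>) \<partial>M)
        \<le> (\<integral>\<^sup>+\<omega>. ennreal (run_max (\<lambda>k. s k \<omega>) k * s (Suc k) \<omega>) \<partial>M)"
  shows "(\<integral>\<^sup>+\<omega>. ennreal ((run_max (\<lambda>k. s k \<omega>) n)\<^sup>2) \<partial>M) \<le> 4 * (\<integral>\<^sup>+\<omega>. ennreal ((s n \<omega>)\<^sup>2) \<partial>M)"
proof -
  define m where "m k \<omega> = run_max (\<lambda>k. s k \<omega>) k" for k \<omega>
  have [measurable]: "m k \<in> borel_measurable M" for k
    unfolding m_def by (intro run_max_measurable) measurable
  have m0: "0 \<le> m k \<omega>" for k \<omega>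
    unfolding m_def by (intro run_max_nonneg nonneg)
  \<comment> \<open>This sum is added to both sides and cancelled at the end, for which it must be
    finite; each term is below a finite sum of second moments.\<close>
  define a where "a = (\<Sum>k<n. 4 * (\<integral>\<^sup>+\<omega>. ennreal (m k \<omega> * s k \<omega>) \<partial>M))"
  have "(\<integral>\<^sup>+\<omega>. ennreal (m k \<omega> * s k \<omega>) \<partial>M) < \<infinity>" if "k < n" for k
  proof -
    have "(\<integral>\<^sup>+\<omega>. ennreal (m k \<omega> * s k \<omega>) \<partial>M) \<le> (\<integral>\<^sup>+\<omega>. (\<Sum>j\<le>k. ennreal ((s j \<omega>)\<^sup>2)) \<partial>M)"
    proof (intro nn_integral_mono)
      fix \<omega>
      have "m k \<omega> * s k \<omega> \<le> (m k \<omega>)\<^sup>2"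
        using m0[of k \<omega>] run_max_ge[of k k "\<lambda>k. s k \<omega>"] unfolding power2_eq_square m_def
        by (intro mult_left_mono) auto
      also have "\<dots> \<le> (\<Sum>j\<le>k. (s j \<omega>)\<^sup>2)"
        unfolding m_def by (rule run_max_power2_le)
      finally show "ennreal (m k \<omega> * s k \<omega>) \<le> (\<Sum>j\<le>k. ennreal ((s j \<omega>)\<^sup>2))"
        by (subst sum_ennreal) (auto intro: ennreal_leI)
    qed
    also have "\<dots> = (\<Sum>j\<le>k. \<integral>\<^sup>+\<omega>. ennreal ((s j \<omega>)\<^sup>2) \<partial>M)"
      by (rule nn_integral_sum) measurable
    also have "\<dots> < \<infinity>"
      using fin that by (auto simp: less_top[symmetric])
    finally show ?thesis .
  qed
  then have afin: "a < \<infinity>"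
    unfolding a_def by (auto simp: ennreal_mult_less_top)
  have "(\<integral>\<^sup>+\<omega>. ennreal ((m n \<omega>)\<^sup>2) \<partial>M) + a
      \<le> (\<integral>\<^sup>+\<omega>. ennreal ((m n \<omega>)\<^sup>2) \<partial>M) + (\<Sum>k<n. 4 * (\<integral>\<^sup>+\<omega>. ennreal (m k \<omega> * s (Suc k) \<omega>) \<partial>M))"
    unfolding a_def using sub by (intro add_left_mono sum_mono mult_left_mono) (auto simp: m_def)
  also have "\<dots> = (\<integral>\<^sup>+\<omega>. ennreal ((m n \<omega>)\<^sup>2 + (\<Sum>k<n. 4 * (m k \<omega> * s (Suc k) \<omega>))) \<partial>M)"
    by (simp add: nn_integral_add nn_integral_sum nn_integral_cmult m0 nonneg sum_nonneg ennreal_plus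
        ennreal_mult flip: sum_ennreal)
  also have "\<dots> \<le> (\<integral>\<^sup>+\<omega>. ennreal (4 * (s n \<omega>)\<^sup>2 + (\<Sum>k<n. 4 * (m k \<omega> * s k \<omega>))) \<partial>M)"
    unfolding m_def by (intro nn_integral_mono ennreal_leI run_max_power2_pathwise)
  also have "\<dots> = 4 * (\<integral>\<^sup>+\<omega>. ennreal ((s n \<omega>)\<^sup>2) \<partial>M) + a"
    unfolding a_def
    by (simp add: nn_integral_add nn_integral_sum nn_integral_cmult m0 nonneg sum_nonneg ennreal_plus
        ennreal_mult flip: sum_ennreal)
  finally show ?thesis
    using afin unfolding m_def by (auto simp: ennreal_add_left_cancel_le add.commute)
qed

lemma power_le_fact_exp: "0 \<le> (x::real) \<Longrightarrow> x ^ j \<le> fact j * exp x"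
proof -
  assume x: "0 \<le> x"
  have "(\<Sum>n\<in>{j}. inverse (fact n) * x ^ n) \<le> (\<Sum>n. inverse (fact n) * x ^ n)"
    using x by (intro sum_le_suminf summable_exp) auto
  then have "inverse (fact j) * x ^ j \<le> exp x"
    by (simp add: exp_def)
  then show "x ^ j \<le> fact j * exp x"
    by (simp add: field_simps)
qed

text \<open>The factorial comes from \<open>x ^ (2 * m) \<le> fact (2 * m) * exp x\<close> for
  \<open>x \<ge> 0\<close>; the other factor is Doob's 4 times the bound
  \<open>2 * exp 2 + 2\<close> for the second moment of twice the hyperbolic cosine.\<close>

definition sup_const :: "nat \<Rightarrow> real" where
  "sup_const m = fact (2 * m) * (8 * exp 2 + 8)"

lemma sup_const_pos: "sup_const m > 0"
  unfolding sup_const_def by (intro mult_pos_pos add_pos_pos) auto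

section \<open>Moments of the supremum of a deterministic elementary integral\<close>

context bm_setting
begin

lemma elementary_integral_measurable_M:
  fixes E :: "('w, 'h, 'k::{real_inner,second_countable_topology}) elementary"
  shows "elementary_process M t0 Fil E \<Longrightarrow> t0 \<le> t \<Longrightarrow> elementary_integral W E t \<in> borel_measurable M"
  using meas_M[of t] elementary_integral_measurable[of E t t] by blast

text \<open>Doob's inequality applied to the submartingale \<open>2 cosh (J \<bullet> f / sqrt v)\<close>.\<close>

lemma scalar_max_moment:
  fixes E :: "('w, 'h, 'k::{real_inner,second_countable_topology}) elementary" and p :: "nat \<Rightarrow> real"
  assumes det: "det_process E" and v: "v > 0" and q: "\<And>\<omega>. \<kappa> * quad E f t0 T \<omega> \<le> v"
    and p: "mono p" "t0 \<le> p 0" "\<And>k. p k \<le> T"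
  obtains m where "m \<in> borel_measurable M"
    "\<And>k \<omega>. k \<le> n \<Longrightarrow> ((elementary_integral W E (p k) \<omega> \<bullet> f)\<^sup>2) ^ j \<le> m \<omega>"
    "(\<integral>\<^sup>+\<omega>. ennreal (m \<omega>) \<partial>M) \<le> ennreal (sup_const j * v ^ j)"
proof -
  note E = det_process_elementary[OF det]
  define J where "J = elementary_integral W E"
  have tp: "t0 \<le> p k" for k using p(1,2) monoD[of p 0 k] by simp
  have [measurable]: "J (p k) \<in> borel_measurable M" for k
    unfolding J_def by (rule elementary_integral_measurable_M[OF E tp])
  \<comment> \<open>Dividing by \<open>sqrt v\<close> makes \<open>\<kappa> * quad\<close> at most 1
    in the rescaled direction.\<close>
  define x where "x k \<omega> = J (p k) \<omega> \<bullet> (f /\<^sub>R sqrt v)" for k \<omega>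
  have [measurable]: "x k \<in> borel_measurable M" for k
    unfolding x_def by measurable
  have xF: "x k \<in> borel_measurable (Fil (p l))" if "k \<le> l" for k l
  proof -
    have [measurable]: "J (p k) \<in> borel_measurable (Fil (p l))"
      unfolding J_def by (rule elementary_integral_measurable[OF E tp monoD[OF p(1) that]])
    show ?thesis unfolding x_def by measurable
  qed
  define s where "s k \<omega> = exp (x k \<omega>) + exp (- x k \<omega>)" for k \<omega>
  have [measurable]: "s k \<in> borel_measurable M" for k
    unfolding s_def by measurable
  have s0: "0 \<le> s k \<omega>" for k \<omega> by (simp add: s_def)
  have sabs: "exp \<bar>x k \<omega>\<bar> \<le> s k \<omega>" for k \<omega> by (cases "x k \<omega> \<ge> 0") (auto simp: s_def)
  then have s1: "1 \<le> s k \<omega>" for k \<omega> using order_trans[of 1 "exp \<bar>x k \<omega>\<bar>" "s k \<omega>"] by simp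
  define M' where "M' k \<omega> = run_max (\<lambda>k. s k \<omega>) k" for k \<omega>
  have M'0: "0 \<le> M' k \<omega>" for k \<omega> unfolding M'_def by (intro run_max_nonneg s0)
  have M'F: "M' k \<in> borel_measurable (Fil (p k))" for k
    unfolding M'_def
  proof (intro run_max_measurable)
    fix i assume "i \<le> k"
    then have [measurable]: "x i \<in> borel_measurable (Fil (p k))" by (rule xF)
    show "(\<lambda>\<omega>. s i \<omega>) \<in> borel_measurable (Fil (p k))" unfolding s_def by measurable
  qed
  have [measurable]: "M' k \<in> borel_measurable M" for k
    using meas_M[OF tp M'F] .
  have ge: "(\<integral>\<^sup>+\<omega>. ennreal (\<zeta> \<omega>) \<partial>M) \<le> (\<integral>\<^sup>+\<omega>. ennreal (\<zeta> \<omega> * exp (c * x (Suc k) \<omega> - c * x k \<omega>)) \<partial>M)"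
    if "\<zeta> \<in> borel_measurable (Fil (p k))" "\<And>\<omega>. 0 \<le> \<zeta> \<omega>" for \<zeta> c k
    using exp_det_ge[OF det tp _ that, of "p (Suc k)" "c *\<^sub>R (f /\<^sub>R sqrt v)"] monoD[OF p(1), of k "Suc k"]
    by (simp add: x_def J_def inner_diff_left right_diff_distrib mult.assoc)
  have sub: "(\<integral>\<^sup>+\<omega>. ennreal (M' k \<omega> * s k \<omega>) \<partial>M) \<le> (\<integral>\<^sup>+\<omega>. ennreal (M' k \<omega> * s (Suc k) \<omega>) \<partial>M)" for k
  proof -
    have [measurable]: "x k \<in> borel_measurable (Fil (p k))" "M' k \<in> borel_measurable (Fil (p k))"
      using xF[of k k] M'F by auto
    have m: "(\<lambda>\<omega>. M' k \<omega> * exp (c * x k \<omega>)) \<in> borel_measurable (Fil (p k))" for c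
      by measurable
    have part: "(\<integral>\<^sup>+\<omega>. ennreal (M' k \<omega> * exp (c * x k \<omega>)) \<partial>M) \<le> (\<integral>\<^sup>+\<omega>. ennreal (M' k \<omega> * exp (c * x (Suc k) \<omega>)) \<partial>M)" for c
      using ge[OF m[of c], of c] M'0 by (simp add: mult.assoc flip: exp_add)
    have eq: "(\<integral>\<^sup>+\<omega>. ennreal (M' k \<omega> * s l \<omega>) \<partial>M)
       = (\<integral>\<^sup>+\<omega>. ennreal (M' k \<omega> * exp (1 * x l \<omega>)) \<partial>M) + (\<integral>\<^sup>+\<omega>. ennreal (M' k \<omega> * exp ((-1) * x l \<omega>)) \<partial>M)" for l
      by (subst nn_integral_add[symmetric]) (auto simp: s_def M'0 distrib_left simp flip: ennreal_plus)
    show ?thesis unfolding eq by (intro add_mono part)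
  qed
  have s2: "(\<integral>\<^sup>+\<omega>. ennreal ((s k \<omega>)\<^sup>2) \<partial>M) \<le> ennreal (2 * exp 2 + 2)" for k
  proof -
    \<comment> \<open>Squaring \<open>s\<close> produces the exponents \<open>2 * x\<close> and
      \<open>- 2 * x\<close>, hence the two values of \<open>c\<close>; for both the compensator is
      at most 2.\<close>
    have le: "(\<integral>\<^sup>+\<omega>. ennreal (exp (c * x k \<omega>)) \<partial>M) \<le> ennreal (exp 2)" if c: "c\<^sup>2 = 4" for c
    proof -
      let ?k = "c *\<^sub>R (f /\<^sub>R sqrt v)"
      have qle: "\<kappa> / 2 * quad E ?k t0 (p k) \<omega> \<le> 2" for \<omega>
      proof -
        have "quad E f t0 (p k) \<omega> \<le> quad E f t0 T \<omega>"
          using quad_add[of t0 "p k" T E f \<omega>] quad_nonneg[of E f "p k" T \<omega>] tp p(3) by simp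
        then have "\<kappa> * quad E f t0 (p k) \<omega> \<le> v"
          using q[of \<omega>] kappa_pos by (meson mult_left_mono less_imp_le order_trans)
        moreover have "quad E ?k t0 (p k) \<omega> = 4 / v * quad E f t0 (p k) \<omega>"
          unfolding quad_scaleR using c v by (simp add: power_inverse field_simps)
        ultimately have "\<kappa> / 2 * quad E ?k t0 (p k) \<omega> = 2 / v * (\<kappa> * quad E f t0 (p k) \<omega>)"
          by (simp only:) simp
        also have "\<dots> \<le> 2 / v * v"
          using v \<open>\<kappa> * quad E f t0 (p k) \<omega> \<le> v\<close> by (intro mult_left_mono) auto
        finally show ?thesis using v by simp
      qed
      have "(\<integral>\<^sup>+\<omega>. ennreal (exp (c * x k \<omega>)) \<partial>M)
          \<le> (\<integral>\<^sup>+\<omega>. ennreal (exp 2) * ennreal (1 * exp ((J (p k) \<omega> - J t0 \<omega>) \<bullet> ?k - \<kappa> / 2 * quad E ?k t0 (p k) \<omega>)) \<partial>M)"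
      proof (intro nn_integral_mono)
        fix \<omega>
        have "c * x k \<omega> \<le> 2 + ((J (p k) \<omega> - J t0 \<omega>) \<bullet> ?k - \<kappa> / 2 * quad E ?k t0 (p k) \<omega>)"
          using qle[of \<omega>] by (simp add: x_def J_def elementary_integral_start[OF E])
        then have "exp (c * x k \<omega>) \<le> exp (2 + ((J (p k) \<omega> - J t0 \<omega>) \<bullet> ?k - \<kappa> / 2 * quad E ?k t0 (p k) \<omega>))"
          by (simp only: exp_le_cancel_iff)
        then show "ennreal (exp (c * x k \<omega>)) \<le> ennreal (exp 2) * ennreal (1 * exp ((J (p k) \<omega> - J t0 \<omega>) \<bullet> ?k - \<kappa> / 2 * quad E ?k t0 (p k) \<omega>))"
          unfolding exp_add[of 2] by (simp add: ennreal_leI flip: ennreal_mult)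
      qed
      also have "\<dots> = ennreal (exp 2) * (\<integral>\<^sup>+\<omega>. ennreal (1 * exp ((J (p k) \<omega> - J t0 \<omega>) \<bullet> ?k - \<kappa> / 2 * quad E ?k t0 (p k) \<omega>)) \<partial>M)"
      proof (rule nn_integral_cmult)
        have [measurable]: "quad E ?k t0 (p k) \<in> borel_measurable M" "J t0 \<in> borel_measurable M"
          using meas_M[OF tp quad_measurable[OF E]] elementary_integral_measurable_M[OF E] by (auto simp: J_def)
        show "(\<lambda>\<omega>. ennreal (1 * exp ((J (p k) \<omega> - J t0 \<omega>) \<bullet> ?k - \<kappa> / 2 * quad E ?k t0 (p k) \<omega>))) \<in> borel_measurable M"
          by measurable
      qed
      also have "\<dots> \<le> ennreal (exp 2) * (\<integral>\<^sup>+\<omega>. ennreal 1 \<partial>M)"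
        unfolding J_def by (intro mult_left_mono exp_elementary_le[OF E order_refl tp]) auto
      finally show ?thesis by (simp add: emeasure_space_1)
    qed
    have "(s k \<omega>)\<^sup>2 = exp (2 * x k \<omega>) + exp ((-2) * x k \<omega>) + 2" for \<omega>
      unfolding s_def power2_sum by (simp add: power2_eq_square flip: exp_add)
    then have "(\<integral>\<^sup>+\<omega>. ennreal ((s k \<omega>)\<^sup>2) \<partial>M)
        = (\<integral>\<^sup>+\<omega>. ennreal (exp (2 * x k \<omega>)) + ennreal (exp ((-2) * x k \<omega>)) + 2 \<partial>M)"
      by (simp add: ennreal_plus)
    also have "\<dots> = (\<integral>\<^sup>+\<omega>. ennreal (exp (2 * x k \<omega>)) \<partial>M) + (\<integral>\<^sup>+\<omega>. ennreal (exp ((-2) * x k \<omega>)) \<partial>M) + 2"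
      by (simp add: nn_integral_add emeasure_space_1)
    also have "\<dots> \<le> ennreal (exp 2) + ennreal (exp 2) + 2"
      by (intro add_mono le) auto
    also have "\<dots> = ennreal (2 * exp 2 + 2)"
      by (subst ennreal_plus[symmetric], simp, simp)
    finally show ?thesis .
  qed
  have "(\<integral>\<^sup>+\<omega>. ennreal ((M' n \<omega>)\<^sup>2) \<partial>M) \<le> 4 * (\<integral>\<^sup>+\<omega>. ennreal ((s n \<omega>)\<^sup>2) \<partial>M)"
    unfolding M'_def
  proof (rule doob_L2)
    show "(\<integral>\<^sup>+\<omega>. ennreal ((s k \<omega>)\<^sup>2) \<partial>M) < \<infinity>" for k
      using s2[of k] by (rule order.strict_trans1) simp
  qed (use sub s0 in \<open>auto simp: M'_def\<close>)
  also have "\<dots> \<le> 4 * ennreal (2 * exp 2 + 2)"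
    by (intro mult_left_mono s2) simp
  finally have dl2: "(\<integral>\<^sup>+\<omega>. ennreal ((M' n \<omega>)\<^sup>2) \<partial>M) \<le> 4 * ennreal (2 * exp 2 + 2)" .
  show thesis
  proof (rule that[of "\<lambda>\<omega>. fact (2 * j) * v ^ j * (M' n \<omega>)\<^sup>2"])
    fix k \<omega> assume "k \<le> n"
    have "\<bar>x k \<omega>\<bar> ^ (2 * j) \<le> fact (2 * j) * exp \<bar>x k \<omega>\<bar>"
      by (rule power_le_fact_exp) simp
    also have "exp \<bar>x k \<omega>\<bar> \<le> s k \<omega>" by (rule sabs)
    also have "s k \<omega> \<le> M' n \<omega>" unfolding M'_def by (rule run_max_ge) fact
    \<comment> \<open>Twice the cosine never falls below 1, so a bound linear in the maximum may be
      weakened to its square, the quantity that Doob's inequality controls.\<close>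
    also have "M' n \<omega> \<le> (M' n \<omega>)\<^sup>2"
    proof -
      have "1 \<le> M' n \<omega>" using s1[of k \<omega>] \<open>s k \<omega> \<le> M' n \<omega>\<close> by linarith
      then show ?thesis by (simp add: power2_eq_square)
    qed
    finally have "(x k \<omega> ^ 2) ^ j \<le> fact (2 * j) * (M' n \<omega>)\<^sup>2"
      by (simp add: power_mult)
    then have "v ^ j * (x k \<omega> ^ 2) ^ j \<le> v ^ j * (fact (2 * j) * (M' n \<omega>)\<^sup>2)"
      using v by (intro mult_left_mono) auto
    moreover have "v ^ j * (x k \<omega> ^ 2) ^ j = ((J (p k) \<omega> \<bullet> f)\<^sup>2) ^ j"
      unfolding power_mult_distrib[symmetric] x_def using v by (simp add: power_mult_distrib power_inverse)
    ultimately show "((elementary_integral W E (p k) \<omega> \<bullet> f)\<^sup>2) ^ j \<le> fact (2 * j) * v ^ j * (M' n \<omega>)\<^sup>2"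
      by (simp add: J_def mult_ac)
  next
    have "(\<integral>\<^sup>+\<omega>. ennreal (fact (2 * j) * v ^ j * (M' n \<omega>)\<^sup>2) \<partial>M)
        = ennreal (fact (2 * j) * v ^ j) * (\<integral>\<^sup>+\<omega>. ennreal ((M' n \<omega>)\<^sup>2) \<partial>M)"
      using v by (subst nn_integral_cmult[symmetric]) (auto simp: ennreal_mult)
    also have "\<dots> \<le> ennreal (fact (2 * j) * v ^ j) * (4 * ennreal (2 * exp 2 + 2))"
      by (intro mult_left_mono dl2) simp
    also have "\<dots> = ennreal (sup_const j * v ^ j)"
    proof -
      have "4 * ennreal (2 * exp 2 + 2) = ennreal (8 * exp 2 + 8)"
        using ennreal_mult[of 4 "2 * exp 2 + 2"] by simp
      then have "ennreal (fact (2 * j) * v ^ j) * (4 * ennreal (2 * exp 2 + 2))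
          = ennreal (fact (2 * j) * v ^ j * (8 * exp 2 + 8))"
        using v by (subst ennreal_mult) auto
      also have "fact (2 * j) * v ^ j * (8 * exp 2 + 8) = sup_const j * v ^ j"
        by (simp add: sup_const_def)
      finally show ?thesis .
    qed
    finally show "(\<integral>\<^sup>+\<omega>. ennreal (fact (2 * j) * v ^ j * (M' n \<omega>)\<^sup>2) \<partial>M) \<le> ennreal (sup_const j * v ^ j)" .
  qed measurable
qed

text \<open>The bound of \<open>scalar_max_moment\<close> does not depend on the number of times, so
  monotone convergence along finite subsets of \<open>S\<close> gives the countable
  supremum.\<close>

lemma scalar_sup_moment:
  fixes E :: "('w, 'h, 'k::{real_inner,second_countable_topology}) elementary"
  assumes det: "det_process E" and v: "v > 0" and q: "\<And>\<omega>. \<kappa> * quad E f t0 T \<omega> \<le> v"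
    and S: "countable S" "S \<noteq> {}" "S \<subseteq> {t0..T}"
  shows "(\<integral>\<^sup>+\<omega>. (SUP t\<in>S. ennreal (((elementary_integral W E t \<omega> \<bullet> f)\<^sup>2) ^ j)) \<partial>M) \<le> ennreal (sup_const j * v ^ j)"
proof -
  define e where "e = from_nat_into S"
  have e: "range e = S" unfolding e_def using S by (simp add: range_from_nat_into)
  define g where "g t \<omega> = ennreal (((elementary_integral W E t \<omega> \<bullet> f)\<^sup>2) ^ j)" for t \<omega>
  have [measurable]: "g (e i) \<in> borel_measurable M" for i
  proof -
    have "e i \<in> S" using e by auto
    then have "t0 \<le> e i" using S by auto
    then have [measurable]: "elementary_integral W E (e i) \<in> borel_measurable M"
      by (rule elementary_integral_measurable_M[OF det_process_elementary[OF det]])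
    show ?thesis unfolding g_def by measurable
  qed
  have "(SUP t\<in>S. g t \<omega>) = (SUP n. SUP i\<in>{..n::nat}. g (e i) \<omega>)" for \<omega>
  proof (intro antisym SUP_least)
    fix t assume "t \<in> S"
    then obtain i where "t = e i" using e by auto
    then show "g t \<omega> \<le> (SUP n. SUP i\<in>{..n}. g (e i) \<omega>)"
      by (intro SUP_upper2[of i] SUP_upper) auto
  next
    fix n i :: nat show "g (e i) \<omega> \<le> (SUP t\<in>S. g t \<omega>)"
      using e by (intro SUP_upper) auto
  qed
  then have "(\<integral>\<^sup>+\<omega>. (SUP t\<in>S. g t \<omega>) \<partial>M) = (\<integral>\<^sup>+\<omega>. (SUP n. SUP i\<in>{..n}. g (e i) \<omega>) \<partial>M)"
    by simp
  also have "\<dots> = (SUP n. \<integral>\<^sup>+\<omega>. (SUP i\<in>{..n}. g (e i) \<omega>) \<partial>M)"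
  proof (rule nn_integral_monotone_convergence_SUP)
    show "incseq (\<lambda>n \<omega>. SUP i\<in>{..n}. g (e i) \<omega>)"
      by (auto simp: incseq_def le_fun_def intro!: SUP_subset_mono)
  qed measurable
  also have "\<dots> \<le> ennreal (sup_const j * v ^ j)"
  proof (rule SUP_least)
    fix n
    define xs where "xs = sorted_list_of_set (e ` {..n})"
    have xs: "set xs = e ` {..n}" "sorted xs" "xs \<noteq> []"
      unfolding xs_def by auto
    \<comment> \<open>Beyond the end of the sorted list the last time is repeated, which makes
      \<open>p\<close> monotone on all natural numbers.\<close>
    define p where "p k = xs ! (min k (length xs - 1))" for k
    have len: "0 < length xs" using xs(3) by simp
    have pin: "p k \<in> set xs" for k
      unfolding p_def by (intro nth_mem) (use len in linarith)
    have mono: "mono p"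
      unfolding p_def by (intro monoI sorted_nth_mono xs(2)) (use len in linarith)+
    have pS: "p k \<in> S" for k using pin[of k] xs(1) e by auto
    obtain m where m: "m \<in> borel_measurable M"
      "\<And>k \<omega>. k \<le> length xs \<Longrightarrow> ((elementary_integral W E (p k) \<omega> \<bullet> f)\<^sup>2) ^ j \<le> m \<omega>"
      "(\<integral>\<^sup>+\<omega>. ennreal (m \<omega>) \<partial>M) \<le> ennreal (sup_const j * v ^ j)"
      using scalar_max_moment[OF det v q mono, where n = "length xs" and j = j] pS S by (metis atLeastAtMost_iff subsetD)
    have "(\<integral>\<^sup>+\<omega>. (SUP i\<in>{..n}. g (e i) \<omega>) \<partial>M) \<le> (\<integral>\<^sup>+\<omega>. ennreal (m \<omega>) \<partial>M)"
    proof (intro nn_integral_mono SUP_least)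
      fix \<omega> i assume "i \<in> {..n}"
      then have "e i \<in> set xs" using xs by auto
      then obtain k where k: "k < length xs" "xs ! k = e i" by (auto simp: in_set_conv_nth)
      moreover from k have "min k (length xs - 1) = k" by linarith
      ultimately have "p k = e i" by (simp add: p_def)
      then show "g (e i) \<omega> \<le> ennreal (m \<omega>)"
        unfolding g_def using m(2)[of k \<omega>] k by (intro ennreal_leI) auto
    qed
    with m(3) show "(\<integral>\<^sup>+\<omega>. (SUP i\<in>{..n}. g (e i) \<omega>) \<partial>M) \<le> ennreal (sup_const j * v ^ j)"
      by simp
  qed
  finally show ?thesis by (simp add: g_def)
qed

lemma det_dual_value: "det_process E \<Longrightarrow> dual_value E k r \<omega> = dual_value E k r \<omega>'"
  unfolding dual_value_def
  by (intro arg_cong[where f = sum_list] map_cong refl) (auto simp: det_process_def)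

lemma det_elementary_value: "det_process E \<Longrightarrow> elementary_value E r \<omega> = elementary_value E r \<omega>'"
  unfolding elementary_value_def
  by (intro arg_cong[where f = sum_list] map_cong refl) (auto simp: det_process_def)

lemma det_quad: "det_process E \<Longrightarrow> quad E k s t \<omega> = quad E k s t \<omega>'"
  unfolding quad_def by (subst det_dual_value[of E k _ \<omega> \<omega>']) auto

text \<open>All values lie in the span of the finite orthonormal set \<open>C\<close>, so the
  squared norm is a finite sum of squared coordinates. Jensen's inequality with weights proportional
  to the coordinate variances yields a bound that depends on the total variance but not on the size
  of \<open>C\<close>, as is needed when \<open>C\<close> grows along an approximation.\<close>

lemma vector_sup_moment:
  fixes E :: "('w, 'h, 'k::{real_inner,banach,second_countable_topology}) elementary"
  assumes det: "det_process E" and C: "finite C" "C \<subseteq> the_basis"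
    and EC: "\<And>a b \<xi> h k. (a, b, \<xi>, h, k) \<in> set E \<Longrightarrow> k \<in> C"
    and H: "(\<integral>\<^sup>+r\<in>{t0..T}. hs_sq (elementary_value E r undefined) \<partial>lborel) \<le> ennreal H" "0 \<le> H" "\<kappa> * H < v"
    and S: "countable S" "S \<noteq> {}" "S \<subseteq> {t0..T}" and j: "j > 0"
  shows "(\<integral>\<^sup>+\<omega>. (SUP t\<in>S. ennreal (norm (elementary_integral W E t \<omega>) ^ (2 * j))) \<partial>M) \<le> ennreal (sup_const j * v ^ j)"
proof -
  define J where "J = elementary_integral W E"
  define q where "q f = quad E f t0 T undefined" for f
  have q0: "0 \<le> q f" for f by (simp add: q_def quad_nonneg)
  have v: "0 < v" using H mult_nonneg_nonneg[of \<kappa> H] kappa_pos by linarith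
  have qsum: "(\<Sum>f\<in>C. q f) \<le> H"
  proof -
    have "ennreal (\<Sum>f\<in>C. q f) = (\<Sum>f\<in>C. \<integral>\<^sup>+r\<in>{t0<..T}. ennreal ((norm (dual_value E f r undefined))\<^sup>2) \<partial>lborel)"
      unfolding quad_nn_integral[symmetric] q_def by (rule sum_ennreal[symmetric]) (rule quad_nonneg)
    also have "\<dots> = (\<integral>\<^sup>+r. (\<Sum>f\<in>C. ennreal ((norm (dual_value E f r undefined))\<^sup>2) * indicator {t0<..T} r) \<partial>lborel)"
      by (rule nn_integral_sum[symmetric]) measurable
    also have "\<dots> \<le> (\<integral>\<^sup>+r\<in>{t0..T}. hs_sq (elementary_value E r undefined) \<partial>lborel)"
    proof (intro nn_integral_mono)
      fix r
      have "(\<Sum>f\<in>C. ennreal ((norm (dual_value E f r undefined))\<^sup>2)) \<le> hs_sq (elementary_value E r undefined)"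
        unfolding nn_integral_dual_value_basis[symmetric] by (rule nn_integral_count_space_ge_sum[OF C])
      then show "(\<Sum>f\<in>C. ennreal ((norm (dual_value E f r undefined))\<^sup>2) * indicator {t0<..T} r)
          \<le> hs_sq (elementary_value E r undefined) * indicator {t0..T} r"
        by (auto simp: indicator_def)
    qed
    also have "\<dots> \<le> ennreal H" by fact
    finally show ?thesis using H(2) by simp
  qed
  have norm_J: "(norm (J t \<omega>))\<^sup>2 = (\<Sum>f\<in>C. (J t \<omega> \<bullet> f)\<^sup>2)" for t \<omega>
  proof -
    have zero: "J t \<omega> \<bullet> f = 0" if f: "f \<in> the_basis - C" for f
    proof -
      have "k \<bullet> f = 0" if "(a, b, \<xi>, h, k) \<in> set E" for a b \<xi> h k
        using orthonormal_basis_inner[OF the_basis, of k f] EC[OF that] C f by auto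
      then have "map (\<lambda>x. (case x of (a, b, \<xi>, h, k) \<Rightarrow> (\<xi> \<omega> * (W (min b t) h \<omega> - W (min a t) h \<omega>)) *\<^sub>R k) \<bullet> f) E = map (\<lambda>_. 0) E"
        by (intro map_cong refl) auto
      then show ?thesis
        unfolding J_def elementary_integral_def inner_sum_list_left by (simp only: sum_list_0)
    qed
    have "ennreal ((norm (J t \<omega>))\<^sup>2) = (\<integral>\<^sup>+f. ennreal ((J t \<omega> \<bullet> f)\<^sup>2) \<partial>count_space the_basis)"
      by (rule parseval[OF the_basis, symmetric])
    also have "\<dots> = (\<integral>\<^sup>+f. ennreal ((J t \<omega> \<bullet> f)\<^sup>2) * indicator C f \<partial>count_space the_basis)"
      using zero by (intro nn_integral_cong) (auto simp: indicator_def)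
    also have "\<dots> = (\<integral>\<^sup>+f. ennreal ((J t \<omega> \<bullet> f)\<^sup>2) \<partial>count_space C)"
      using C by (simp add: nn_integral_restrict_space[symmetric] restrict_count_space Int_absorb1 Int_absorb2)
    also have "\<dots> = ennreal (\<Sum>f\<in>C. (J t \<omega> \<bullet> f)\<^sup>2)"
      using C by (simp add: nn_integral_count_space_finite sum_ennreal)
    finally show ?thesis by (simp add: sum_nonneg)
  qed
  show ?thesis
  proof (cases "C = {}")
    case True
    then have "norm (J t \<omega>) = 0" for t \<omega> using norm_J[of t \<omega>] by simp
    then show ?thesis using j S(2) by (simp add: J_def[symmetric] power_0_left)
  next
    case False
    \<comment> \<open>The excess of \<open>v\<close> over the total variance is spread evenly: every
      weight becomes positive, even for a coordinate without variance, and the weights still add up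
      to \<open>v\<close>.\<close>
    define w where "w f = \<kappa> * q f + (v - \<kappa> * (\<Sum>f\<in>C. q f)) / card C" for f
    have gap: "0 < v - \<kappa> * (\<Sum>f\<in>C. q f)"
      using mult_left_mono[OF qsum less_imp_le[OF kappa_pos]] H(3) by linarith
    have card: "0 < card C" using False C by (simp add: card_gt_0_iff)
    have w_pos: "0 < w f" for f
      unfolding w_def using gap card q0 kappa_pos by (intro add_nonneg_pos) auto
    have w_ge: "\<kappa> * q f \<le> w f" for f
      unfolding w_def using gap card by simp
    have w_sum: "(\<Sum>f\<in>C. w f) = v"
      unfolding w_def using card by (simp add: sum.distrib sum_distrib_left)
    \<comment> \<open>Convexity of the j-th power with weights \<open>w f / v\<close> at the points
      \<open>v / w f * (J t \<omega> \<bullet> f)\<^sup>2\<close>, whose weighted mean is the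
      squared norm.\<close>
    have jensen: "norm (J t \<omega>) ^ (2 * j) \<le> (\<Sum>f\<in>C. (w f / v) * (v / w f) ^ j * ((J t \<omega> \<bullet> f)\<^sup>2) ^ j)" for t \<omega>
    proof -
      have "convex_on {0::real..} (\<lambda>x. x ^ j)"
        using convex_power_even[of j] convex_power_odd[of j] by (cases "even j") (auto intro: convex_on_subset)
      then have "(\<Sum>f\<in>C. (w f / v) *\<^sub>R ((v / w f) * (J t \<omega> \<bullet> f)\<^sup>2)) ^ j
          \<le> (\<Sum>f\<in>C. (w f / v) * ((v / w f) * (J t \<omega> \<bullet> f)\<^sup>2) ^ j)"
        using C False w_pos v w_sum
        by (intro convex_on_sum) (auto simp: less_imp_le sum_divide_distrib[symmetric])
      moreover have "(\<Sum>f\<in>C. (w f / v) *\<^sub>R ((v / w f) * (J t \<omega> \<bullet> f)\<^sup>2)) = (norm (J t \<omega>))\<^sup>2"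
        unfolding norm_J using w_pos v by (intro sum.cong refl) (simp add: less_imp_neq[symmetric])
      ultimately show ?thesis
        by (simp only: power_mult power_mult_distrib mult.assoc)
    qed
    define g where "g f \<omega> = (SUP t\<in>S. ennreal (((J t \<omega> \<bullet> f)\<^sup>2) ^ j))" for f \<omega>
    have gm[measurable]: "g f \<in> borel_measurable M" for f
      unfolding g_def
    proof (rule borel_measurable_SUP)
      fix t assume "t \<in> S"
      then have "t0 \<le> t" using S by auto
      then have [measurable]: "J t \<in> borel_measurable M"
        unfolding J_def by (rule elementary_integral_measurable_M[OF det_process_elementary[OF det]])
      show "(\<lambda>\<omega>. ennreal (((J t \<omega> \<bullet> f)\<^sup>2) ^ j)) \<in> borel_measurable M" by measurable
    qed (rule S)
    have "(\<integral>\<^sup>+\<omega>. (SUP t\<in>S. ennreal (norm (J t \<omega>) ^ (2 * j))) \<partial>M)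
        \<le> (\<integral>\<^sup>+\<omega>. (\<Sum>f\<in>C. ennreal ((w f / v) * (v / w f) ^ j) * g f \<omega>) \<partial>M)"
    proof (intro nn_integral_mono SUP_least)
      fix \<omega> t assume t: "t \<in> S"
      have "ennreal (norm (J t \<omega>) ^ (2 * j)) \<le> ennreal (\<Sum>f\<in>C. (w f / v) * (v / w f) ^ j * ((J t \<omega> \<bullet> f)\<^sup>2) ^ j)"
        by (intro ennreal_leI jensen)
      also have "\<dots> = (\<Sum>f\<in>C. ennreal ((w f / v) * (v / w f) ^ j * ((J t \<omega> \<bullet> f)\<^sup>2) ^ j))"
        using w_pos v by (intro sum_ennreal[symmetric]) (simp add: less_imp_le)
      also have "\<dots> = (\<Sum>f\<in>C. ennreal ((w f / v) * (v / w f) ^ j) * ennreal (((J t \<omega> \<bullet> f)\<^sup>2) ^ j))"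
        using w_pos v by (intro sum.cong refl ennreal_mult) (simp_all add: less_imp_le)
      also have "\<dots> \<le> (\<Sum>f\<in>C. ennreal ((w f / v) * (v / w f) ^ j) * g f \<omega>)"
        unfolding g_def using t by (intro sum_mono mult_left_mono SUP_upper) auto
      finally show "ennreal (norm (J t \<omega>) ^ (2 * j)) \<le> (\<Sum>f\<in>C. ennreal ((w f / v) * (v / w f) ^ j) * g f \<omega>)" .
    qed
    also have "\<dots> = (\<Sum>f\<in>C. ennreal ((w f / v) * (v / w f) ^ j) * (\<integral>\<^sup>+\<omega>. g f \<omega> \<partial>M))"
      by (subst nn_integral_sum) (auto simp: nn_integral_cmult)
    also have "\<dots> \<le> (\<Sum>f\<in>C. ennreal ((w f / v) * (v / w f) ^ j) * ennreal (sup_const j * w f ^ j))"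
    proof (intro sum_mono mult_left_mono)
      fix f
      show "(\<integral>\<^sup>+\<omega>. g f \<omega> \<partial>M) \<le> ennreal (sup_const j * w f ^ j)"
        unfolding g_def J_def
      proof (rule scalar_sup_moment[OF det w_pos _ S])
        fix \<omega> show "\<kappa> * quad E f t0 T \<omega> \<le> w f"
          using w_ge[of f] det_quad[OF det, of f t0 T \<omega> undefined] by (simp add: q_def)
      qed
    qed simp
    \<comment> \<open>The power of \<open>v / w f\<close> from Jensen cancels the power of
      \<open>w f\<close> from the scalar estimate. What remains are the convex weights, which sum to
      1.\<close>
    also have "\<dots> = (\<Sum>f\<in>C. ennreal (w f / v * (sup_const j * v ^ j)))"
    proof (intro sum.cong refl)
      fix f
      have "((w f / v) * (v / w f) ^ j) * (sup_const j * w f ^ j) = w f / v * (sup_const j * v ^ j)"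
        using w_pos[of f] v by (simp add: power_divide)
      then show "ennreal ((w f / v) * (v / w f) ^ j) * ennreal (sup_const j * w f ^ j) = ennreal (w f / v * (sup_const j * v ^ j))"
        using w_pos[of f] v sup_const_pos[of j] by (subst ennreal_mult[symmetric]) (auto simp: less_imp_le)
    qed
    also have "\<dots> = ennreal (\<Sum>f\<in>C. w f / v * (sup_const j * v ^ j))"
      using w_pos v sup_const_pos[of j] by (intro sum_ennreal) (simp add: less_imp_le)
    also have "(\<Sum>f\<in>C. w f / v * (sup_const j * v ^ j)) = sup_const j * v ^ j"
      using w_sum v by (simp add: sum_distrib_right[symmetric] sum_divide_distrib[symmetric])
    finally show ?thesis by (simp add: J_def)
  qed
qed

end

section \<open>Approximation of deterministic integrands\<close>

definition step_fun :: "(real \<times> real \<times> real) list \<Rightarrow> real \<Rightarrow> real" where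
  "step_fun L s = (\<Sum>(a, b, c)\<leftarrow>L. c * indicator {a<..b} s)"

lemma step_fun_simps [simp]:
  "step_fun [] s = 0" "step_fun ((a, b, c) # L) s = c * indicator {a<..b} s + step_fun L s"
  "step_fun (L @ L') s = step_fun L s + step_fun L' s"
  by (simp_all add: step_fun_def)

lemma step_fun_measurable [measurable]: "step_fun L \<in> borel_measurable borel"
  unfolding step_fun_def by (intro borel_measurable_sum_list) (auto simp: split_beta')

lemma step_fun_scale: "step_fun (map (\<lambda>(a, b, c). (a, b, d * c)) L) s = d * step_fun L s"
  by (induction L) (auto simp: algebra_simps)

text \<open>Intervals may not start before \<open>t0\<close>, as \<open>det_process\<close> demands.
  The tolerance refers to the squared distance.\<close>

definition L2_step_approx :: "real \<Rightarrow> real \<Rightarrow> (real \<Rightarrow> real) \<Rightarrow> bool" where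
  "L2_step_approx t0 T f \<longleftrightarrow> (\<forall>\<epsilon>>0. \<exists>L. (\<forall>(a, b, c)\<in>set L. t0 \<le> a \<and> a \<le> b) \<and>
     (\<integral>\<^sup>+s\<in>{t0<..T}. ennreal ((f s - step_fun L s)\<^sup>2) \<partial>lborel) < ennreal \<epsilon>)"

lemma L2_dist_triangle:
  fixes f g h :: "real \<Rightarrow> real"
  assumes [measurable]: "f \<in> borel_measurable borel" "g \<in> borel_measurable borel"
    "h \<in> borel_measurable borel" "A \<in> sets borel"
  shows "(\<integral>\<^sup>+s\<in>A. ennreal ((f s - h s)\<^sup>2) \<partial>lborel)
    \<le> 2 * (\<integral>\<^sup>+s\<in>A. ennreal ((f s - g s)\<^sup>2) \<partial>lborel) + 2 * (\<integral>\<^sup>+s\<in>A. ennreal ((g s - h s)\<^sup>2) \<partial>lborel)"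
proof -
  have "(\<integral>\<^sup>+s\<in>A. ennreal ((f s - h s)\<^sup>2) \<partial>lborel)
     \<le> (\<integral>\<^sup>+s. 2 * (ennreal ((f s - g s)\<^sup>2) * indicator A s) + 2 * (ennreal ((g s - h s)\<^sup>2) * indicator A s) \<partial>lborel)"
  proof (intro nn_integral_mono)
    fix s
    have "(f s - h s)\<^sup>2 \<le> 2 * (f s - g s)\<^sup>2 + 2 * (g s - h s)\<^sup>2"
      using norm_add_power2_le[of "f s - g s" "g s - h s"] by simp
    then have "ennreal ((f s - h s)\<^sup>2) \<le> ennreal (2 * (f s - g s)\<^sup>2 + 2 * (g s - h s)\<^sup>2)"
      by (rule ennreal_leI)
    also have "\<dots> = 2 * ennreal ((f s - g s)\<^sup>2) + 2 * ennreal ((g s - h s)\<^sup>2)"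
      by (simp add: ennreal_mult)
    finally show "ennreal ((f s - h s)\<^sup>2) * indicator A s
        \<le> 2 * (ennreal ((f s - g s)\<^sup>2) * indicator A s) + 2 * (ennreal ((g s - h s)\<^sup>2) * indicator A s)"
      by (auto simp: indicator_def)
  qed
  also have "\<dots> = 2 * (\<integral>\<^sup>+s\<in>A. ennreal ((f s - g s)\<^sup>2) \<partial>lborel) + 2 * (\<integral>\<^sup>+s\<in>A. ennreal ((g s - h s)\<^sup>2) \<partial>lborel)"
    by (simp add: nn_integral_add nn_integral_cmult)
  finally show ?thesis .
qed

lemma ennreal_two_quarters:
  assumes "a < ennreal (\<epsilon> / 4)" "b < ennreal (\<epsilon> / 4)" "\<epsilon> > 0"
  shows "2 * a + 2 * b < ennreal \<epsilon>"
proof -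
  obtain x where x: "a = ennreal x" "0 \<le> x" using assms(1) by (cases a) auto
  obtain y where y: "b = ennreal y" "0 \<le> y" using assms(2) by (cases b) auto
  have "x < \<epsilon> / 4" "y < \<epsilon> / 4"
    using assms(1,2) unfolding x(1) y(1) ennreal_less_iff[OF x(2)] ennreal_less_iff[OF y(2)] .
  then have "ennreal (2 * x + 2 * y) < ennreal \<epsilon>" using x y by (subst ennreal_less_iff) auto
  moreover have "ennreal (2 * x + 2 * y) = 2 * a + 2 * b"
    using x y ennreal_mult[of 2 x] ennreal_mult[of 2 y] ennreal_plus[of "2 * x" "2 * y"] by simp
  ultimately show ?thesis by simp
qed

lemma L2_step_approx_limit:
  assumes f[measurable]: "f \<in> borel_measurable borel"
    and lim: "\<And>\<epsilon>. \<epsilon> > 0 \<Longrightarrow> \<exists>g. g \<in> borel_measurable borel \<and> L2_step_approx t0 T g \<and>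
       (\<integral>\<^sup>+s\<in>{t0<..T}. ennreal ((f s - g s)\<^sup>2) \<partial>lborel) < ennreal \<epsilon>"
  shows "L2_step_approx t0 T f"
  unfolding L2_step_approx_def
proof (intro allI impI)
  fix \<epsilon> :: real assume \<epsilon>: "\<epsilon> > 0"
  then have e4: "\<epsilon> / 4 > 0" by simp
  from lim[OF this] obtain g where g: "g \<in> borel_measurable borel" "L2_step_approx t0 T g"
    "(\<integral>\<^sup>+s\<in>{t0<..T}. ennreal ((f s - g s)\<^sup>2) \<partial>lborel) < ennreal (\<epsilon> / 4)"
    by blast
  obtain L where L: "\<forall>(a, b, c)\<in>set L. t0 \<le> a \<and> a \<le> b"
    "(\<integral>\<^sup>+s\<in>{t0<..T}. ennreal ((g s - step_fun L s)\<^sup>2) \<partial>lborel) < ennreal (\<epsilon> / 4)"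
    using g(2) e4 unfolding L2_step_approx_def by blast
  have "(\<integral>\<^sup>+s\<in>{t0<..T}. ennreal ((f s - step_fun L s)\<^sup>2) \<partial>lborel) < ennreal \<epsilon>"
    using L2_dist_triangle[OF f g(1) step_fun_measurable[of L], of "{t0<..T}"]
      ennreal_two_quarters[OF g(3) L(2) \<epsilon>] by (auto intro: order.strict_trans1)
  with L(1) show "\<exists>L. (\<forall>(a, b, c)\<in>set L. t0 \<le> a \<and> a \<le> b) \<and>
     (\<integral>\<^sup>+s\<in>{t0<..T}. ennreal ((f s - step_fun L s)\<^sup>2) \<partial>lborel) < ennreal \<epsilon>" by blast
qed

lemma L2_step_approx_add:
  assumes f[measurable]: "f \<in> borel_measurable borel" and g[measurable]: "g \<in> borel_measurable borel"
    and af: "L2_step_approx t0 T f" and ag: "L2_step_approx t0 T g"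
  shows "L2_step_approx t0 T (\<lambda>s. f s + g s)"
  unfolding L2_step_approx_def
proof (intro allI impI)
  fix \<epsilon> :: real assume \<epsilon>: "\<epsilon> > 0"
  then have e4: "\<epsilon> / 4 > 0" by simp
  obtain L where L: "\<forall>(a, b, c)\<in>set L. t0 \<le> a \<and> a \<le> b"
    "(\<integral>\<^sup>+s\<in>{t0<..T}. ennreal ((f s - step_fun L s)\<^sup>2) \<partial>lborel) < ennreal (\<epsilon> / 4)"
    using af e4 unfolding L2_step_approx_def by blast
  obtain L' where L': "\<forall>(a, b, c)\<in>set L'. t0 \<le> a \<and> a \<le> b"
    "(\<integral>\<^sup>+s\<in>{t0<..T}. ennreal ((g s - step_fun L' s)\<^sup>2) \<partial>lborel) < ennreal (\<epsilon> / 4)"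
    using ag e4 unfolding L2_step_approx_def by blast
  have "(\<integral>\<^sup>+s\<in>{t0<..T}. ennreal (((f s + g s) - step_fun (L @ L') s)\<^sup>2) \<partial>lborel)
      \<le> 2 * (\<integral>\<^sup>+s\<in>{t0<..T}. ennreal ((f s + g s - (step_fun L s + g s))\<^sup>2) \<partial>lborel)
        + 2 * (\<integral>\<^sup>+s\<in>{t0<..T}. ennreal ((step_fun L s + g s - step_fun (L @ L') s)\<^sup>2) \<partial>lborel)"
    by (rule L2_dist_triangle) auto
  also have "\<dots> < ennreal \<epsilon>"
    using ennreal_two_quarters[OF L(2) L'(2) \<epsilon>] by simp
  finally have "(\<integral>\<^sup>+s\<in>{t0<..T}. ennreal (((f s + g s) - step_fun (L @ L') s)\<^sup>2) \<partial>lborel) < ennreal \<epsilon>" .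
  moreover have "\<forall>(a, b, c)\<in>set (L @ L'). t0 \<le> a \<and> a \<le> b" using L(1) L'(1) by auto
  ultimately show "\<exists>L. (\<forall>(a, b, c)\<in>set L. t0 \<le> a \<and> a \<le> b) \<and>
     (\<integral>\<^sup>+s\<in>{t0<..T}. ennreal ((f s + g s - step_fun L s)\<^sup>2) \<partial>lborel) < ennreal \<epsilon>" by blast
qed

lemma L2_step_approx_scale:
  assumes f[measurable]: "f \<in> borel_measurable borel" and af: "L2_step_approx t0 T f"
  shows "L2_step_approx t0 T (\<lambda>s. d * f s)"
  unfolding L2_step_approx_def
proof (intro allI impI)
  fix \<epsilon> :: real assume \<epsilon>: "\<epsilon> > 0"
  define \<eta> where "\<eta> = \<epsilon> / (d\<^sup>2 + 1)"
  have \<eta>: "\<eta> > 0" unfolding \<eta>_def using \<epsilon> by (intro divide_pos_pos) (auto intro: add_nonneg_pos)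
  obtain L where L: "\<forall>(a, b, c)\<in>set L. t0 \<le> a \<and> a \<le> b"
    "(\<integral>\<^sup>+s\<in>{t0<..T}. ennreal ((f s - step_fun L s)\<^sup>2) \<partial>lborel) < ennreal \<eta>"
    using af \<eta> unfolding L2_step_approx_def by blast
  let ?L = "map (\<lambda>(a, b, c). (a, b, d * c)) L"
  have "(\<integral>\<^sup>+s\<in>{t0<..T}. ennreal ((d * f s - step_fun ?L s)\<^sup>2) \<partial>lborel)
     = (\<integral>\<^sup>+s. ennreal (d\<^sup>2) * (ennreal ((f s - step_fun L s)\<^sup>2) * indicator {t0<..T} s) \<partial>lborel)"
    by (intro nn_integral_cong)
       (auto simp: step_fun_scale indicator_def power_mult_distrib simp flip: ennreal_mult right_diff_distrib)
  also have "\<dots> = ennreal (d\<^sup>2) * (\<integral>\<^sup>+s\<in>{t0<..T}. ennreal ((f s - step_fun L s)\<^sup>2) \<partial>lborel)"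
    by (rule nn_integral_cmult) simp
  also have "\<dots> \<le> ennreal (d\<^sup>2) * ennreal \<eta>"
    using L(2) by (intro mult_left_mono) auto
  also have "\<dots> = ennreal (d\<^sup>2 * \<eta>)"
    using \<eta> by (simp add: ennreal_mult)
  also have "\<dots> < ennreal \<epsilon>"
  proof -
    have "d\<^sup>2 * \<eta> < (d\<^sup>2 + 1) * \<eta>" using \<eta> by simp
    also have "\<dots> = \<epsilon>" unfolding \<eta>_def by (simp add: add_nonneg_eq_0_iff)
    finally show ?thesis using \<eta> by (subst ennreal_less_iff) auto
  qed
  finally have "(\<integral>\<^sup>+s\<in>{t0<..T}. ennreal ((d * f s - step_fun ?L s)\<^sup>2) \<partial>lborel) < ennreal \<epsilon>" .
  moreover have "\<forall>(a, b, c)\<in>set ?L. t0 \<le> a \<and> a \<le> b" using L(1) by auto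
  ultimately show "\<exists>L. (\<forall>(a, b, c)\<in>set L. t0 \<le> a \<and> a \<le> b) \<and>
     (\<integral>\<^sup>+s\<in>{t0<..T}. ennreal ((d * f s - step_fun L s)\<^sup>2) \<partial>lborel) < ennreal \<epsilon>" by blast
qed

lemma L2_step_approx_sum:
  assumes "finite I" "\<And>i. i \<in> I \<Longrightarrow> f i \<in> borel_measurable borel" "\<And>i. i \<in> I \<Longrightarrow> L2_step_approx t0 T (f i)"
  shows "L2_step_approx t0 T (\<lambda>s. \<Sum>i\<in>I. f i s)"
  using assms
proof (induction I)
  case empty
  have "(\<integral>\<^sup>+s\<in>{t0<..T}. ennreal ((0 - step_fun [] s)\<^sup>2) \<partial>lborel) < ennreal \<epsilon>" if "\<epsilon> > 0" for \<epsilon>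
    using that by simp
  then show ?case unfolding L2_step_approx_def by (auto intro!: exI[of _ "[]"])
next
  case (insert i I)
  then show ?case
    by (auto intro!: L2_step_approx_add borel_measurable_sum)
qed

lemma L2_step_approx_Ioc: "L2_step_approx t0 T (indicator {a<..b})"
  unfolding L2_step_approx_def
proof (intro allI impI)
  fix \<epsilon> :: real assume "\<epsilon> > 0"
  \<comment> \<open>The first entry moves the start to \<open>t0\<close> or later; the maximum in
    the second keeps the interval ordered even if it ends before that.\<close>
  let ?L = "[(max a t0, max b (max a t0), 1)]"
  have "(\<integral>\<^sup>+s\<in>{t0<..T}. ennreal ((indicator {a<..b} s - step_fun ?L s)\<^sup>2) \<partial>lborel) = (\<integral>\<^sup>+(s::real). 0 \<partial>lborel)"
    by (intro nn_integral_cong) (auto simp: indicator_def)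
  then show "\<exists>L. (\<forall>(a, b, c)\<in>set L. t0 \<le> a \<and> a \<le> b) \<and>
     (\<integral>\<^sup>+s\<in>{t0<..T}. ennreal ((indicator {a<..b} s - step_fun L s)\<^sup>2) \<partial>lborel) < ennreal \<epsilon>"
    using \<open>\<epsilon> > 0\<close> by (intro exI[of _ ?L]) auto
qed

lemma L2_step_approx_cong:
  assumes "L2_step_approx t0 T f" "\<And>s. t0 < s \<Longrightarrow> s \<le> T \<Longrightarrow> f s = g s"
  shows "L2_step_approx t0 T g"
proof -
  have "(\<integral>\<^sup>+s\<in>{t0<..T}. ennreal ((f s - step_fun L s)\<^sup>2) \<partial>lborel)
     = (\<integral>\<^sup>+s\<in>{t0<..T}. ennreal ((g s - step_fun L s)\<^sup>2) \<partial>lborel)" for L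
    using assms(2) by (intro nn_integral_cong) (auto simp: indicator_def)
  with assms(1) show ?thesis unfolding L2_step_approx_def by simp
qed

text \<open>Dynkin's argument from half-open intervals. A complement needs to be correct only on
  (t0, T], and the tail of a disjoint union has small measure there because the interval is
  finite.\<close>

lemma L2_step_approx_indicator:
  assumes "A \<in> sets borel"
  shows "L2_step_approx t0 T (indicator A)"
proof -
  let ?G = "range (\<lambda>(a, b). {a<..b::real})"
  have sets: "sets borel = sigma_sets UNIV ?G"
    by (simp add: borel_sigma_sets_Ioc)
  have "Int_stable ?G"
    by (auto simp: Int_stable_def image_iff)
  moreover have "?G \<subseteq> Pow UNIV" by simp
  moreover have "A \<in> sigma_sets UNIV ?G" using assms unfolding sets .
  ultimately show ?thesis
  proof (induction rule: sigma_sets_induct_disjoint)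
    case (basic A)
    then show ?case using L2_step_approx_Ioc by auto
  next
    case empty
    show ?case using L2_step_approx_sum[of "{}" "\<lambda>_ _. 0" t0 T] by (simp add: indicator_def)
  next
    case (compl A)
    have [measurable]: "A \<in> sets borel" using compl(1) unfolding sets .
    have "L2_step_approx t0 T (\<lambda>s. indicator {t0<..T} s + (- 1) * indicator A s)"
      by (intro L2_step_approx_add L2_step_approx_scale L2_step_approx_Ioc compl) auto
    then show ?case
      by (rule L2_step_approx_cong) (auto simp: indicator_def)
  next
    case (union A)
    have [measurable]: "A i \<in> sets borel" for i using union(2) unfolding sets by auto
    show ?case
    proof (rule L2_step_approx_limit)
      fix \<epsilon> :: real assume \<epsilon>: "\<epsilon> > 0"
      define B where "B n = {t0<..T} \<inter> ((\<Union>i. A i) - (\<Union>i<n. A i))" for n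
      have "(\<lambda>n. emeasure lborel (B n)) \<longlonglongrightarrow> emeasure lborel (\<Inter>n. B n)"
      proof (rule Lim_emeasure_decseq)
        show "decseq B" unfolding B_def decseq_def by fastforce
        show "range B \<subseteq> sets lborel" unfolding B_def by auto
        have "emeasure lborel (B n) \<le> emeasure lborel {t0<..T}" for n
          by (intro emeasure_mono) (auto simp: B_def)
        moreover have "emeasure lborel {t0<..T} < \<infinity>" by (cases "t0 \<le> T") auto
        ultimately show "emeasure lborel (B n) \<noteq> \<infinity>" for n
          by (metis leD)
      qed
      moreover have "(\<Inter>n. B n) = {}" unfolding B_def by auto
      ultimately have "(\<lambda>n. emeasure lborel (B n)) \<longlonglongrightarrow> 0" by simp
      then have "eventually (\<lambda>n. emeasure lborel (B n) < ennreal \<epsilon>) sequentially"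
        using \<epsilon> by (intro order_tendstoD) auto
      then obtain n where n: "emeasure lborel (B n) < ennreal \<epsilon>" by (auto simp: eventually_sequentially)
      let ?g = "\<lambda>s. \<Sum>i<n. indicator (A i) s :: real"
      have ind: "?g s = indicator (\<Union>i<n. A i) s" for s
        using union(1) by (subst indicator_UN_disjoint) (auto simp: disjoint_family_on_def)
      have "(\<integral>\<^sup>+s\<in>{t0<..T}. ennreal ((indicator (\<Union>i. A i) s - ?g s)\<^sup>2) \<partial>lborel) = (\<integral>\<^sup>+s. indicator (B n) s \<partial>lborel)"
        unfolding ind by (intro nn_integral_cong) (auto simp: indicator_def B_def)
      also have "\<dots> = emeasure lborel (B n)" by (simp add: B_def)
      finally have "(\<integral>\<^sup>+s\<in>{t0<..T}. ennreal ((indicator (\<Union>i. A i) s - ?g s)\<^sup>2) \<partial>lborel) < ennreal \<epsilon>"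
        using n by simp
      moreover have "L2_step_approx t0 T ?g"
        using union by (intro L2_step_approx_sum) auto
      moreover have "?g \<in> borel_measurable borel" by measurable
      ultimately show "\<exists>g. g \<in> borel_measurable borel \<and> L2_step_approx t0 T g \<and>
         (\<integral>\<^sup>+s\<in>{t0<..T}. ennreal ((indicator (\<Union>i. A i) s - g s)\<^sup>2) \<partial>lborel) < ennreal \<epsilon>"
        by blast
    qed measurable
  qed
qed

text \<open>Rounding the values down to multiples of \<open>1 / n\<close> leaves finitely many level
  sets. The squared error is at most \<open>1 / n\<close>, and \<open>n\<close> exceeds
  \<open>d / \<epsilon>\<close> where \<open>d\<close> bounds the length of the interval.\<close>

lemma L2_step_approx_bounded:
  assumes f[measurable]: "f \<in> borel_measurable borel" and c: "\<And>s. t0 < s \<Longrightarrow> s \<le> T \<Longrightarrow> \<bar>f s\<bar> \<le> c"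
  shows "L2_step_approx t0 T f"
proof (rule L2_step_approx_limit[OF f])
  fix \<epsilon> :: real assume \<epsilon>: "\<epsilon> > 0"
  define d where "d = \<bar>T - t0\<bar> + 1"
  have d: "d > 0" by (simp add: d_def)
  obtain n :: nat where n': "d / \<epsilon> < real n"
    using reals_Archimedean2 by blast
  have "0 < d / \<epsilon>" using d \<epsilon> by simp
  with n' have "0 < real n" by linarith
  with n' have n: "n > 0" "d / \<epsilon> < real n" by auto
  \<comment> \<open>Large enough that the rounded value of \<open>real n * f s\<close> falls into
    the summation range for every relevant \<open>s\<close>.\<close>
  define N where "N = \<lceil>real n * \<bar>c\<bar>\<rceil> + 1"
  define g where "g s = (\<Sum>k\<in>{-N..N}. (real_of_int k / real n) * indicator {s. \<lfloor>real n * f s\<rfloor> = k} s)" for s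
  have m: "{s. \<lfloor>real n * f s\<rfloor> = k} \<in> sets borel" for k
  proof -
    have "{s. \<lfloor>real n * f s\<rfloor> = k} = {s \<in> space borel. real_of_int k \<le> real n * f s \<and> real n * f s < real_of_int k + 1}"
      by (auto simp: floor_eq_iff)
    also have "\<dots> \<in> sets borel" by measurable
    finally show ?thesis .
  qed
  have "L2_step_approx t0 T g"
    unfolding g_def using m by (intro L2_step_approx_sum L2_step_approx_scale L2_step_approx_indicator) auto
  moreover have gm[measurable]: "g \<in> borel_measurable borel"
    unfolding g_def using m by measurable
  moreover have "(\<integral>\<^sup>+s\<in>{t0<..T}. ennreal ((f s - g s)\<^sup>2) \<partial>lborel) < ennreal \<epsilon>"
  proof -
    have close: "(f s - g s)\<^sup>2 \<le> 1 / real n" if s: "t0 < s" "s \<le> T" for s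
    proof -
      let ?k = "\<lfloor>real n * f s\<rfloor>"
      have "\<bar>real n * f s\<bar> \<le> real n * \<bar>c\<bar>"
        using c[OF s] by (simp add: abs_mult mult_left_mono)
      then have "?k \<in> {-N..N}" unfolding N_def by (simp add: le_floor_iff floor_le_iff) linarith
      then have "g s = real_of_int ?k / real n"
      proof -
        assume k: "?k \<in> {-N..N}"
        have "g s = (\<Sum>k\<in>{-N..N}. if k = ?k then real_of_int k / real n else 0)"
          unfolding g_def by (intro sum.cong refl) (auto simp: indicator_def)
        also have "\<dots> = real_of_int ?k / real n"
          using k by (subst sum.delta) auto
        finally show ?thesis .
      qed
      then have "f s - g s = (real n * f s - real_of_int ?k) / real n"
        using n(1) by (simp add: field_simps)
      moreover have "0 \<le> real n * f s - real_of_int ?k" "real n * f s - real_of_int ?k \<le> 1" by linarith+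
      ultimately have *: "0 \<le> f s - g s" "f s - g s \<le> 1 / real n"
        using n(1) by (auto simp: divide_right_mono)
      have "(f s - g s)\<^sup>2 \<le> (1 / real n) * 1"
      proof -
        have "1 / real n \<le> 1" using n(1) by simp
        with * have "f s - g s \<le> 1" by linarith
        then show ?thesis unfolding power2_eq_square using * by (intro mult_mono) auto
      qed
      then show ?thesis by simp
    qed
    have "(\<integral>\<^sup>+s\<in>{t0<..T}. ennreal ((f s - g s)\<^sup>2) \<partial>lborel) \<le> (\<integral>\<^sup>+s\<in>{t0<..T}. ennreal (1 / real n) \<partial>lborel)"
      using close by (intro nn_integral_mono) (auto simp: indicator_def intro!: ennreal_leI)
    also have "\<dots> = ennreal (1 / real n) * emeasure lborel {t0<..T}"
      by (simp add: nn_integral_cmult)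
    also have "\<dots> \<le> ennreal (1 / real n) * ennreal d"
      by (intro mult_left_mono, cases "t0 \<le> T") (auto simp: d_def intro!: ennreal_leI)
    also have "\<dots> = ennreal (d / real n)"
      using d by (simp flip: ennreal_mult)
    also have "\<dots> < ennreal \<epsilon>"
      using n \<epsilon> d by (subst ennreal_less_iff) (auto simp: field_simps)
    finally show ?thesis .
  qed
  ultimately show "\<exists>g. g \<in> borel_measurable borel \<and> L2_step_approx t0 T g \<and>
       (\<integral>\<^sup>+s\<in>{t0<..T}. ennreal ((f s - g s)\<^sup>2) \<partial>lborel) < ennreal \<epsilon>" by blast
qed

section \<open>Matrix entries of Hilbert-Schmidt operators\<close>

lemma hs_sq_pairs:
  "hs_sq A = (\<integral>\<^sup>+x. ennreal ((blinfun_apply A (fst x) \<bullet> snd x)\<^sup>2) \<partial>count_space (the_basis \<times> the_basis))"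
  for A :: "'h::{real_inner,banach,second_countable_topology} \<Rightarrow>\<^sub>L 'k::{real_inner,banach,second_countable_topology}"
proof -
  interpret S: sigma_finite_measure "count_space (the_basis :: 'k set)"
    by (rule sigma_finite_measure_count_space_countable) (rule countable_the_basis)
  have "hs_sq A = (\<integral>\<^sup>+e. \<integral>\<^sup>+f. ennreal ((blinfun_apply A e \<bullet> f)\<^sup>2) \<partial>count_space the_basis \<partial>count_space the_basis)"
    unfolding hs_sq_def by (simp add: parseval[OF the_basis])
  also have "\<dots> = (\<integral>\<^sup>+x. ennreal ((blinfun_apply A (fst x) \<bullet> snd x)\<^sup>2) \<partial>(count_space the_basis \<Otimes>\<^sub>M count_space the_basis))"
    by (subst S.nn_integral_fst[symmetric]) (auto simp: pair_measure_countable countable_the_basis)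
  finally show ?thesis by (simp add: pair_measure_countable countable_the_basis)
qed

text \<open>Some finite part exceeds the total minus \<open>\<epsilon> / 2\<close>. The tail is
  estimated by adding it back to that part, since subtraction in \<open>ennreal\<close> is
  truncated.\<close>

lemma nn_integral_count_space_tail:
  fixes f :: "'a \<Rightarrow> ennreal"
  assumes X: "countable X" and fin: "(\<integral>\<^sup>+x. f x \<partial>count_space X) < \<infinity>" and \<epsilon>: "\<epsilon> > 0"
  obtains P where "finite P" "P \<subseteq> X" "(\<integral>\<^sup>+x. f x * indicator (- P) x \<partial>count_space X) < ennreal \<epsilon>"
proof -
  obtain r where r: "(\<integral>\<^sup>+x. f x \<partial>count_space X) = ennreal r" "0 \<le> r"
    using fin by (cases "\<integral>\<^sup>+x. f x \<partial>count_space X") auto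
  have "\<exists>P. finite P \<and> P \<subseteq> X \<and> (\<integral>\<^sup>+x. f x * indicator (- P) x \<partial>count_space X) < ennreal \<epsilon>"
  \<comment> \<open>For small \<open>r\<close> the empty set works; otherwise
    \<open>r - \<epsilon> / 2\<close> is positive, so its embedding into \<open>ennreal\<close> is
    not cut off at 0.\<close>
  proof (cases "r < \<epsilon>")
    case True
    then show ?thesis using r by (intro exI[of _ "{}"]) (simp add: ennreal_less_iff)
  next
    case False
    then have "\<not> ennreal r \<le> ennreal (r - \<epsilon> / 2)" using \<epsilon> by simp
    then obtain P where P: "finite P" "P \<subseteq> X" "\<not> (\<Sum>x\<in>P. f x) \<le> ennreal (r - \<epsilon> / 2)"
      using nn_integral_count_space_finite_le[OF _ X, of f "ennreal (r - \<epsilon> / 2)"] unfolding r(1) by blast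
    have "ennreal r = (\<integral>\<^sup>+x. f x * indicator P x + f x * indicator (- P) x \<partial>count_space X)"
      unfolding r(1)[symmetric] by (intro nn_integral_cong) (auto simp: indicator_def)
    also have "\<dots> = (\<integral>\<^sup>+x. f x * indicator P x \<partial>count_space X) + (\<integral>\<^sup>+x. f x * indicator (- P) x \<partial>count_space X)"
      by (rule nn_integral_add) auto
    also have "(\<integral>\<^sup>+x. f x * indicator P x \<partial>count_space X) = (\<Sum>x\<in>P. f x)"
      using P by (simp add: nn_integral_restrict_space[symmetric] restrict_count_space Int_absorb1 Int_absorb2
          nn_integral_count_space_finite)
    finally have eq: "ennreal r = (\<Sum>x\<in>P. f x) + (\<integral>\<^sup>+x. f x * indicator (- P) x \<partial>count_space X)" .
    obtain a where a: "(\<Sum>x\<in>P. f x) = ennreal a" "0 \<le> a"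
      using eq by (cases "\<Sum>x\<in>P. f x") auto
    obtain b where b: "(\<integral>\<^sup>+x. f x * indicator (- P) x \<partial>count_space X) = ennreal b" "0 \<le> b"
      using eq by (cases "\<integral>\<^sup>+x. f x * indicator (- P) x \<partial>count_space X") auto
    have "r = a + b"
      using eq a b r by (simp flip: ennreal_plus)
    moreover have "a > r - \<epsilon> / 2"
      using P(3) a False \<epsilon> by simp
    ultimately have "b < \<epsilon>" using \<epsilon> by simp
    with P b show ?thesis by (auto simp: ennreal_less_iff)
  qed
  then show thesis using that by blast
qed


lemma nn_integral_Icc_Ioc: "(\<integral>\<^sup>+s\<in>{a..b}. f s \<partial>lborel) = (\<integral>\<^sup>+s\<in>{a<..b}. f s \<partial>lborel)" for a b :: real
proof (rule nn_integral_cong_AE)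
  have "AE s in lborel. s \<noteq> a" by (rule AE_lborel_singleton)
  then show "AE s in lborel. f s * indicator {a..b} s = f s * indicator {a<..b} s"
    by eventually_elim (auto simp: indicator_def)
qed

lemma nn_integral_count_space_indicator_finite:
  assumes "finite P" "P \<subseteq> X"
  shows "(\<integral>\<^sup>+x. f x * indicator P x \<partial>count_space X) = (\<Sum>x\<in>P. f x)"
  using assms by (simp add: nn_integral_restrict_space[symmetric] restrict_count_space Int_absorb1 Int_absorb2
      nn_integral_count_space_finite)

lemma sum_list_concat_map: "(\<Sum>y\<leftarrow>concat (map G xs). F y) = (\<Sum>x\<leftarrow>xs. \<Sum>y\<leftarrow>G x. F y)"
  by (induction xs) auto

lemma inner_power2_le_hs_sq:
  fixes A :: "'h::{real_inner,banach,second_countable_topology} \<Rightarrow>\<^sub>L 'k::{real_inner,banach,second_countable_topology}"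
  assumes "e \<in> the_basis" "f \<in> the_basis"
  shows "ennreal ((blinfun_apply A e \<bullet> f)\<^sup>2) \<le> hs_sq A"
  using nn_integral_count_space_ge_sum[of "{(e, f)}" "the_basis \<times> the_basis"
      "\<lambda>x. ennreal ((blinfun_apply A (fst x) \<bullet> snd x)\<^sup>2)"] assms
  unfolding hs_sq_pairs by simp

definition step_process ::
  "(real \<times> real \<times> real) list \<Rightarrow> 'h \<Rightarrow> 'k \<Rightarrow> ('w, 'h, 'k) elementary" where
  "step_process L e f = map (\<lambda>(a, b, c). (a, b, \<lambda>_. c, e, f)) L"

lemma step_process_value:
  fixes f :: "'k::real_inner"
  shows
  "(\<Sum>(a, b, \<xi>, h, k)\<leftarrow>step_process L e f. (indicator {a<..b} s * \<xi> \<omega> * (v \<bullet> h)) *\<^sub>R k)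
    = (step_fun L s * (v \<bullet> e)) *\<^sub>R f"
  unfolding step_process_def by (induction L) (auto simp: algebra_simps)

text \<open>The rank-one operators built from basis vectors are matrix units, so each matrix entry
  of the assembled process is its own step function, and the approximation can be carried out entry
  by entry.\<close>

lemma elementary_value_steps:
  fixes L :: "'h::{real_inner,banach,second_countable_topology} \<times> 'k::{real_inner,banach,second_countable_topology} \<Rightarrow> _"
  assumes xs: "distinct xs" "set xs \<subseteq> the_basis \<times> the_basis" and x: "x \<in> the_basis \<times> the_basis"
  shows "blinfun_apply (elementary_value (concat (map (\<lambda>x. step_process (L x) (fst x) (snd x)) xs)) s \<omega>) (fst x) \<bullet> snd x
    = (if x \<in> set xs then step_fun (L x) s else 0)"
proof -
  have "blinfun_apply (elementary_value (concat (map (\<lambda>x. step_process (L x) (fst x) (snd x)) xs)) s \<omega>) (fst x) \<bullet> snd x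
     = (\<Sum>y\<leftarrow>xs. step_fun (L y) s * (fst x \<bullet> fst y) * (snd y \<bullet> snd x))"
    unfolding elementary_value_apply sum_list_concat_map step_process_value inner_sum_list_left by simp
  also have "\<dots> = (\<Sum>y\<in>set xs. step_fun (L y) s * (fst x \<bullet> fst y) * (snd y \<bullet> snd x))"
    using xs(1) by (simp add: sum_list_distinct_conv_sum_set)
  also have "\<dots> = (\<Sum>y\<in>set xs. if y = x then step_fun (L x) s else 0)"
  proof (intro sum.cong refl)
    fix y assume "y \<in> set xs"
    then have "fst y \<in> the_basis" "snd y \<in> the_basis" "fst x \<in> the_basis" "snd x \<in> the_basis"
      using xs x by auto
    then show "step_fun (L y) s * (fst x \<bullet> fst y) * (snd y \<bullet> snd x) = (if y = x then step_fun (L x) s else 0)"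
    proof (cases "y = x")
      case True
      then show ?thesis using \<open>fst x \<in> _\<close> \<open>snd x \<in> _\<close> by (simp add: orthonormal_basis_inner[OF the_basis])
    next
      case False
      then have "fst y \<noteq> fst x \<or> snd y \<noteq> snd x" by (auto simp: prod_eq_iff)
      then show ?thesis using False \<open>fst x \<in> _\<close> \<open>snd x \<in> _\<close> \<open>fst y \<in> _\<close> \<open>snd y \<in> _\<close>
        by (auto simp: orthonormal_basis_inner[OF the_basis])
    qed
  qed
  finally show ?thesis by simp
qed

context bm_setting
begin

text \<open>Half of \<open>\<epsilon>\<close> is spent on discarding all but finitely many matrix
  entries, half on approximating the remaining ones by step functions. The finite set
  \<open>C\<close> of output directions is recorded because \<open>vector_sup_moment\<close> needs
  it.\<close>

lemma elementary_approx:
  fixes R :: "real \<Rightarrow> ('h \<Rightarrow>\<^sub>L 'k::{real_inner,banach,second_countable_topology})"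
  assumes R: "\<And>h. (\<lambda>s. blinfun_apply (R s) h) \<in> borel_measurable (restrict_space borel {t0..T})"
    and c: "\<And>s. t0 \<le> s \<Longrightarrow> s \<le> T \<Longrightarrow> hs_sq (R s) \<le> ennreal c" and \<epsilon>: "\<epsilon> > 0"
  obtains D :: "('w, 'h, 'k) elementary" and C where "det_process D" "finite C" "C \<subseteq> the_basis"
    "\<And>a b \<xi> h k. (a, b, \<xi>, h, k) \<in> set D \<Longrightarrow> k \<in> C"
    "\<And>\<omega>. (\<integral>\<^sup>+s\<in>{t0..T}. hs_sq (R s - elementary_value D s \<omega>) \<partial>lborel) < ennreal \<epsilon>"
proof -
  define X :: "('h \<times> 'k) set" where "X = the_basis \<times> the_basis"
  have X: "countable X" unfolding X_def by (intro countable_SIGMA countable_the_basis)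
  define \<phi> where "\<phi> x s = indicator {t0..T} s * (blinfun_apply (R s) (fst x) \<bullet> snd x)" for x s
  have \<phi>m[measurable]: "\<phi> x \<in> borel_measurable borel" for x
  proof -
    have [measurable]: "(\<lambda>s. blinfun_apply (R s) (fst x)) \<in> borel_measurable (restrict_space borel {t0..T})"
      by (rule R)
    have "(\<lambda>s. blinfun_apply (R s) (fst x) \<bullet> snd x) \<in> borel_measurable (restrict_space borel {t0..T})"
      by measurable
    then show ?thesis
      unfolding \<phi>_def by (subst (asm) borel_measurable_restrict_space_iff) (auto simp: mult.commute)
  qed
  define e where "e x = (\<integral>\<^sup>+s\<in>{t0<..T}. ennreal ((\<phi> x s)\<^sup>2) \<partial>lborel)" for x
  have "(\<integral>\<^sup>+x. e x \<partial>count_space X) = (\<integral>\<^sup>+s. \<integral>\<^sup>+x. ennreal ((\<phi> x s)\<^sup>2) * indicator {t0<..T} s \<partial>count_space X \<partial>lborel)"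
    unfolding e_def by (rule nn_integral_count_space_nn_integral[symmetric, OF X]) measurable
  also have "\<dots> \<le> (\<integral>\<^sup>+s. ennreal c * indicator {t0<..T} s \<partial>lborel)"
  proof (intro nn_integral_mono)
    fix s :: real
    have "(\<integral>\<^sup>+x. ennreal ((\<phi> x s)\<^sup>2) \<partial>count_space X) \<le> ennreal c" if "t0 < s" "s \<le> T"
      using c[of s] that unfolding \<phi>_def X_def by (simp add: hs_sq_pairs)
    then show "(\<integral>\<^sup>+x. ennreal ((\<phi> x s)\<^sup>2) * indicator {t0<..T} s \<partial>count_space X) \<le> ennreal c * indicator {t0<..T} s"
      by (auto simp: indicator_def)
  qed
  also have "\<dots> < \<infinity>"
    by (cases "t0 \<le> T") (auto simp: nn_integral_cmult ennreal_mult_less_top)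
  finally have fin: "(\<integral>\<^sup>+x. e x \<partial>count_space X) < \<infinity>" .
  obtain P where P: "finite P" "P \<subseteq> X" "(\<integral>\<^sup>+x. e x * indicator (- P) x \<partial>count_space X) < ennreal (\<epsilon> / 2)"
    using nn_integral_count_space_tail[OF X fin, of "\<epsilon> / 2"] \<epsilon> by auto
  \<comment> \<open>An equal share for each retained entry; the added 1 covers the case that none is
    retained.\<close>
  define \<eta> where "\<eta> = \<epsilon> / 2 / (card P + 1)"
  have \<eta>: "\<eta> > 0" unfolding \<eta>_def using \<epsilon> by (intro divide_pos_pos) auto
  have "\<exists>L. (\<forall>(a, b, c)\<in>set L. t0 \<le> a \<and> a \<le> b) \<and>
     (\<integral>\<^sup>+s\<in>{t0<..T}. ennreal ((\<phi> x s - step_fun L s)\<^sup>2) \<partial>lborel) < ennreal \<eta>" if "x \<in> P" for x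
  proof -
    have "L2_step_approx t0 T (\<phi> x)"
    proof (rule L2_step_approx_bounded[OF \<phi>m])
      fix s assume s: "t0 < s" "s \<le> T"
      have "ennreal ((\<phi> x s)\<^sup>2) \<le> hs_sq (R s)"
        using inner_power2_le_hs_sq[of "fst x" "snd x" "R s"] that P(2) s by (auto simp: \<phi>_def X_def)
      also have "\<dots> \<le> ennreal c" by (rule c) (use s in auto)
      also have "\<dots> \<le> ennreal (max c 0)" by (intro ennreal_leI) simp
      finally have "(\<phi> x s)\<^sup>2 \<le> max c 0"
        by (rule ennreal_le_iff[THEN iffD1, rotated]) simp
      then show "\<bar>\<phi> x s\<bar> \<le> sqrt (max c 0)" by (simp add: real_le_rsqrt)
    qed
    then show ?thesis using \<eta> unfolding L2_step_approx_def by blast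
  qed
  then have "\<forall>x\<in>P. \<exists>L. (\<forall>(a, b, c)\<in>set L. t0 \<le> a \<and> a \<le> b) \<and>
     (\<integral>\<^sup>+s\<in>{t0<..T}. ennreal ((\<phi> x s - step_fun L s)\<^sup>2) \<partial>lborel) < ennreal \<eta>" by blast
  from bchoice[OF this] obtain L where
    L': "\<forall>x\<in>P. (\<forall>(a, b, c)\<in>set (L x). t0 \<le> a \<and> a \<le> b) \<and>
      (\<integral>\<^sup>+s\<in>{t0<..T}. ennreal ((\<phi> x s - step_fun (L x) s)\<^sup>2) \<partial>lborel) < ennreal \<eta>" ..
  have L: "\<And>x. x \<in> P \<Longrightarrow> \<forall>(a, b, c)\<in>set (L x). t0 \<le> a \<and> a \<le> b"
    "\<And>x. x \<in> P \<Longrightarrow> (\<integral>\<^sup>+s\<in>{t0<..T}. ennreal ((\<phi> x s - step_fun (L x) s)\<^sup>2) \<partial>lborel) < ennreal \<eta>"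
    using L' by blast+
  obtain xs where xs: "set xs = P" "distinct xs"
    using finite_distinct_list[OF P(1)] by blast
  define D :: "('w, 'h, 'k) elementary" where "D = concat (map (\<lambda>x. step_process (L x) (fst x) (snd x)) xs)"
  have setD: "\<exists>x\<in>P. \<exists>c. (a, b, c) \<in> set (L x) \<and> \<xi> = (\<lambda>_. c) \<and> k = snd x" if mem: "(a, b, \<xi>, h, k) \<in> set D" for a b \<xi> h k
  proof -
    obtain x where x: "x \<in> P" "(a, b, \<xi>, h, k) \<in> set (step_process (L x) (fst x) (snd x))"
      using mem xs(1) unfolding D_def by auto
    then obtain c where "(a, b, c) \<in> set (L x)" "\<xi> = (\<lambda>_. c)" "k = snd x"
      unfolding step_process_def by auto
    with x(1) show ?thesis by blast
  qed
  show thesis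
  proof (rule that[of D "snd ` P"])
    show "det_process D"
      unfolding det_process_def
    proof (clarify, goal_cases)
      case (1 a b \<xi> h k)
      then show ?case using setD[of a b \<xi> h k] L(1) by fastforce
    qed
    show "finite (snd ` P)" using P by simp
    show "snd ` P \<subseteq> the_basis" using P(2) by (auto simp: X_def)
    show "k \<in> snd ` P" if "(a, b, \<xi>, h, k) \<in> set D" for a b \<xi> h k
      using setD[OF that] by auto
    fix \<omega>
    define d where "d x s = (if x \<in> P then \<phi> x s - step_fun (L x) s else \<phi> x s)" for x s
    have dm[measurable]: "d x \<in> borel_measurable borel" for x
      unfolding d_def by (cases "x \<in> P") simp_all
    have hs: "hs_sq (R s - elementary_value D s \<omega>) = (\<integral>\<^sup>+x. ennreal ((d x s)\<^sup>2) \<partial>count_space X)"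
      if s: "t0 < s" "s \<le> T" for s
      unfolding hs_sq_pairs X_def[symmetric]
    proof (intro nn_integral_cong)
      fix x assume "x \<in> space (count_space X)"
      then have x: "x \<in> the_basis \<times> the_basis" by (simp add: X_def)
      have "set xs \<subseteq> the_basis \<times> the_basis" using xs P by (auto simp: X_def)
      from elementary_value_steps[OF xs(2) this x, of L s \<omega>]
      show "ennreal ((blinfun_apply (R s - elementary_value D s \<omega>) (fst x) \<bullet> snd x)\<^sup>2) = ennreal ((d x s)\<^sup>2)"
        using s by (simp add: D_def[symmetric] blinfun.diff_left inner_diff_left d_def \<phi>_def xs(1))
    qed
    define dd where "dd x = (\<integral>\<^sup>+s\<in>{t0<..T}. ennreal ((d x s)\<^sup>2) \<partial>lborel)" for x
    have "(\<integral>\<^sup>+s\<in>{t0..T}. hs_sq (R s - elementary_value D s \<omega>) \<partial>lborel)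
       = (\<integral>\<^sup>+s. \<integral>\<^sup>+x. ennreal ((d x s)\<^sup>2) * indicator {t0<..T} s \<partial>count_space X \<partial>lborel)"
      unfolding nn_integral_Icc_Ioc by (intro nn_integral_cong) (auto simp: indicator_def hs)
    also have "\<dots> = (\<integral>\<^sup>+x. dd x \<partial>count_space X)"
      unfolding dd_def by (rule nn_integral_count_space_nn_integral[OF X]) measurable
    also have "\<dots> = (\<integral>\<^sup>+x. dd x * indicator P x + e x * indicator (- P) x \<partial>count_space X)"
      by (intro nn_integral_cong) (auto simp: indicator_def dd_def e_def d_def)
    also have "\<dots> = (\<integral>\<^sup>+x. dd x * indicator P x \<partial>count_space X) + (\<integral>\<^sup>+x. e x * indicator (- P) x \<partial>count_space X)"
      by (rule nn_integral_add) auto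
    also have "(\<integral>\<^sup>+x. dd x * indicator P x \<partial>count_space X) = (\<Sum>x\<in>P. dd x)"
      by (rule nn_integral_count_space_indicator_finite[OF P(1,2)])
    also have "(\<Sum>x\<in>P. dd x) \<le> (\<Sum>x\<in>P. ennreal \<eta>)"
      using L(2) by (intro sum_mono) (auto simp: dd_def d_def less_imp_le)
    also have "\<dots> = ennreal (card P * \<eta>)"
      using \<eta> by (simp add: ennreal_mult ennreal_of_nat_eq_real_of_nat)
    also have "\<dots> \<le> ennreal (\<epsilon> / 2)"
      unfolding \<eta>_def using \<epsilon> by (intro ennreal_leI) (simp add: field_simps)
    also have "ennreal (\<epsilon> / 2) + (\<integral>\<^sup>+x. e x * indicator (- P) x \<partial>count_space X) < ennreal (\<epsilon> / 2) + ennreal (\<epsilon> / 2)"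
      using P(3) by (intro ennreal_add_left_cancel_less[THEN iffD2]) auto
    also have "\<dots> = ennreal \<epsilon>" using \<epsilon> by (simp flip: ennreal_plus)
    finally show "(\<integral>\<^sup>+s\<in>{t0..T}. hs_sq (R s - elementary_value D s \<omega>) \<partial>lborel) < ennreal \<epsilon>"
      by (simp add: add_right_mono)
  qed
qed

end

section \<open>The stochastic integral of a deterministic integrand\<close>

lemma hs_sq_elementary_bounded:
  fixes E :: "('w, 'h::{real_inner,banach,second_countable_topology}, 'k::{real_inner,banach,second_countable_topology}) elementary"
  shows "\<exists>c\<ge>0. \<forall>s. hs_sq (elementary_value E s \<omega>) \<le> ennreal c"
proof (induction E)
  case Nil
  have "hs_sq (0 :: 'h \<Rightarrow>\<^sub>L 'k) = 0" by (simp add: hs_sq_def)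
  then show ?case by (auto simp: elementary_value_def)
next
  case (Cons x E)
  obtain a b \<xi> h k where x: "x = (a, b, \<xi>, h, k)" by (cases x) auto
  obtain c where c: "c \<ge> 0" "\<And>s. hs_sq (elementary_value E s \<omega>) \<le> ennreal c" using Cons by auto
  define d where "d = (\<xi> \<omega>)\<^sup>2 * (norm k)\<^sup>2 * (norm h)\<^sup>2"
  have one: "hs_sq (elementary_value [x] s \<omega>) \<le> ennreal d" for s
  proof -
    have "hs_sq (elementary_value [x] s \<omega>)
        \<le> (\<integral>\<^sup>+e. ennreal ((\<xi> \<omega>)\<^sup>2 * (norm k)\<^sup>2) * ennreal ((h \<bullet> e)\<^sup>2) \<partial>count_space the_basis)"
      unfolding hs_sq_def
    proof (intro nn_integral_mono)
      fix e
      have "(norm (blinfun_apply (elementary_value [x] s \<omega>) e))\<^sup>2 \<le> (\<xi> \<omega>)\<^sup>2 * (norm k)\<^sup>2 * (h \<bullet> e)\<^sup>2"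
        by (auto simp: elementary_value_apply x indicator_def power_mult_distrib inner_commute)
      then show "ennreal ((norm (blinfun_apply (elementary_value [x] s \<omega>) e))\<^sup>2)
          \<le> ennreal ((\<xi> \<omega>)\<^sup>2 * (norm k)\<^sup>2) * ennreal ((h \<bullet> e)\<^sup>2)"
        by (subst ennreal_mult[symmetric]) (auto intro: ennreal_leI)
    qed
    also have "\<dots> = ennreal ((\<xi> \<omega>)\<^sup>2 * (norm k)\<^sup>2) * ennreal ((norm h)\<^sup>2)"
      by (simp add: nn_integral_cmult parseval[OF the_basis])
    also have "\<dots> = ennreal d"
      unfolding d_def by (rule ennreal_mult[symmetric]) auto
    finally show ?thesis .
  qed
  have "hs_sq (elementary_value (x # E) s \<omega>) \<le> ennreal (2 * d + 2 * c)" for s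
  proof -
    have "hs_sq (elementary_value (x # E) s \<omega>) \<le> 2 * hs_sq (elementary_value [x] s \<omega>) + 2 * hs_sq (elementary_value E s \<omega>)"
      using hs_sq_add_le[of "elementary_value [x] s \<omega>" "elementary_value E s \<omega>"]
        elementary_value_append[of "[x]" E s \<omega>] by simp
    also have "\<dots> \<le> 2 * ennreal d + 2 * ennreal c"
      by (intro add_mono mult_left_mono one c) auto
    also have "\<dots> = ennreal (2 * d + 2 * c)"
      using c ennreal_mult[of 2 d] ennreal_mult[of 2 c] ennreal_plus[of "2 * d" "2 * c"] by (simp add: d_def)
    finally show ?thesis .
  qed
  moreover have "2 * d + 2 * c \<ge> 0" using c by (simp add: d_def)
  ultimately show ?case by blast
qed

lemma hs_sq_diff_le:
  assumes "hs_sq A \<le> ennreal a" "hs_sq B \<le> ennreal b" "0 \<le> a" "0 \<le> b"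
  shows "hs_sq (A - B) \<le> ennreal (2 * a + 2 * b)"
proof -
  have "hs_sq (A - B) \<le> 2 * hs_sq A + 2 * hs_sq B"
    using hs_sq_add_le[of A "- B"] by (simp add: hs_sq_uminus)
  also have "\<dots> \<le> 2 * ennreal a + 2 * ennreal b"
    by (intro add_mono mult_left_mono assms) auto
  also have "\<dots> = ennreal (2 * a + 2 * b)"
    using assms ennreal_mult[of 2 a] ennreal_mult[of 2 b] ennreal_plus[of "2 * a" "2 * b"] by simp
  finally show ?thesis .
qed

lemma continuous_on_atLeast:
  assumes "\<And>n::nat. continuous_on {t0..t0 + real n} f"
  shows "continuous_on {t0::real..} f"
  unfolding continuous_on_eq_continuous_within
proof
  fix x assume "x \<in> {t0..}"
  obtain n :: nat where n: "x - t0 < real n" using reals_Archimedean2 by blast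
  have "continuous (at x within {t0..t0 + real n}) f"
    using assms[of n] \<open>x \<in> {t0..}\<close> n by (auto simp: continuous_on_eq_continuous_within)
  moreover have "at x within {t0..} = at x within {t0..t0 + real n}"
    by (rule at_within_nhd[of _ "{..<t0 + real n}"]) (use n in auto)
  ultimately show "continuous (at x within {t0..}) f" by (simp add: continuous_within)
qed

text \<open>The end points are added so that the closure is the whole closed interval even when it
  degenerates to one irrational point.\<close>

definition dense_times :: "real \<Rightarrow> real \<Rightarrow> real set" where
  "dense_times t0 T = insert t0 (insert T (\<rat> \<inter> {t0..T}))"

lemma dense_times:
  assumes "t0 \<le> T"
  shows "countable (dense_times t0 T)" "dense_times t0 T \<noteq> {}" "dense_times t0 T \<subseteq> {t0..T}"
    "closure (dense_times t0 T) = {t0..T}"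
proof -
  show "countable (dense_times t0 T)" "dense_times t0 T \<noteq> {}" and sub: "dense_times t0 T \<subseteq> {t0..T}"
    using assms by (auto simp: dense_times_def countable_rat)
  show "closure (dense_times t0 T) = {t0..T}"
  proof
    show "closure (dense_times t0 T) \<subseteq> {t0..T}"
      using sub by (intro closure_minimal) auto
    show "{t0..T} \<subseteq> closure (dense_times t0 T)"
    proof
      fix t assume t: "t \<in> {t0..T}"
      show "t \<in> closure (dense_times t0 T)"
      proof (cases "t = T")
        case True
        then show ?thesis using closure_subset[of "dense_times t0 T"] by (auto simp: dense_times_def)
      next
        case False
        show ?thesis
          unfolding closure_approachable
        proof (intro allI impI)
          fix e :: real assume "e > 0"
          then obtain q where q: "q \<in> \<rat>" "t < q" "q < min T (t + e)"
            using Rats_dense_in_real[of t "min T (t + e)"] t False by auto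
          then show "\<exists>y\<in>dense_times t0 T. dist y t < e"
            using t by (intro bexI[of _ q]) (auto simp: dense_times_def dist_real_def)
        qed
      qed
    qed
  qed
qed

lemma (in prob_space) vanishes_in_probability_AE:
  fixes D :: "nat \<Rightarrow> 'a \<Rightarrow> real"
  assumes [measurable]: "\<And>n. D n \<in> borel_measurable M" and lim: "AE \<omega> in M. (\<lambda>n. D n \<omega>) \<longlonglongrightarrow> 0"
    and nonneg: "\<And>n \<omega>. 0 \<le> D n \<omega>"
  shows "vanishes_in_probability M (\<lambda>n \<omega>. ennreal (D n \<omega>))"
  unfolding vanishes_in_probability_def
proof (intro conjI allI impI)
  show "(\<lambda>\<omega>. ennreal (D n \<omega>)) \<in> borel_measurable M" for n by measurable
  fix \<epsilon> :: real assume \<epsilon>: "\<epsilon> > 0"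
  let ?A = "\<lambda>n. {\<omega> \<in> space M. D n \<omega> > \<epsilon>}"
  have "(\<lambda>n. \<integral>\<omega>. indicator (?A n) \<omega> \<partial>M) \<longlonglongrightarrow> (\<integral>\<omega>. (0::real) \<partial>M)"
  proof (rule integral_dominated_convergence[where w = "\<lambda>_. 1"])
    show "AE \<omega> in M. (\<lambda>n. indicator (?A n) \<omega> :: real) \<longlonglongrightarrow> 0"
      using lim
    proof eventually_elim
      case (elim \<omega>)
      then have "eventually (\<lambda>n. D n \<omega> < \<epsilon>) sequentially" using \<epsilon> by (intro order_tendstoD)
      then have "eventually (\<lambda>n. indicator (?A n) \<omega> = (0::real)) sequentially"
        by eventually_elim (auto simp: indicator_def)
      then show ?case by (rule tendsto_eventually)
    qed
  qed auto
  then show "(\<lambda>n. measure M {\<omega> \<in> space M. ennreal (D n \<omega>) > ennreal \<epsilon>}) \<longlonglongrightarrow> 0"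
    using \<epsilon> by (simp add: ennreal_less_iff)
qed

lemma elementary_integral_continuous:
  fixes E :: "('w, 'h, 'k::{real_inner,second_countable_topology}) elementary"
  assumes W: "\<And>a b \<xi> h k. (a, b, \<xi>, h, k) \<in> set E \<Longrightarrow> continuous_on {t0..} (\<lambda>t. W t h \<omega>)"
    and E: "elementary_process M t0 Fil E"
  shows "continuous_on {t0..} (\<lambda>t. elementary_integral W E t \<omega>)"
  using assms
proof (induction E)
  case Nil
  then show ?case by (simp add: elementary_integral_def)
next
  case (Cons x E)
  obtain a b \<xi> h k where x: "x = (a, b, \<xi>, h, k)" by (cases x) auto
  have ab: "t0 \<le> a" "a \<le> b" using Cons.prems(2) x by (auto simp: elementary_process_def)
  have c: "continuous_on {t0..} (\<lambda>t. W (min c t) h \<omega>)" if "t0 \<le> c" for c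
  proof -
    have "continuous_on {t0..} (\<lambda>t. W t h \<omega>)" by (rule Cons.prems(1)[of a b \<xi> h k]) (simp add: x)
    then show ?thesis
      by (rule continuous_on_compose2) (use that in \<open>auto intro!: continuous_intros\<close>)
  qed
  have "continuous_on {t0..} (\<lambda>t. elementary_integral W E t \<omega>)"
  proof (rule Cons.IH)
    show "continuous_on {t0..} (\<lambda>t. W t h \<omega>)" if "(a, b, \<xi>, h, k) \<in> set E" for a b \<xi> h k
      by (rule Cons.prems(1)[of a b \<xi> h k]) (simp add: that)
    show "elementary_process M t0 Fil E" using Cons.prems(2) by (simp add: elementary_process_def)
  qed
  moreover have "elementary_integral W (x # E) t \<omega>
      = (\<xi> \<omega> * (W (min b t) h \<omega> - W (min a t) h \<omega>)) *\<^sub>R k + elementary_integral W E t \<omega>" for t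
    by (simp add: elementary_integral_def x)
  ultimately show ?case
    using c[of a] c[of b] ab by (auto intro!: continuous_intros)
qed

text \<open>The reciprocals of the weights \<open>2 ^ Suc n\<close> sum to 1, so the whole series
  satisfies the bound of its weighted terms without an additional constant.\<close>

lemma weighted_sup_bound:
  fixes u :: "nat \<Rightarrow> 'b::banach"
  assumes le: "\<And>n. (2 ^ Suc n * norm (u n)) ^ j \<le> r" and j: "j > 0"
  shows "norm (u n) \<le> root j r * (1 / 2) ^ Suc n" "summable u" "norm (suminf u) ^ j \<le> r"
proof -
  have r: "0 \<le> r" using le[of 0] by (rule order_trans[rotated]) simp
  have u: "norm (u n) \<le> root j r * (1 / 2) ^ Suc n" for n
  proof -
    have "2 ^ Suc n * norm (u n) = root j ((2 ^ Suc n * norm (u n)) ^ j)"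
      using j by (simp add: real_root_power_cancel)
    also have "\<dots> \<le> root j r" using j le by (intro real_root_le_mono)
    finally show ?thesis by (simp add: field_simps power_divide)
  qed
  show "norm (u n) \<le> root j r * (1 / 2) ^ Suc n" by (rule u)
  have g: "(\<lambda>n. root j r * (1 / 2) ^ Suc n) sums (root j r * 1)"
    by (intro sums_mult) (rule power_half_series)
  then have sm: "summable (\<lambda>n. norm (u n))"
    by (intro summable_comparison_test'[OF sums_summable[OF g]]) (use u in auto)
  then show "summable u" by (rule summable_norm_cancel)
  have "norm (suminf u) \<le> (\<Sum>n. norm (u n))" by (rule summable_norm[OF sm])
  also have "\<dots> \<le> (\<Sum>n. root j r * (1 / 2) ^ Suc n)"
    by (intro suminf_le u sm sums_summable[OF g])
  also have "\<dots> = root j r" using sums_unique[OF g] by simp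
  finally have "norm (suminf u) ^ j \<le> root j r ^ j" by (intro power_mono) auto
  then show "norm (suminf u) ^ j \<le> r" using j r by simp
qed

section \<open>Construction of the integral process\<close>

context bm_setting
begin

text \<open>The process is a series of deterministic elementary integrals \<open>J n\<close>, whose
  supremum over a compact interval has geometrically decaying moments. For each horizon and exponent
  one integrable \<open>Y\<close> dominates all terms even after weighting by
  \<open>2 ^ Suc n\<close>; it yields uniform convergence, hence continuous paths, as well as the
  moment bound.\<close>

lemma ito_integral_version:
  fixes \<Phi> :: "real \<Rightarrow> ('h \<Rightarrow>\<^sub>L 'k::{real_inner,banach,second_countable_topology})"
  assumes \<Phi>m: "\<And>h T. (\<lambda>s. blinfun_apply (\<Phi> s) h) \<in> borel_measurable (restrict_space borel {t0..T})"
    and \<Phi>b: "\<And>T. \<exists>c\<ge>0. \<forall>s\<in>{t0..T}. hs_sq (\<Phi> s) \<le> ennreal c"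
  obtains I :: "real \<Rightarrow> 'w \<Rightarrow> 'k"
  where "\<And>t. t0 \<le> t \<Longrightarrow> I t \<in> borel_measurable (Fil t)"
    "AE \<omega> in M. continuous_on {t0..} (\<lambda>t. I t \<omega>)"
    "\<And>t. t0 \<le> t \<Longrightarrow> has_ito_integral M t0 Fil W (\<lambda>s \<omega>. \<Phi> s) t (I t)"
    "\<And>\<omega>. I t0 \<omega> = 0"
    "\<And>T j. t0 \<le> T \<Longrightarrow> j > 0 \<Longrightarrow> \<exists>Y\<in>borel_measurable M. (\<integral>\<^sup>+\<omega>. Y \<omega> \<partial>M) < \<infinity> \<and>
       (AE \<omega> in M. \<forall>t\<in>{t0..T}. ennreal (norm (I t \<omega>) ^ (2 * j)) \<le> Y \<omega>)"
proof -
  \<comment> \<open>\<open>D\<close> approximates what \<open>E\<close> has left over, so the chosen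
    pieces are increments of a series. The rate 1/64 leaves room for the later weights, and the
    horizon grows with \<open>n\<close> so that one sequence serves all times.\<close>
  define good :: "nat \<Rightarrow> ('w, 'h, 'k) elementary \<Rightarrow> ('w, 'h, 'k) elementary \<Rightarrow> bool" where
    "good n E D \<longleftrightarrow> det_process D \<and> (\<exists>C. finite C \<and> C \<subseteq> the_basis \<and> (\<forall>(a, b, \<xi>, h, k)\<in>set D. k \<in> C)) \<and>
     (\<integral>\<^sup>+s\<in>{t0..t0 + real n}. hs_sq (\<Phi> s - elementary_value E s undefined - elementary_value D s undefined) \<partial>lborel)
        < ennreal ((1 / 64) ^ n)" for n E D
  have ex_good: "\<exists>D. good n E D" for n E
  proof -
    obtain c where c: "c \<ge> 0" "\<And>s. s \<in> {t0..t0 + real n} \<Longrightarrow> hs_sq (\<Phi> s) \<le> ennreal c"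
      using \<Phi>b[of "t0 + real n"] by blast
    obtain d where d: "d \<ge> 0" "\<And>s. hs_sq (elementary_value E s undefined) \<le> ennreal d"
      using hs_sq_elementary_bounded[of E undefined] by blast
    have m: "(\<lambda>s. blinfun_apply (\<Phi> s - elementary_value E s undefined) h) \<in> borel_measurable (restrict_space borel {t0..t0 + real n})" for h
    proof -
      have [measurable]: "(\<lambda>s. blinfun_apply (\<Phi> s) h) \<in> borel_measurable (restrict_space borel {t0..t0 + real n})"
        by (rule \<Phi>m)
      have [measurable]: "(\<lambda>s. blinfun_apply (elementary_value E s undefined) h) \<in> borel_measurable (restrict_space borel {t0..t0 + real n})"
        by (rule measurable_restrict_space1) measurable
      show ?thesis unfolding blinfun.diff_left by measurable
    qed
    have b: "hs_sq (\<Phi> s - elementary_value E s undefined) \<le> ennreal (2 * c + 2 * d)"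
      if "t0 \<le> s" "s \<le> t0 + real n" for s
      by (rule hs_sq_diff_le) (use c d that in auto)
    show ?thesis
    proof (rule elementary_approx[of "\<lambda>s. \<Phi> s - elementary_value E s undefined", OF m b])
      show "0 < (1 / 64 :: real) ^ n" by simp
      fix D :: "('w, 'h, 'k) elementary" and C :: "'k set"
      assume D: "det_process D" "finite C" "C \<subseteq> the_basis"
        "\<And>a b \<xi> h k. (a, b, \<xi>, h, k) \<in> set D \<Longrightarrow> k \<in> C"
        "\<And>\<omega>. (\<integral>\<^sup>+s\<in>{t0..t0 + real n}. hs_sq (\<Phi> s - elementary_value E s undefined - elementary_value D s \<omega>) \<partial>lborel) < ennreal ((1 / 64) ^ n)"
      have "\<forall>(a, b, \<xi>, h, k)\<in>set D. k \<in> C" using D(4) by (auto simp: split_beta')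
      with D(1-3) D(5)[of undefined] show "\<exists>D. good n E D" unfolding good_def by blast
    qed
  qed
  define nxt where "nxt n E = (SOME D. good n E D)" for n E
  have nxt: "good n E (nxt n E)" for n E
    unfolding nxt_def by (rule someI_ex[OF ex_good])
  define E where "E = rec_nat [] (\<lambda>n E. E @ nxt n E)"
  define D where "D n = nxt n (E n)" for n
  have E0: "E 0 = []" and ES: "E (Suc n) = E n @ D n" for n
    by (simp_all add: E_def D_def)
  have D: "det_process (D n)"
    "\<exists>C. finite C \<and> C \<subseteq> the_basis \<and> (\<forall>(a, b, \<xi>, h, k)\<in>set (D n). k \<in> C)"
    "(\<integral>\<^sup>+s\<in>{t0..t0 + real n}. hs_sq (\<Phi> s - elementary_value (E n) s undefined - elementary_value (D n) s undefined) \<partial>lborel)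
        < ennreal ((1 / 64) ^ n)" for n
    using nxt[of n "E n"] unfolding good_def D_def by blast+
  have detE: "det_process (E n)" for n
  proof (induction n)
    case 0
    show ?case by (simp add: E0 det_process_def)
  next
    case (Suc n)
    then show ?case using D(1)[of n] unfolding ES det_process_def set_append ball_Un by blast
  qed
  define err where "err n = (\<lambda>s. hs_sq (\<Phi> s - elementary_value (E n) s undefined))" for n
  have err: "(\<integral>\<^sup>+s\<in>{t0..t0 + real n}. err (Suc n) s \<partial>lborel) \<le> ennreal ((1 / 64) ^ n)" for n
    using D(3)[of n] unfolding err_def ES elementary_value_append by (simp add: algebra_simps less_imp_le)
  have errm: "(\<lambda>s. err n s * indicator {t0..T} s) \<in> borel_measurable lborel" for n T
  proof -
    have "err n \<in> borel_measurable (restrict_space borel {t0..T})"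
      unfolding err_def
    proof (rule hs_sq_measurable)
      fix h
      have [measurable]: "(\<lambda>s. blinfun_apply (\<Phi> s) h) \<in> borel_measurable (restrict_space borel {t0..T})"
        by (rule \<Phi>m)
      have [measurable]: "(\<lambda>s. blinfun_apply (elementary_value (E n) s undefined) h) \<in> borel_measurable (restrict_space borel {t0..T})"
        by (rule measurable_restrict_space1) measurable
      show "(\<lambda>s. blinfun_apply (\<Phi> s - elementary_value (E n) s undefined) h) \<in> borel_measurable (restrict_space borel {t0..T})"
        unfolding blinfun.diff_left by measurable
    qed
    then show ?thesis
      by (subst (asm) borel_measurable_restrict_space_iff_ennreal) auto
  qed
  define J where "J n = elementary_integral W (D n)" for n
  have JE: "elementary_integral W (E n) t \<omega> = (\<Sum>i<n. J i t \<omega>)" for n t \<omega>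
    by (induction n) (simp_all add: E0 ES elementary_integral_append J_def elementary_integral_def[of W "[]"])
  define I where "I t \<omega> = (\<Sum>n. J n t \<omega>)" for t \<omega>
  have Jm: "J n t \<in> borel_measurable (Fil t)" if "t0 \<le> t" for n t
    unfolding J_def using det_process_elementary[OF D(1)] that by (intro elementary_integral_measurable) auto
  have JmM: "J n t \<in> borel_measurable M" if "t0 \<le> t" for n t
    using meas_M[OF that Jm[OF that]] .
  have Im: "I t \<in> borel_measurable (Fil t)" if "t0 \<le> t" for t
  proof -
    have [measurable]: "J n t \<in> borel_measurable (Fil t)" for n by (rule Jm[OF that])
    show ?thesis unfolding I_def by measurable
  qed
  have Jcont: "AE \<omega> in M. \<forall>n. continuous_on {t0..} (\<lambda>t. J n t \<omega>)"
    unfolding AE_all_countable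
  proof
    fix n
    have "AE \<omega> in M. \<forall>x\<in>set (D n). continuous_on {t0..} (\<lambda>t. W t (fst (snd (snd (snd x)))) \<omega>)"
      by (subst AE_ball_countable) (auto intro: W_continuous countable_finite)
    then show "AE \<omega> in M. continuous_on {t0..} (\<lambda>t. J n t \<omega>)"
    proof eventually_elim
      case (elim \<omega>)
      show ?case unfolding J_def
        by (rule elementary_integral_continuous[OF _ det_process_elementary[OF D(1)]]) (use elim in fastforce)
    qed
  qed
  have Ybound: "\<exists>Y\<in>borel_measurable M. (\<integral>\<^sup>+\<omega>. Y \<omega> \<partial>M) < \<infinity> \<and>
     (AE \<omega> in M. Y \<omega> < \<infinity> \<and> (\<forall>n. \<forall>t\<in>{t0..T}. ennreal ((2 ^ Suc n * norm (J n t \<omega>)) ^ (2 * j)) \<le> Y \<omega>))"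
    if T: "t0 \<le> T" and j: "j > 0" for T j
  proof -
    define S where "S = dense_times t0 T"
    note S = dense_times[OF T, folded S_def]
    \<comment> \<open>From this index on even the previous horizon,
      \<open>t0 + real (n - 1)\<close>, contains the whole interval up to \<open>T\<close>.\<close>
    define nT where "nT = nat \<lceil>T - t0\<rceil> + 1"
    have fin: "\<exists>H\<ge>0. (\<integral>\<^sup>+s\<in>{t0..T}. hs_sq (elementary_value (D n) s undefined) \<partial>lborel) \<le> ennreal H" for n
    proof -
      obtain c where c: "c \<ge> 0" "\<And>s. hs_sq (elementary_value (D n) s undefined) \<le> ennreal c"
        using hs_sq_elementary_bounded[of "D n" undefined] by blast
      have "(\<integral>\<^sup>+s\<in>{t0..T}. hs_sq (elementary_value (D n) s undefined) \<partial>lborel) \<le> (\<integral>\<^sup>+s\<in>{t0..T}. ennreal c \<partial>lborel)"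
        by (intro nn_integral_mono mult_right_mono c) auto
      also have "\<dots> = ennreal (c * (T - t0))"
        using c T by (simp add: nn_integral_cmult ennreal_mult)
      finally show ?thesis using c T by (intro exI[of _ "c * (T - t0)"]) auto
    qed
    then obtain H' where H': "\<And>n. H' n \<ge> 0"
      "\<And>n. (\<integral>\<^sup>+s\<in>{t0..T}. hs_sq (elementary_value (D n) s undefined) \<partial>lborel) \<le> ennreal (H' n)"
      by metis
    \<comment> \<open>For late \<open>n\<close> the piece \<open>D n\<close> is the difference of
      two consecutive errors, the earlier of which is controlled only at rate \<open>n - 1\<close>;
      twice the sum of both is at most the stated value. For the finitely many early
      \<open>n\<close> finiteness is enough.\<close>
    define H where "H n = (if nT \<le> n then 4 * (1 / 64) ^ (n - 1) else H' n)" for n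
    have H0: "0 \<le> H n" for n using H' by (simp add: H_def)
    have H: "(\<integral>\<^sup>+s\<in>{t0..T}. hs_sq (elementary_value (D n) s undefined) \<partial>lborel) \<le> ennreal (H n)" for n
    proof (cases "nT \<le> n")
      case True
      then obtain m where m: "n = Suc m" "nT \<le> Suc m" unfolding nT_def by (cases n) auto
      have Tm: "T \<le> t0 + real m" using m(2) unfolding nT_def by linarith
      have "(\<integral>\<^sup>+s\<in>{t0..T}. hs_sq (elementary_value (D n) s undefined) \<partial>lborel)
          \<le> (\<integral>\<^sup>+s. 2 * (err n s * indicator {t0..t0 + real m} s) + 2 * (err (Suc n) s * indicator {t0..t0 + real n} s) \<partial>lborel)"
      proof (intro nn_integral_mono)
        fix s
        have "elementary_value (D n) s undefined
            = (\<Phi> s - elementary_value (E n) s undefined) + - (\<Phi> s - elementary_value (E (Suc n)) s undefined)"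
          by (simp add: ES elementary_value_append)
        then have "hs_sq (elementary_value (D n) s undefined) \<le> 2 * err n s + 2 * err (Suc n) s"
          unfolding err_def using hs_sq_add_le[of "\<Phi> s - elementary_value (E n) s undefined" "- (\<Phi> s - elementary_value (E (Suc n)) s undefined)"]
          unfolding hs_sq_uminus by simp
        then show "hs_sq (elementary_value (D n) s undefined) * indicator {t0..T} s
            \<le> 2 * (err n s * indicator {t0..t0 + real m} s) + 2 * (err (Suc n) s * indicator {t0..t0 + real n} s)"
          using Tm m(1) by (auto simp: indicator_def)
      qed
      also have "\<dots> = 2 * (\<integral>\<^sup>+s\<in>{t0..t0 + real m}. err (Suc m) s \<partial>lborel) + 2 * (\<integral>\<^sup>+s\<in>{t0..t0 + real n}. err (Suc n) s \<partial>lborel)"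
        unfolding m(1)[symmetric] using errm by (subst nn_integral_add) (auto simp: nn_integral_cmult)
      also have "\<dots> \<le> 2 * ennreal ((1 / 64) ^ m) + 2 * ennreal ((1 / 64) ^ m)"
      proof (intro add_mono mult_left_mono err)
        have "(\<integral>\<^sup>+s\<in>{t0..t0 + real n}. err (Suc n) s \<partial>lborel) \<le> ennreal ((1 / 64) ^ n)" by (rule err)
        also have "\<dots> \<le> ennreal ((1 / 64) ^ m)"
          unfolding m(1) by (intro ennreal_leI power_decreasing) auto
        finally show "(\<integral>\<^sup>+s\<in>{t0..t0 + real n}. err (Suc n) s \<partial>lborel) \<le> ennreal ((1 / 64) ^ m)" .
      qed auto
      also have "\<dots> = ennreal (4 * (1 / 64) ^ m)"
        using ennreal_mult[of 2 "(1 / 64) ^ m"] ennreal_plus[of "2 * (1 / 64) ^ m" "2 * (1 / 64) ^ m"] by simp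
      finally show ?thesis using True m(1) by (simp add: H_def)
    qed (use H' in \<open>simp add: H_def\<close>)
    \<comment> \<open>\<open>vector_sup_moment\<close> requires strict inequality. For late
      \<open>n\<close> the value is twice \<open>\<kappa> * H n\<close>, since
      \<open>4 * 64 = 256\<close>.\<close>
    define v where "v n = (if nT \<le> n then 512 * \<kappa> * (1 / 64) ^ n else \<kappa> * H n + 1)" for n
    have Hv: "\<kappa> * H n < v n" for n
    proof (cases "nT \<le> n")
      case True
      then obtain m where m: "n = Suc m" unfolding nT_def by (cases n) auto
      have "\<kappa> * H n = 256 * (\<kappa> * (1 / 64) ^ n)" using True m by (simp add: H_def)
      moreover have "0 < \<kappa> * (1 / 64) ^ n" using kappa_pos by simp
      moreover have "v n = 512 * (\<kappa> * (1 / 64) ^ n)" using True by (simp add: v_def)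
      ultimately show ?thesis by linarith
    qed (simp add: v_def)
    have v0: "0 \<le> v n" for n
      using Hv[of n] mult_nonneg_nonneg[OF less_imp_le[OF kappa_pos] H0[of n]] by linarith
    define y where "y n \<omega> = (SUP t\<in>S. ennreal (norm (J n t \<omega>) ^ (2 * j)))" for n \<omega>
    have [measurable]: "y n \<in> borel_measurable M" for n
      unfolding y_def
    proof (rule borel_measurable_SUP[OF S(1)])
      fix t assume "t \<in> S"
      then have [measurable]: "J n t \<in> borel_measurable M" using S(3) by (intro JmM) auto
      show "(\<lambda>\<omega>. ennreal (norm (J n t \<omega>) ^ (2 * j))) \<in> borel_measurable M" by measurable
    qed
    have y: "(\<integral>\<^sup>+\<omega>. y n \<omega> \<partial>M) \<le> ennreal (sup_const j * v n ^ j)" for n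
    proof -
      obtain C where C: "finite C" "C \<subseteq> the_basis" "\<forall>(a, b, \<xi>, h, k)\<in>set (D n). k \<in> C"
        using D(2) by blast
      show ?thesis
        unfolding y_def J_def
        by (rule vector_sup_moment[OF D(1) C(1,2) _ H H0 Hv S(1-3) j]) (use C(3) in blast)
    qed
    \<comment> \<open>A sum of all weighted suprema instead of a supremum over \<open>n\<close>: it
      dominates every term and is integrated termwise.\<close>
    define Y where "Y \<omega> = (\<Sum>n. ennreal ((2 ^ Suc n) ^ (2 * j)) * y n \<omega>)" for \<omega>
    have Ym: "Y \<in> borel_measurable M" unfolding Y_def by measurable
    have "(\<integral>\<^sup>+\<omega>. Y \<omega> \<partial>M) = (\<Sum>n. ennreal ((2 ^ Suc n) ^ (2 * j)) * (\<integral>\<^sup>+\<omega>. y n \<omega> \<partial>M))"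
      unfolding Y_def by (simp add: nn_integral_suminf nn_integral_cmult)
    also have "\<dots> \<le> (\<Sum>n. ennreal ((2 ^ Suc n) ^ (2 * j) * (sup_const j * v n ^ j)))"
    proof (intro suminf_le summableI)
      fix n
      have "ennreal ((2 ^ Suc n) ^ (2 * j)) * (\<integral>\<^sup>+\<omega>. y n \<omega> \<partial>M) \<le> ennreal ((2 ^ Suc n) ^ (2 * j)) * ennreal (sup_const j * v n ^ j)"
        by (intro mult_left_mono y) simp
      also have "\<dots> = ennreal ((2 ^ Suc n) ^ (2 * j) * (sup_const j * v n ^ j))"
        using v0[of n] sup_const_pos[of j] by (intro ennreal_mult[symmetric]) auto
      finally show "ennreal ((2 ^ Suc n) ^ (2 * j)) * (\<integral>\<^sup>+\<omega>. y n \<omega> \<partial>M) \<le> ennreal ((2 ^ Suc n) ^ (2 * j) * (sup_const j * v n ^ j))" .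
    qed
    also have "\<dots> < \<infinity>"
    proof -
      \<comment> \<open>The squared weight grows like \<open>4 ^ n\<close> while \<open>v n\<close>
        decays like \<open>(1 / 64) ^ n\<close>, so the terms are eventually geometric with ratio
        \<open>(1 / 16) ^ j\<close>; the constant 2048 is \<open>4 * 512\<close>.\<close>
      have "summable (\<lambda>n. (2 ^ Suc n) ^ (2 * j) * (sup_const j * v n ^ j))"
      proof (rule summable_cong[THEN iffD2])
        show "eventually (\<lambda>n. (2 ^ Suc n) ^ (2 * j) * (sup_const j * v n ^ j)
            = sup_const j * (2048 * \<kappa>) ^ j * ((1 / 16) ^ j) ^ n) sequentially"
          using eventually_ge_at_top[of nT]
        proof eventually_elim
          case (elim n)
          have "((2 ^ Suc n)\<^sup>2 * v n) = 2048 * \<kappa> * (1 / 16) ^ n"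
          proof -
            have "((2::real) ^ Suc n)\<^sup>2 = 4 * 4 ^ n"
              by (simp add: power2_eq_square power_mult_distrib[symmetric])
            moreover have "(4::real) ^ n * (1 / 64) ^ n = (1 / 16) ^ n"
              by (simp add: power_mult_distrib[symmetric])
            ultimately show ?thesis using elim by (simp add: v_def)
          qed
          then have "((2 ^ Suc n)\<^sup>2 * v n) ^ j = (2048 * \<kappa>) ^ j * ((1 / 16) ^ n) ^ j"
            by (simp only: power_mult_distrib)
          moreover have "((2 ^ Suc n)\<^sup>2 * v n) ^ j = (2 ^ Suc n) ^ (2 * j) * v n ^ j"
            by (simp only: power_mult_distrib power_mult)
          moreover have "((1 / 16 :: real) ^ n) ^ j = ((1 / 16) ^ j) ^ n"
            by (simp only: power_mult[symmetric] mult.commute)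
          ultimately have "(2 ^ Suc n) ^ (2 * j) * v n ^ j = (2048 * \<kappa>) ^ j * ((1 / 16) ^ j) ^ n"
            by simp
          then show ?case by (simp only: mult.left_commute[of _ "sup_const j"] mult.assoc)
        qed
        have "(1 / 16 :: real) ^ j < 1" using j by (simp add: power_less_one_iff)
        then show "summable (\<lambda>n. sup_const j * (2048 * \<kappa>) ^ j * ((1 / 16) ^ j) ^ n)"
          by (intro summable_mult summable_geometric) simp
      qed
      then show ?thesis
        using v0 sup_const_pos[of j] by (subst suminf_ennreal2) (auto simp: less_imp_le)
    qed
    finally have Yfin: "(\<integral>\<^sup>+\<omega>. Y \<omega> \<partial>M) < \<infinity>" .
    have "AE \<omega> in M. Y \<omega> \<noteq> \<infinity>"
      by (rule nn_integral_noteq_infinite[OF Ym]) (use Yfin in auto)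
    then have "AE \<omega> in M. Y \<omega> < \<infinity> \<and> (\<forall>n. \<forall>t\<in>{t0..T}. ennreal ((2 ^ Suc n * norm (J n t \<omega>)) ^ (2 * j)) \<le> Y \<omega>)"
      using Jcont
    proof eventually_elim
      case (elim \<omega>)
      obtain r where r: "Y \<omega> = ennreal r" "0 \<le> r" using elim(1) by (cases "Y \<omega>") auto
      have onS: "(2 ^ Suc n * norm (J n t \<omega>)) ^ (2 * j) \<le> r" if "t \<in> S" for n t
      proof -
        have "ennreal ((2 ^ Suc n * norm (J n t \<omega>)) ^ (2 * j)) = ennreal ((2 ^ Suc n) ^ (2 * j)) * ennreal (norm (J n t \<omega>) ^ (2 * j))"
          unfolding power_mult_distrib by (rule ennreal_mult) auto
        also have "\<dots> \<le> ennreal ((2 ^ Suc n) ^ (2 * j)) * y n \<omega>"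
          unfolding y_def by (intro mult_left_mono SUP_upper that) simp
        also have "\<dots> \<le> Y \<omega>"
          unfolding Y_def
          using sum_le_suminf[of "\<lambda>n. ennreal ((2 ^ Suc n) ^ (2 * j)) * y n \<omega>" "{n}"] by (simp add: summableI)
        finally show ?thesis unfolding r(1) using r(2) by (simp only: ennreal_le_iff)
      qed
      \<comment> \<open>Measurability of \<open>Y\<close> forced the supremum onto countably many
        times; continuity of the paths now extends the bound to the full interval.\<close>
      have "(2 ^ Suc n * norm (J n t \<omega>)) ^ (2 * j) \<le> r" if "t \<in> {t0..T}" for n t
      proof (rule continuous_le_on_closure[of S "\<lambda>t. (2 ^ Suc n * norm (J n t \<omega>)) ^ (2 * j)"])
        have "continuous_on {t0..T} (\<lambda>t. J n t \<omega>)"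
          by (rule continuous_on_subset[of "{t0..}"]) (use elim(2) in auto)
        then show "continuous_on (closure S) (\<lambda>t. (2 ^ Suc n * norm (J n t \<omega>)) ^ (2 * j))"
          unfolding S(4) by (intro continuous_intros)
        show "t \<in> closure S" unfolding S(4) by (rule that)
      qed (rule onS)
      then show ?case using elim(1) unfolding r(1) by (auto intro: ennreal_leI simp del: power_Suc)
    qed
    with Ym Yfin show ?thesis by blast
  qed
  have converge: "AE \<omega> in M. continuous_on {t0..} (\<lambda>t. I t \<omega>) \<and> (\<forall>t\<ge>t0. summable (\<lambda>n. J n t \<omega>))"
  proof -
    have "AE \<omega> in M. \<forall>N::nat. continuous_on {t0..t0 + real N} (\<lambda>t. I t \<omega>) \<and> (\<forall>t\<in>{t0..t0 + real N}. summable (\<lambda>n. J n t \<omega>))"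
      unfolding AE_all_countable
    proof
      fix N :: nat
      obtain Y where Y: "AE \<omega> in M. Y \<omega> < \<infinity> \<and> (\<forall>n. \<forall>t\<in>{t0..t0 + real N}. ennreal ((2 ^ Suc n * norm (J n t \<omega>)) ^ (2 * 1)) \<le> Y \<omega>)"
        using Ybound[of "t0 + real N" 1] by auto
      show "AE \<omega> in M. continuous_on {t0..t0 + real N} (\<lambda>t. I t \<omega>) \<and> (\<forall>t\<in>{t0..t0 + real N}. summable (\<lambda>n. J n t \<omega>))"
        using Y Jcont
      proof eventually_elim
        case (elim \<omega>)
        obtain r where r: "Y \<omega> = ennreal r" "0 \<le> r" using elim(1) by (cases "Y \<omega>") auto
        have le: "(2 ^ Suc n * norm (J n t \<omega>)) ^ 2 \<le> r" if "t \<in> {t0..t0 + real N}" for n t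
        proof -
          have "ennreal ((2 ^ Suc n * norm (J n t \<omega>)) ^ 2) \<le> ennreal r"
            using elim(1) that unfolding r(1) by (simp del: power_Suc)
          then show ?thesis using r(2) by (simp only: ennreal_le_iff)
        qed
        have bnd: "norm (J n t \<omega>) \<le> root 2 r * (1 / 2) ^ Suc n" "summable (\<lambda>n. J n t \<omega>)"
          if "t \<in> {t0..t0 + real N}" for n t
          using weighted_sup_bound(1,2)[of "\<lambda>n. J n t \<omega>" 2 r] le[OF that] by auto
        have "uniform_limit {t0..t0 + real N} (\<lambda>n t. \<Sum>i<n. J i t \<omega>) (\<lambda>t. \<Sum>i. J i t \<omega>) sequentially"
        proof (rule Weierstrass_m_test[where M = "\<lambda>n. root 2 r * (1 / 2) ^ Suc n"])
          show "summable (\<lambda>n. root 2 r * (1 / 2) ^ Suc n)"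
            using sums_mult[OF power_half_series, of "root 2 r"] by (rule sums_summable)
        qed (rule bnd)
        then have "continuous_on {t0..t0 + real N} (\<lambda>t. I t \<omega>)"
          unfolding I_def
        proof (rule uniform_limit_theorem[rotated])
          show "\<forall>\<^sub>F n in sequentially. continuous_on {t0..t0 + real N} (\<lambda>t. \<Sum>i<n. J i t \<omega>)"
            using elim(2) by (intro always_eventually allI continuous_on_sum) (auto intro: continuous_on_subset)
        qed simp
        with bnd(2) show ?case by blast
      qed
    qed
    then show ?thesis
    proof eventually_elim
      case (elim \<omega>)
      have "continuous_on {t0..} (\<lambda>t. I t \<omega>)"
        using elim by (intro continuous_on_atLeast) auto
      moreover have "summable (\<lambda>n. J n t \<omega>)" if "t0 \<le> t" for t
      proof -
        obtain N :: nat where "t - t0 < real N" using reals_Archimedean2 by blast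
        then have "t \<in> {t0..t0 + real N}" using that by auto
        then show ?thesis using elim by blast
      qed
      ultimately show ?case by blast
    qed
  qed
  show thesis
  proof (rule that[of I])
    show "I t \<in> borel_measurable (Fil t)" if "t0 \<le> t" for t by (rule Im[OF that])
    show "AE \<omega> in M. continuous_on {t0..} (\<lambda>t. I t \<omega>)"
      using converge by eventually_elim simp
    show "I t0 \<omega> = 0" for \<omega>
      unfolding I_def J_def by (simp add: elementary_integral_start[OF det_process_elementary[OF D(1)]])
    show "\<exists>Y\<in>borel_measurable M. (\<integral>\<^sup>+\<omega>. Y \<omega> \<partial>M) < \<infinity> \<and>
       (AE \<omega> in M. \<forall>t\<in>{t0..T}. ennreal (norm (I t \<omega>) ^ (2 * j)) \<le> Y \<omega>)" if T: "t0 \<le> T" and j: "j > 0" for T j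
    proof -
      obtain Y where Y: "Y \<in> borel_measurable M" "(\<integral>\<^sup>+\<omega>. Y \<omega> \<partial>M) < \<infinity>"
        "AE \<omega> in M. Y \<omega> < \<infinity> \<and> (\<forall>n. \<forall>t\<in>{t0..T}. ennreal ((2 ^ Suc n * norm (J n t \<omega>)) ^ (2 * j)) \<le> Y \<omega>)"
        using Ybound[OF T j] by blast
      have "AE \<omega> in M. \<forall>t\<in>{t0..T}. ennreal (norm (I t \<omega>) ^ (2 * j)) \<le> Y \<omega>"
        using Y(3)
      proof eventually_elim
        case (elim \<omega>)
        obtain r where r: "Y \<omega> = ennreal r" "0 \<le> r" using elim by (cases "Y \<omega>") auto
        show ?case
        proof
          fix t assume t: "t \<in> {t0..T}"
          have "(2 ^ Suc n * norm (J n t \<omega>)) ^ (2 * j) \<le> r" for n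
          proof -
            have "ennreal ((2 ^ Suc n * norm (J n t \<omega>)) ^ (2 * j)) \<le> ennreal r"
              using elim t unfolding r(1) by blast
            then show ?thesis using r(2) by (simp only: ennreal_le_iff)
          qed
          from weighted_sup_bound(3)[of "\<lambda>n. J n t \<omega>", OF this] j
          show "ennreal (norm (I t \<omega>) ^ (2 * j)) \<le> Y \<omega>"
            unfolding r(1) I_def by (intro ennreal_leI) auto
        qed
      qed
      with Y show ?thesis by blast
    qed
    show "has_ito_integral M t0 Fil W (\<lambda>s \<omega>. \<Phi> s) t (I t)" if t: "t0 \<le> t" for t
      unfolding has_ito_integral_def
    proof (intro conjI allI exI[of _ E])
      show "progressively_measurable t0 Fil (\<lambda>s \<omega>. blinfun_apply (\<Phi> s) h)" for h
        unfolding progressively_measurable_def split_beta'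
        by (intro allI impI measurable_compose[OF measurable_fst \<Phi>m])
      show "I t \<in> borel_measurable M" using meas_M[OF t Im[OF t]] .
      show "elementary_process M t0 Fil (E n)" for n by (rule det_process_elementary[OF detE])
      \<comment> \<open>Approximants and integrand are deterministic, so convergence of the
        integrands in probability reduces to convergence of a sequence of numbers.\<close>
      define \<delta> where "\<delta> n = (\<integral>\<^sup>+s\<in>{t0..t}. err n s \<partial>lborel)" for n
      have \<delta>: "(\<integral>\<^sup>+s\<in>{t0..t}. (hs_norm (elementary_value (E n) s \<omega> - \<Phi> s))\<^sup>2 \<partial>lborel) = \<delta> n" for n \<omega>
        unfolding \<delta>_def err_def hs_norm_power2 det_elementary_value[OF detE, of n _ \<omega> undefined]
        by (subst hs_sq_uminus[symmetric]) simp
      show "vanishes_in_probability M (\<lambda>n \<omega>. \<integral>\<^sup>+s\<in>{t0..t}. (hs_norm (elementary_value (E n) s \<omega> - \<Phi> s))\<^sup>2 \<partial>lborel)"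
        unfolding \<delta> vanishes_in_probability_def
      proof (intro conjI allI impI)
        fix \<epsilon> :: real assume \<epsilon>: "\<epsilon> > 0"
        obtain N :: nat where N: "t - t0 < real N" using reals_Archimedean2 by blast
        have "(\<lambda>n. (1 / 64 :: real) ^ n) \<longlonglongrightarrow> 0" by (rule LIMSEQ_realpow_zero) auto
        then have "eventually (\<lambda>n. (1 / 64 :: real) ^ n < \<epsilon>) sequentially"
          using \<epsilon> by (intro order_tendstoD)
        then have "eventually (\<lambda>n. \<delta> (Suc n) \<le> ennreal \<epsilon>) sequentially"
          using eventually_ge_at_top[of N]
        proof eventually_elim
          case (elim n)
          have "\<delta> (Suc n) \<le> (\<integral>\<^sup>+s\<in>{t0..t0 + real n}. err (Suc n) s \<partial>lborel)"
            unfolding \<delta>_def using N elim by (intro nn_integral_mono) (auto simp: indicator_def)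
          also have "\<dots> \<le> ennreal ((1 / 64) ^ n)" by (rule err)
          also have "\<dots> \<le> ennreal \<epsilon>" using elim by (intro ennreal_leI) auto
          finally show ?case .
        qed
        then have "eventually (\<lambda>n. measure M {\<omega> \<in> space M. \<delta> (Suc n) > ennreal \<epsilon>} = 0) sequentially"
          by eventually_elim (simp add: leD)
        then have "(\<lambda>n. measure M {\<omega> \<in> space M. \<delta> (Suc n) > ennreal \<epsilon>}) \<longlonglongrightarrow> 0"
          by (rule tendsto_eventually)
        then show "(\<lambda>n. measure M {\<omega> \<in> space M. \<delta> n > ennreal \<epsilon>}) \<longlonglongrightarrow> 0"
          by (rule LIMSEQ_imp_Suc)
      qed simp
      show "vanishes_in_probability M (\<lambda>n \<omega>. ennreal (dist (elementary_integral W (E n) t \<omega>) (I t \<omega>)))"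
      proof (rule vanishes_in_probability_AE)
        show "(\<lambda>\<omega>. dist (elementary_integral W (E n) t \<omega>) (I t \<omega>)) \<in> borel_measurable M" for n
          using elementary_integral_measurable_M[OF det_process_elementary[OF detE] t, of n] meas_M[OF t Im[OF t]]
          by measurable
        show "AE \<omega> in M. (\<lambda>n. dist (elementary_integral W (E n) t \<omega>) (I t \<omega>)) \<longlonglongrightarrow> 0"
          using converge
        proof eventually_elim
          case (elim \<omega>)
          then have "(\<lambda>n. \<Sum>i<n. J i t \<omega>) \<longlonglongrightarrow> I t \<omega>"
            unfolding I_def using t by (intro summable_LIMSEQ) auto
          then show ?case unfolding JE by (rule tendsto_dist_iff[THEN iffD1])
        qed
      qed simp
    qed
  qed
qed

end

section \<open>Integral equations with an additive path\<close>

lemma set_integral_norm_le: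
  fixes f :: "real \<Rightarrow> 'a::{banach,second_countable_topology}"
  assumes f: "set_integrable lborel A f" and g: "set_integrable lborel A g"
    and le: "\<And>s. s \<in> A \<Longrightarrow> norm (f s) \<le> g s"
  shows "norm (LINT s:A|lborel. f s) \<le> (LINT s:A|lborel. g s)"
proof -
  have "norm (LINT s:A|lborel. f s) \<le> (LINT s|lborel. norm (indicator A s *\<^sub>R f s))"
    unfolding set_lebesgue_integral_def by (rule integral_norm_bound)
  also have "\<dots> \<le> (LINT s:A|lborel. g s)"
    unfolding set_lebesgue_integral_def
    using f g le unfolding set_integrable_def
    by (intro integral_mono integrable_norm) (auto simp: indicator_def)
  finally show ?thesis .
qed

lemma set_integral_Icc_continuous:
  fixes f :: "real \<Rightarrow> 'a::{banach,second_countable_topology}"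
  assumes f: "continuous_on {t0..} f"
  shows "continuous_on {t0..} (\<lambda>t. LINT s:{t0..t}|lborel. f s)"
proof (rule continuous_on_atLeast)
  fix n :: nat
  define T where "T = t0 + real n"
  have fT: "continuous_on {a..b} f" if "t0 \<le> a" for a b
    by (rule continuous_on_subset[OF f]) (use that in auto)
  have int: "set_integrable lborel {t0..t} f" for t
    by (rule borel_integrable_atLeastAtMost'[OF fT]) simp
  have "bounded (f ` {t0..T})"
    by (intro compact_imp_bounded compact_continuous_image fT compact_Icc order_refl)
  then obtain B where B: "B > 0" "\<And>s. s \<in> {t0..T} \<Longrightarrow> norm (f s) \<le> B"
    unfolding bounded_pos by blast
  have le: "dist (LINT s:{t0..t}|lborel. f s) (LINT s:{t0..u}|lborel. f s) \<le> B * dist t u"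
    if tu: "t0 \<le> u" "u \<le> t" "t \<le> T" for t u
  proof -
    have "{t0..t} = {t0..u} \<union> {u<..t}" using tu by auto
    moreover have int': "set_integrable lborel {u<..t} f"
      by (rule set_integrable_subset[OF int[of t]]) (use tu in auto)
    ultimately have "(LINT s:{t0..t}|lborel. f s) - (LINT s:{t0..u}|lborel. f s) = (LINT s:{u<..t}|lborel. f s)"
      using int[of u] by (subst \<open>{t0..t} = _\<close>, subst set_integral_Un) auto
    also have "norm \<dots> \<le> (LINT s:{u<..t}|lborel. B)"
      by (rule set_integral_norm_le[OF int'])
         (use B tu in \<open>auto simp: set_integrable_def\<close>)
    also have "\<dots> = B * dist t u"
      using tu by (simp add: set_lebesgue_integral_def dist_real_def)
    finally show ?thesis by (simp add: dist_norm)
  qed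
  have "B-lipschitz_on {t0..T} (\<lambda>t. LINT s:{t0..t}|lborel. f s)"
  proof (rule lipschitz_onI)
    fix t u assume "t \<in> {t0..T}" "u \<in> {t0..T}"
    then show "dist (LINT s:{t0..t}|lborel. f s) (LINT s:{t0..u}|lborel. f s) \<le> B * dist t u"
      using le[of u t] le[of t u] by (cases "u \<le> t") (auto simp: dist_commute)
  qed (use B in simp)
  then show "continuous_on {t0..t0 + real n} (\<lambda>t. LINT s:{t0..t}|lborel. f s)"
    unfolding T_def by (rule lipschitz_on_continuous_on)
qed

lemma set_integral_exp:
  fixes L t0 t :: real
  assumes "L > 0" "t0 \<le> t"
  shows "(LINT s:{t0..t}|lborel. exp (2 * L * (s - t0))) = (exp (2 * L * (t - t0)) - 1) / (2 * L)"
proof -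
  have "(LINT s|lborel. indicator {t0..t} s *\<^sub>R exp (2 * L * (s - t0)))
      = exp (2 * L * (t - t0)) / (2 * L) - exp (2 * L * (t0 - t0)) / (2 * L)"
  proof (rule integral_FTC_atLeastAtMost[OF assms(2)])
    fix x
    show "((\<lambda>s. exp (2 * L * (s - t0)) / (2 * L)) has_vector_derivative exp (2 * L * (x - t0))) (at x within {t0..t})"
      using assms(1) unfolding has_real_derivative_iff_has_vector_derivative[symmetric]
      by (auto intro!: derivative_eq_intros)
  qed (intro continuous_intros)
  then show ?thesis
    unfolding set_lebesgue_integral_def by (simp add: diff_divide_distrib)
qed

text \<open>In the supremum norm weighted by \<open>exp (- 2 * L * (s - t0))\<close>, integration
  followed by multiplication with \<open>L\<close> has norm at most 1/2 on any interval, so neither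
  iteration nor Gronwall has to restrict to short times. The first form serves Picard iteration, the
  second Gronwall.\<close>

lemma set_integral_weighted_le:
  fixes L t0 t :: real
  assumes L: "L > 0" and t: "t0 \<le> t" and \<phi>: "continuous_on {t0..t} \<phi>"
    and le: "\<And>s. s \<in> {t0..t} \<Longrightarrow> \<phi> s \<le> m * exp (2 * L * (s - t0))" and m: "0 \<le> m"
  shows "L * (LINT s:{t0..t}|lborel. \<phi> s) \<le> m / 2 * exp (2 * L * (t - t0))"
    and "L * (LINT s:{t0..t}|lborel. \<phi> s) \<le> m / 2 * (exp (2 * L * (t - t0)) - 1)"
proof -
  have "(LINT s:{t0..t}|lborel. \<phi> s) \<le> (LINT s:{t0..t}|lborel. m * exp (2 * L * (s - t0)))"
    by (intro set_integral_mono borel_integrable_atLeastAtMost' \<phi> continuous_intros le)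
  also have "\<dots> = m * ((exp (2 * L * (t - t0)) - 1) / (2 * L))"
    using set_integral_exp[OF L t] by simp
  finally have "L * (LINT s:{t0..t}|lborel. \<phi> s) \<le> L * (m * ((exp (2 * L * (t - t0)) - 1) / (2 * L)))"
    using L by (intro mult_left_mono) auto
  also have "\<dots> = m / 2 * (exp (2 * L * (t - t0)) - 1)"
    using L by simp
  finally show "L * (LINT s:{t0..t}|lborel. \<phi> s) \<le> m / 2 * (exp (2 * L * (t - t0)) - 1)" .
  also have "\<dots> \<le> m / 2 * exp (2 * L * (t - t0))"
    using m by (intro mult_left_mono) auto
  finally show "L * (LINT s:{t0..t}|lborel. \<phi> s) \<le> m / 2 * exp (2 * L * (t - t0))" .
qed

text \<open>The hypothesis is evaluated where the weighted function \<open>w\<close> is largest.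
  There the integral term is at most half of the left-hand side and can be absorbed, whence the
  factor 2.\<close>

lemma gronwall_weighted:
  fixes L t0 T :: real
  assumes L: "L > 0" and \<phi>: "continuous_on {t0..T} \<phi>" and nonneg: "\<And>s. s \<in> {t0..T} \<Longrightarrow> 0 \<le> \<phi> s"
    and le: "\<And>t. t \<in> {t0..T} \<Longrightarrow> \<phi> t \<le> A + L * (LINT s:{t0..t}|lborel. \<phi> s)" and A: "0 \<le> A" and t: "t \<in> {t0..T}"
  shows "\<phi> t \<le> 2 * A * exp (2 * L * (t - t0))"
proof -
  define w where "w s = \<phi> s * exp (- 2 * L * (s - t0))" for s
  have "continuous_on {t0..T} w"
    unfolding w_def by (intro continuous_intros \<phi>)
  then obtain u where u: "u \<in> {t0..T}" "\<And>s. s \<in> {t0..T} \<Longrightarrow> w s \<le> w u"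
    using continuous_attains_sup[of "{t0..T}" w] t by auto
  have \<phi>w: "\<phi> s = w s * exp (2 * L * (s - t0))" for s
    by (simp add: w_def mult.assoc flip: exp_add)
  have w0: "0 \<le> w u" using nonneg[OF u(1)] by (simp add: w_def)
  have "\<phi> u \<le> A + w u / 2 * (exp (2 * L * (u - t0)) - 1)"
  proof -
    have "L * (LINT s:{t0..u}|lborel. \<phi> s) \<le> w u / 2 * (exp (2 * L * (u - t0)) - 1)"
    proof (rule set_integral_weighted_le(2)[OF L])
      show "t0 \<le> u" using u by simp
      show "continuous_on {t0..u} \<phi>" by (rule continuous_on_subset[OF \<phi>]) (use u in auto)
      show "\<phi> s \<le> w u * exp (2 * L * (s - t0))" if "s \<in> {t0..u}" for s
        unfolding \<phi>w[of s] using u that by (intro mult_right_mono) auto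
    qed (rule w0)
    with le[OF u(1)] show ?thesis by linarith
  qed
  define e where "e = exp (2 * L * (u - t0))"
  have e: "1 \<le> e" unfolding e_def using u L by auto
  have "w u * e \<le> A + w u / 2 * (e - 1)"
    using \<open>\<phi> u \<le> _\<close> unfolding \<phi>w[of u] e_def by simp
  then have "w u * e \<le> 2 * A"
    using w0 by (simp add: field_simps)
  moreover have "w u * 1 \<le> w u * e" using e w0 by (intro mult_left_mono)
  ultimately have "w u \<le> 2 * A" by simp
  then have "w t \<le> 2 * A" using u(2)[OF t] by linarith
  then show ?thesis unfolding \<phi>w[of t] by (intro mult_right_mono) auto
qed

section \<open>Picard iteration for Lipschitz drifts\<close>

primrec picard :: "(real \<Rightarrow> 'a \<Rightarrow> 'a) \<Rightarrow> real \<Rightarrow> (real \<Rightarrow> 'a) \<Rightarrow> nat \<Rightarrow> real \<Rightarrow> 'a::{banach,second_countable_topology}" where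
  "picard F t0 g 0 = g"
| "picard F t0 g (Suc n) = (\<lambda>t. g t + (LINT s:{t0..t}|lborel. F s (picard F t0 g n s)))"

locale lipschitz_drift =
  fixes t0 :: real and F :: "real \<Rightarrow> 'a \<Rightarrow> 'a::{banach,second_countable_topology}"
  assumes F_continuous: "continuous_on ({t0..} \<times> UNIV) (\<lambda>(s, x). F s x)"
    and F_lipschitz: "\<exists>L>0. \<forall>s\<in>{t0..T}. \<forall>x y. norm (F s x - F s y) \<le> L * norm (x - y)"
begin

lemma F_path_continuous: "continuous_on A X \<Longrightarrow> A \<subseteq> {t0..} \<Longrightarrow> continuous_on A (\<lambda>s. F s (X s))"
proof -
  assume X: "continuous_on A X" and A: "A \<subseteq> {t0..}"
  have "continuous_on A (\<lambda>s. case (s, X s) of (s, x) \<Rightarrow> F s x)"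
    by (rule continuous_on_compose2[OF F_continuous]) (use X A in \<open>auto intro!: continuous_intros\<close>)
  then show ?thesis by simp
qed

lemma picard_continuous: "continuous_on {t0..} g \<Longrightarrow> continuous_on {t0..} (picard F t0 g n)"
  by (induction n) (auto intro!: continuous_on_add set_integral_Icc_continuous F_path_continuous)

lemma integral_equation_diff_le:
  assumes L: "L > 0" "\<And>s x y. s \<in> {t0..T} \<Longrightarrow> norm (F s x - F s y) \<le> L * norm (x - y)"
    and X: "continuous_on {t0..T} X" and Y: "continuous_on {t0..T} Y" and t: "t \<in> {t0..T}"
  shows "norm ((LINT s:{t0..t}|lborel. F s (X s)) - (LINT s:{t0..t}|lborel. F s (Y s)))
    \<le> L * (LINT s:{t0..t}|lborel. norm (X s - Y s))"
proof -
  have sub: "continuous_on {t0..t} X" "continuous_on {t0..t} Y"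
    using X Y t by (auto intro: continuous_on_subset)
  have int: "set_integrable lborel {t0..t} (\<lambda>s. F s (X s))" "set_integrable lborel {t0..t} (\<lambda>s. F s (Y s))"
    by (intro borel_integrable_atLeastAtMost' F_path_continuous sub, use t in auto)+
  have "norm ((LINT s:{t0..t}|lborel. F s (X s)) - (LINT s:{t0..t}|lborel. F s (Y s)))
      = norm (LINT s:{t0..t}|lborel. F s (X s) - F s (Y s))"
    using int by (simp add: set_integral_diff)
  also have "\<dots> \<le> (LINT s:{t0..t}|lborel. L * norm (X s - Y s))"
  proof (rule set_integral_norm_le)
    show "set_integrable lborel {t0..t} (\<lambda>s. F s (X s) - F s (Y s))"
      using int by (rule set_integral_diff)
    show "set_integrable lborel {t0..t} (\<lambda>s. L * norm (X s - Y s))"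
      by (intro borel_integrable_atLeastAtMost' continuous_intros sub)
    show "norm (F s (X s) - F s (Y s)) \<le> L * norm (X s - Y s)" if "s \<in> {t0..t}" for s
      using L(2)[of s] that t by auto
  qed
  also have "\<dots> = L * (LINT s:{t0..t}|lborel. norm (X s - Y s))"
    by simp
  finally show ?thesis .
qed

text \<open>The weighted estimate halves the distance of consecutive iterates in each round, on
  every compact interval. The solution is expressed through the total function \<open>lim\<close> so
  that the same formula defines a measurable process for all sample points.\<close>

lemma picard_converges:
  assumes g: "continuous_on {t0..} g"
  defines "X \<equiv> \<lambda>t. lim (\<lambda>n. picard F t0 g n t)"
  shows "continuous_on {t0..} X" and "t0 \<le> t \<Longrightarrow> X t = g t + (LINT s:{t0..t}|lborel. F s (X s))"
proof -
  have "uniform_limit {t0..T} (picard F t0 g) X sequentially" for T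
  proof (cases "t0 \<le> T")
    case True
    obtain L where L: "L > 0" "\<And>s x y. s \<in> {t0..T} \<Longrightarrow> norm (F s x - F s y) \<le> L * norm (x - y)"
      using F_lipschitz by blast
    define P where "P = picard F t0 g"
    have Pc: "continuous_on {t0..T} (P n)" for n
      unfolding P_def by (rule continuous_on_subset[OF picard_continuous[OF g]]) auto
    have "bounded ((\<lambda>t. P (Suc 0) t - P 0 t) ` {t0..T})"
      by (intro compact_imp_bounded compact_continuous_image continuous_intros Pc compact_Icc)
    then obtain m where m: "m > 0" "\<And>t. t \<in> {t0..T} \<Longrightarrow> norm (P (Suc 0) t - P 0 t) \<le> m"
      unfolding bounded_pos by blast
    have diff: "norm (P (Suc n) t - P n t) \<le> m * (1 / 2) ^ n * exp (2 * L * (t - t0))" if "t \<in> {t0..T}" for n t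
      using that
    proof (induction n arbitrary: t)
      case 0
      have "norm (P (Suc 0) t - P 0 t) \<le> m * 1" using m(2)[OF 0] by simp
      also have "\<dots> \<le> m * exp (2 * L * (t - t0))" using m(1) L(1) 0 by (intro mult_left_mono) auto
      finally show ?case by simp
    next
      case (Suc n)
      have "P (Suc (Suc n)) t - P (Suc n) t
          = (LINT s:{t0..t}|lborel. F s (P (Suc n) s)) - (LINT s:{t0..t}|lborel. F s (P n s))"
        by (simp add: P_def)
      then have "norm (P (Suc (Suc n)) t - P (Suc n) t) \<le> L * (LINT s:{t0..t}|lborel. norm (P (Suc n) s - P n s))"
        using integral_equation_diff_le[OF L Pc Pc Suc.prems] by simp
      also have "\<dots> \<le> (m * (1 / 2) ^ n) / 2 * exp (2 * L * (t - t0))"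
      proof (rule set_integral_weighted_le(1)[OF L(1)])
        show "t0 \<le> t" using Suc.prems by simp
        show "continuous_on {t0..t} (\<lambda>s. norm (P (Suc n) s - P n s))"
          by (intro continuous_intros continuous_on_subset[OF Pc]) (use Suc.prems in auto)
        show "norm (P (Suc n) s - P n s) \<le> m * (1 / 2) ^ n * exp (2 * L * (s - t0))" if "s \<in> {t0..t}" for s
          using that Suc.prems by (intro Suc.IH) auto
      qed (use m in simp)
      finally show ?case by simp
    qed
    define c where "c = m * exp (2 * L * (T - t0))"
    have "uniform_limit {t0..T} (\<lambda>n t. \<Sum>i<n. P (Suc i) t - P i t) (\<lambda>t. \<Sum>i. P (Suc i) t - P i t) sequentially"
    proof (rule Weierstrass_m_test[where M = "\<lambda>n. c * (1 / 2) ^ n"])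
      fix n t assume t: "t \<in> {t0..T}"
      have "norm (P (Suc n) t - P n t) \<le> m * (1 / 2) ^ n * exp (2 * L * (t - t0))" by (rule diff[OF t])
      also have "\<dots> \<le> m * (1 / 2) ^ n * exp (2 * L * (T - t0))"
        using m L t by (intro mult_left_mono) auto
      finally show "norm (P (Suc n) t - P n t) \<le> c * (1 / 2) ^ n" by (simp add: c_def mult_ac)
    qed (intro summable_mult summable_geometric, simp)
    then have "uniform_limit {t0..T} (\<lambda>n t. g t + (\<Sum>i<n. P (Suc i) t - P i t)) (\<lambda>t. g t + (\<Sum>i. P (Suc i) t - P i t)) sequentially"
      by (intro uniform_limit_intros)
    moreover have "g t + (\<Sum>i<n. P (Suc i) t - P i t) = P n t" for n t
      unfolding sum_lessThan_telescope[of "\<lambda>i. P i t" n] by (simp add: P_def)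
    ultimately have *: "uniform_limit {t0..T} P (\<lambda>t. g t + (\<Sum>i. P (Suc i) t - P i t)) sequentially"
      by simp
    have eqX: "g t + (\<Sum>i. P (Suc i) t - P i t) = X t" if "t \<in> {t0..T}" for t
      using tendsto_uniform_limitI[OF * that] unfolding X_def P_def by (simp add: limI)
    have "uniform_limit {t0..T} P (\<lambda>t. g t + (\<Sum>i. P (Suc i) t - P i t)) sequentially
        = uniform_limit {t0..T} P X sequentially"
      by (rule uniform_limit_cong') (simp_all only: eqX)
    with * show ?thesis unfolding P_def by simp
  qed (simp add: uniform_limit_iff)
  note ul = this
  show Xc: "continuous_on {t0..} X"
  proof (rule continuous_on_atLeast)
    fix n :: nat
    show "continuous_on {t0..t0 + real n} X"
      by (rule uniform_limit_theorem[OF _ ul])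
         (auto intro!: always_eventually continuous_on_subset[OF picard_continuous[OF g]])
  qed
  show "X t = g t + (LINT s:{t0..t}|lborel. F s (X s))" if t: "t0 \<le> t"
  proof -
    obtain L where L: "L > 0" "\<And>s x y. s \<in> {t0..t} \<Longrightarrow> norm (F s x - F s y) \<le> L * norm (x - y)"
      using F_lipschitz by blast
    have Xt: "continuous_on {t0..t} X" by (rule continuous_on_subset[OF Xc]) auto
    have Pt: "continuous_on {t0..t} (picard F t0 g n)" for n
      by (rule continuous_on_subset[OF picard_continuous[OF g]]) auto
    have "(\<lambda>n. LINT s:{t0..t}|lborel. F s (picard F t0 g n s)) \<longlonglongrightarrow> (LINT s:{t0..t}|lborel. F s (X s))"
    proof (rule metric_LIMSEQ_I)
      fix r :: real assume r: "r > 0"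
      define e where "e = r / (L * (t - t0) + 1)"
      have den: "0 < L * (t - t0) + 1" using L t by (simp add: add_nonneg_pos)
      have e: "e > 0" using r den by (simp add: e_def)
      have "eventually (\<lambda>n. \<forall>s\<in>{t0..t}. dist (picard F t0 g n s) (X s) < e) sequentially"
        using ul[of t] e by (rule uniform_limitD)
      then obtain N where N: "\<And>n s. n \<ge> N \<Longrightarrow> s \<in> {t0..t} \<Longrightarrow> dist (picard F t0 g n s) (X s) < e"
        unfolding eventually_sequentially by blast
      have "dist (LINT s:{t0..t}|lborel. F s (picard F t0 g n s)) (LINT s:{t0..t}|lborel. F s (X s)) < r" if "n \<ge> N" for n
      proof -
        have "dist (LINT s:{t0..t}|lborel. F s (picard F t0 g n s)) (LINT s:{t0..t}|lborel. F s (X s))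
            \<le> L * (LINT s:{t0..t}|lborel. norm (picard F t0 g n s - X s))"
          unfolding dist_norm by (rule integral_equation_diff_le[OF L Pt Xt]) (use t in auto)
        also have "\<dots> \<le> L * (LINT s:{t0..t}|lborel. e)"
          using L N[OF that]
          by (intro mult_left_mono set_integral_mono borel_integrable_atLeastAtMost' continuous_intros Pt Xt)
             (auto simp: dist_norm less_imp_le)
        also have "\<dots> = L * (t - t0) * e"
          using t by (simp add: set_lebesgue_integral_def)
        also have "\<dots> < (L * (t - t0) + 1) * e" using e by simp
        also have "\<dots> = r" using den by (simp add: e_def)
        finally show ?thesis .
      qed
      then show "\<exists>N. \<forall>n\<ge>N. dist (LINT s:{t0..t}|lborel. F s (picard F t0 g n s)) (LINT s:{t0..t}|lborel. F s (X s)) < r"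
        by blast
    qed
    then have "(\<lambda>n. picard F t0 g (Suc n) t) \<longlonglongrightarrow> g t + (LINT s:{t0..t}|lborel. F s (X s))"
      by (simp add: tendsto_add)
    moreover have "(\<lambda>n. picard F t0 g (Suc n) t) \<longlonglongrightarrow> X t"
      by (rule LIMSEQ_Suc[OF tendsto_uniform_limitI[OF ul[of t]]]) (use t in simp)
    ultimately show ?thesis by (rule LIMSEQ_unique[rotated])
  qed
qed

lemma integral_equation_unique:
  assumes X: "continuous_on {t0..} X" "\<And>t. t0 \<le> t \<Longrightarrow> X t = g t + (LINT s:{t0..t}|lborel. F s (X s))"
    and Y: "continuous_on {t0..} Y" "\<And>t. t0 \<le> t \<Longrightarrow> Y t = g t + (LINT s:{t0..t}|lborel. F s (Y s))"
    and t: "t0 \<le> t"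
  shows "X t = Y t"
proof -
  obtain L where L: "L > 0" "\<And>s x y. s \<in> {t0..t} \<Longrightarrow> norm (F s x - F s y) \<le> L * norm (x - y)"
    using F_lipschitz by blast
  have c: "continuous_on {t0..t} X" "continuous_on {t0..t} Y"
    using X(1) Y(1) by (auto intro: continuous_on_subset)
  have "norm (X t - Y t) \<le> 2 * 0 * exp (2 * L * (t - t0))"
  proof (rule gronwall_weighted[OF L(1), of t0 t "\<lambda>t. norm (X t - Y t)"])
    show "continuous_on {t0..t} (\<lambda>t. norm (X t - Y t))" by (intro continuous_intros c)
    show "norm (X u - Y u) \<le> 0 + L * (LINT s:{t0..u}|lborel. norm (X s - Y s))" if "u \<in> {t0..t}" for u
      using integral_equation_diff_le[OF L c that] X(2)[of u] Y(2)[of u] that by simp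
  qed (use t in auto)
  then show ?thesis by simp
qed

text \<open>The order of quantifiers is the point: \<open>a\<close> and \<open>b\<close> are chosen
  before the path and its forcing term, so the same constants serve almost every sample point and
  moments pass from the noise to the solution.\<close>

lemma integral_equation_bound:
  assumes T: "t0 \<le> T"
  shows "\<exists>a\<ge>0. \<exists>b\<ge>0. \<forall>X g \<rho>. continuous_on {t0..} X \<longrightarrow> 0 \<le> \<rho> \<longrightarrow>
    (\<forall>t\<in>{t0..T}. X t = g t + (LINT s:{t0..t}|lborel. F s (X s))) \<longrightarrow> (\<forall>t\<in>{t0..T}. norm (g t) \<le> \<rho>) \<longrightarrow>
    (\<forall>t\<in>{t0..T}. norm (X t) \<le> a + b * \<rho>)"
proof -
  obtain L where L: "L > 0" "\<And>s x y. s \<in> {t0..T} \<Longrightarrow> norm (F s x - F s y) \<le> L * norm (x - y)"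
    using F_lipschitz by blast
  have "bounded ((\<lambda>s. F s 0) ` {t0..T})"
    by (intro compact_imp_bounded compact_continuous_image F_path_continuous continuous_on_const compact_Icc) auto
  then obtain C where C: "C > 0" "\<And>s. s \<in> {t0..T} \<Longrightarrow> norm (F s 0) \<le> C"
    unfolding bounded_pos by blast
  define e where "e = 2 * exp (2 * L * (T - t0))"
  have e: "e > 0" by (simp add: e_def)
  have bnd: "norm (X t) \<le> (C * (T - t0) * e) + e * \<rho>"
    if X: "continuous_on {t0..} X" and \<rho>: "0 \<le> \<rho>"
      and eq: "\<forall>t\<in>{t0..T}. X t = g t + (LINT s:{t0..t}|lborel. F s (X s))"
      and g: "\<forall>t\<in>{t0..T}. norm (g t) \<le> \<rho>" and t: "t \<in> {t0..T}" for X g \<rho> t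
  proof -
    have c: "continuous_on {t0..u} X" for u using X by (auto intro: continuous_on_subset)
    have A: "0 \<le> \<rho> + C * (T - t0)" using \<rho> C T by (intro add_nonneg_nonneg mult_nonneg_nonneg) auto
    have "norm (X t) \<le> 2 * (\<rho> + C * (T - t0)) * exp (2 * L * (t - t0))"
    proof (rule gronwall_weighted[OF L(1) _ _ _ A t])
      show "continuous_on {t0..T} (\<lambda>t. norm (X t))" by (intro continuous_intros c)
      fix u assume u: "u \<in> {t0..T}"
      have "norm (X u) \<le> norm (g u) + norm (LINT s:{t0..u}|lborel. F s (X s))"
        using eq u norm_triangle_ineq by metis
      also have "norm (LINT s:{t0..u}|lborel. F s (X s)) \<le> (LINT s:{t0..u}|lborel. C + L * norm (X s))"
      proof (rule set_integral_norm_le)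
        show "set_integrable lborel {t0..u} (\<lambda>s. F s (X s))"
          by (intro borel_integrable_atLeastAtMost' F_path_continuous c) auto
        show "set_integrable lborel {t0..u} (\<lambda>s. C + L * norm (X s))"
          by (intro borel_integrable_atLeastAtMost' continuous_intros c)
        fix s assume "s \<in> {t0..u}"
        then have s: "s \<in> {t0..T}" using u by auto
        show "norm (F s (X s)) \<le> C + L * norm (X s)"
          using L(2)[OF s, of "X s" 0] C(2)[OF s] norm_triangle_ineq2[of "F s (X s)" "F s 0"] by simp
      qed
      also have "(LINT s:{t0..u}|lborel. C + L * norm (X s)) = C * (u - t0) + L * (LINT s:{t0..u}|lborel. norm (X s))"
      proof -
        have "set_integrable lborel {t0..u} (\<lambda>s. C)" "set_integrable lborel {t0..u} (\<lambda>s. L * norm (X s))"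
          by (intro borel_integrable_atLeastAtMost' continuous_intros c)+
        then have "(LINT s:{t0..u}|lborel. C + L * norm (X s)) = (LINT s:{t0..u}|lborel. C) + (LINT s:{t0..u}|lborel. L * norm (X s))"
          by (rule set_integral_add)
        then show ?thesis using u by (simp add: set_lebesgue_integral_def)
      qed
      also have "C * (u - t0) \<le> C * (T - t0)" using C u by (intro mult_left_mono) auto
      finally show "norm (X u) \<le> \<rho> + C * (T - t0) + L * (LINT s:{t0..u}|lborel. norm (X s))"
        using g u by force
    qed auto
    also have "\<dots> \<le> 2 * (\<rho> + C * (T - t0)) * exp (2 * L * (T - t0))"
      using A L t by (intro mult_left_mono) auto
    finally show ?thesis by (simp add: e_def algebra_simps)
  qed
  have "0 \<le> C * (T - t0) * e" using C T e by simp
  with e bnd show ?thesis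
    by (intro exI[of _ "C * (T - t0) * e"] conjI exI[of _ e]) auto
qed

end

section \<open>Progressive measurability\<close>

lemma progressively_measurable_adapted:
  assumes "progressively_measurable t0 Fil X" "t0 \<le> t"
  shows "X t \<in> borel_measurable (Fil t)"
proof -
  have 1: "(\<lambda>(s, \<omega>). X s \<omega>) \<in> borel_measurable (restrict_space borel {t0..t} \<Otimes>\<^sub>M Fil t)"
    using assms by (auto simp: progressively_measurable_def)
  have 2: "(\<lambda>\<omega>. (t, \<omega>)) \<in> measurable (Fil t) (restrict_space borel {t0..t} \<Otimes>\<^sub>M Fil t)"
    using assms(2) by (intro measurable_Pair1') (auto simp: space_restrict_space)
  from measurable_compose[OF 2 1] show ?thesis by simp
qed

text \<open>The dyadic grid point \<open>gr n s\<close> is never later than \<open>s\<close>, so the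
  step processes are progressive. Since \<open>lim\<close> is total, the limit is measurable on all
  sample points, and it is only on continuous paths that it must reproduce \<open>X\<close>.\<close>

lemma progressive_version:
  fixes X :: "real \<Rightarrow> 'w \<Rightarrow> 'a::{banach,second_countable_topology}"
  assumes filt: "filtration_from M t0 Fil" and X: "\<And>t. t0 \<le> t \<Longrightarrow> X t \<in> borel_measurable (Fil t)"
  obtains X' where "progressively_measurable t0 Fil X'"
    "\<And>\<omega> t. continuous_on {t0..} (\<lambda>t. X t \<omega>) \<Longrightarrow> t0 \<le> t \<Longrightarrow> X' t \<omega> = X t \<omega>"
proof -
  define gr where "gr n s = t0 + real_of_int \<lfloor>2 ^ n * (s - t0)\<rfloor> / 2 ^ n" for n :: nat and s
  have gr_le: "gr n s \<le> s" for n s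
  proof -
    have "real_of_int \<lfloor>2 ^ n * (s - t0)\<rfloor> / 2 ^ n \<le> (2 ^ n * (s - t0)) / 2 ^ n"
      by (intro divide_right_mono) auto
    then show ?thesis by (simp add: gr_def)
  qed
  have gr_ge: "s - (1 / 2) ^ n \<le> gr n s" for n s
  proof -
    have "(2 ^ n * (s - t0) - 1) / 2 ^ n \<le> real_of_int \<lfloor>2 ^ n * (s - t0)\<rfloor> / 2 ^ n"
      by (intro divide_right_mono) (linarith, simp)
    then show ?thesis by (simp add: gr_def diff_divide_distrib power_one_over)
  qed
  have gr_t0: "t0 \<le> gr n s" if "t0 \<le> s" for n s
    using that by (simp add: gr_def)
  define X' where "X' s \<omega> = lim (\<lambda>n. X (gr n s) \<omega>)" for s \<omega>
  show thesis
  proof (rule that[of X'])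
    show "progressively_measurable t0 Fil X'"
      unfolding progressively_measurable_def
    proof (intro allI impI)
      fix T assume T: "t0 \<le> T"
      let ?N = "restrict_space borel {t0..T} \<Otimes>\<^sub>M Fil T"
      have "(\<lambda>z. X (gr n (fst z)) (snd z)) \<in> borel_measurable ?N" for n
      proof -
        have id: "(\<lambda>x. x) \<in> borel_measurable (restrict_space borel {t0..T})"
          by (rule measurable_restrict_space1) simp
        have [measurable]: "fst \<in> borel_measurable ?N"
          by (rule measurable_compose[OF measurable_fst id])
        define k where "k z = \<lfloor>2 ^ n * (fst z - t0)\<rfloor>" for z :: "real \<times> 'w"
        have k: "k \<in> measurable ?N (count_space UNIV)"
          unfolding k_def by measurable
        \<comment> \<open>Clipping makes \<open>X (t i)\<close> measurable for \<open>Fil T\<close>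
          for every integer \<open>i\<close>; on the space of \<open>?N\<close> it changes
          nothing.\<close>
        define t where "t i = min T (max t0 (t0 + real_of_int i / 2 ^ n))" for i
        have "(\<lambda>z. X (t i) (snd z)) \<in> borel_measurable ?N" for i
        proof -
          have "t0 \<le> t i" "t i \<le> T" using T by (auto simp: t_def)
          then have "X (t i) \<in> borel_measurable (Fil T)"
            using filt measurable_from_subalg[OF _ X] unfolding filtration_from_def by blast
          then show ?thesis by (rule measurable_compose[OF measurable_snd])
        qed
        from measurable_compose_countable[OF this k]
        have "(\<lambda>z. X (t (k z)) (snd z)) \<in> borel_measurable ?N" .
        moreover have "t (k z) = gr n (fst z)" if "z \<in> space ?N" for z
        proof -
          have "t0 \<le> fst z" "fst z \<le> T" using that by (auto simp: space_pair_measure space_restrict_space)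
          then have "t0 \<le> gr n (fst z)" "gr n (fst z) \<le> T"
            using gr_t0[of "fst z" n] gr_le[of n "fst z"] by auto
          then show ?thesis by (simp add: t_def k_def gr_def)
        qed
        ultimately show ?thesis by (simp cong: measurable_cong)
      qed
      then have "(\<lambda>z. lim (\<lambda>n. X (gr n (fst z)) (snd z))) \<in> borel_measurable ?N"
        by (rule borel_measurable_lim_metric)
      then show "(\<lambda>(s, \<omega>). X' s \<omega>) \<in> borel_measurable ?N"
        unfolding X'_def by (simp add: split_beta')
    qed
    fix \<omega> t assume c: "continuous_on {t0..} (\<lambda>t. X t \<omega>)" and t: "t0 \<le> t"
    have "(\<lambda>n. gr n t) \<longlonglongrightarrow> t"
    proof (rule tendsto_sandwich[where h = "\<lambda>_. t"])
      show "(\<lambda>n. t - (1 / 2) ^ n) \<longlonglongrightarrow> t"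
        by (rule tendsto_eq_rhs[OF tendsto_diff[OF tendsto_const LIMSEQ_realpow_zero]]) auto
    qed (use gr_ge gr_le in \<open>auto intro!: always_eventually\<close>)
    then have "(\<lambda>n. X (gr n t) \<omega>) \<longlonglongrightarrow> X t \<omega>"
      using t gr_t0 by (intro continuous_on_tendsto_compose[OF c]) (auto intro!: always_eventually)
    then show "X' t \<omega> = X t \<omega>" unfolding X'_def by (rule limI)
  qed
qed

text \<open>The integral up to a variable time is a parameter integral of a jointly measurable
  function over the fixed line, the upper limit being moved into an indicator.\<close>

lemma (in lipschitz_drift) picard_progressive:
  assumes G: "progressively_measurable t0 Fil G"
  shows "progressively_measurable t0 Fil (\<lambda>t \<omega>. picard F t0 (\<lambda>s. G s \<omega>) n t)"
proof (induction n)
  case 0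
  then show ?case using G by simp
next
  case (Suc n)
  define X where "X s \<omega> = picard F t0 (\<lambda>s. G s \<omega>) n s" for s \<omega>
  show ?case
    unfolding progressively_measurable_def
  proof (intro allI impI)
    fix T assume T: "t0 \<le> T"
    let ?R = "restrict_space borel {t0..T}"
    let ?N = "?R \<Otimes>\<^sub>M Fil T"
    have XN: "(\<lambda>(s, \<omega>). X s \<omega>) \<in> borel_measurable ?N"
      using Suc T by (auto simp: progressively_measurable_def X_def)
    have GN[measurable]: "(\<lambda>(s, \<omega>). G s \<omega>) \<in> borel_measurable ?N"
      using G T by (auto simp: progressively_measurable_def)
    \<comment> \<open>Clamping the time to [t0, T] extends the drift to a continuous function on the
      whole line, and thus to a Borel function, without altering it where it is integrated.\<close>
    define cl where "cl s = max t0 (min s T)" for s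
    have clR: "cl \<in> measurable borel ?R"
    proof (rule measurable_restrict_space2)
      show "cl \<in> borel_measurable borel" unfolding cl_def by measurable
    qed (use T in \<open>auto simp: cl_def\<close>)
    have "continuous_on UNIV (\<lambda>z. case (cl (fst z), snd z) of (s, x) \<Rightarrow> F s x)"
      by (rule continuous_on_compose2[OF F_continuous]) (auto simp: cl_def intro!: continuous_intros)
    then have FB: "(\<lambda>z. F (cl (fst z)) (snd z)) \<in> borel_measurable borel"
      by (intro borel_measurable_continuous_onI) simp
    define H where "H s \<omega> = F (cl s) (X (cl s) \<omega>)" for s \<omega>
    have HM: "(\<lambda>z. H (fst z) (snd z)) \<in> borel_measurable (borel \<Otimes>\<^sub>M Fil T)"
    proof -
      have "(\<lambda>z. (cl (fst z), snd z)) \<in> measurable (borel \<Otimes>\<^sub>M Fil T) ?N"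
        by (intro measurable_Pair measurable_compose[OF measurable_fst clR] measurable_snd)
      from measurable_compose[OF this XN]
      have [measurable]: "(\<lambda>z. X (cl (fst z)) (snd z)) \<in> borel_measurable (borel \<Otimes>\<^sub>M Fil T)" by simp
      have "(\<lambda>z. (fst z, X (cl (fst z)) (snd z))) \<in> measurable (borel \<Otimes>\<^sub>M Fil T) (borel \<Otimes>\<^sub>M borel)"
        by measurable
      from measurable_compose[OF this[unfolded borel_prod] FB] show ?thesis
        by (simp add: H_def)
    qed
    have id: "(\<lambda>x. x) \<in> borel_measurable ?R"
      by (rule measurable_restrict_space1) simp
    have [measurable]: "fst \<in> borel_measurable ?N"
      by (rule measurable_compose[OF measurable_fst id])
    have joint: "(\<lambda>(z, s). indicator {t0..fst z} s *\<^sub>R H s (snd z)) \<in> borel_measurable (?N \<Otimes>\<^sub>M lborel)"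
    proof -
      have [measurable]: "(\<lambda>y. fst (fst y)) \<in> borel_measurable (?N \<Otimes>\<^sub>M lborel)"
        by (rule measurable_compose[OF measurable_fst]) measurable
      have "(\<lambda>y. (snd y, snd (fst y))) \<in> measurable (?N \<Otimes>\<^sub>M lborel) (borel \<Otimes>\<^sub>M Fil T)"
        by (intro measurable_Pair measurable_compose[OF measurable_fst measurable_snd])
           (simp add: measurable_snd cong: measurable_cong_sets)
      from measurable_compose[OF this HM]
      have [measurable]: "(\<lambda>y. H (snd y) (snd (fst y))) \<in> borel_measurable (?N \<Otimes>\<^sub>M lborel)" by simp
      have "(\<lambda>y. (if t0 \<le> snd y \<and> snd y \<le> fst (fst y) then 1 else 0 :: real) *\<^sub>R H (snd y) (snd (fst y)))
          \<in> borel_measurable (?N \<Otimes>\<^sub>M lborel)"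
        by measurable
      then show ?thesis by (simp add: indicator_def split_beta')
    qed
    have "(\<lambda>z. LINT s|lborel. indicator {t0..fst z} s *\<^sub>R H s (snd z)) \<in> borel_measurable ?N"
      using lborel.borel_measurable_lebesgue_integral[OF joint] by simp
    then have "(\<lambda>z. G (fst z) (snd z) + (LINT s|lborel. indicator {t0..fst z} s *\<^sub>R H s (snd z))) \<in> borel_measurable ?N"
      using GN by (intro borel_measurable_add) (simp_all add: split_beta')
    moreover have "G (fst z) (snd z) + (LINT s|lborel. indicator {t0..fst z} s *\<^sub>R H s (snd z))
       = picard F t0 (\<lambda>s. G s (snd z)) (Suc n) (fst z)" if "z \<in> space ?N" for z
    proof -
      have "fst z \<le> T" using that by (auto simp: space_pair_measure space_restrict_space)
      then have heq: "indicator {t0..fst z} s *\<^sub>R H s (snd z) = indicator {t0..fst z} s *\<^sub>R F s (X s (snd z))" for s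
        by (auto simp: indicator_def H_def cl_def max_def min_def)
      show ?thesis unfolding heq picard.simps set_lebesgue_integral_def X_def ..
    qed
    ultimately have "(\<lambda>z. picard F t0 (\<lambda>s. G s (snd z)) (Suc n) (fst z)) \<in> borel_measurable ?N"
      by (simp cong: measurable_cong)
    then show "(\<lambda>(s, \<omega>). picard F t0 (\<lambda>s. G s \<omega>) (Suc n) s) \<in> borel_measurable ?N"
      by (simp only: split_beta')
  qed
qed

lemma add_power_le: "0 \<le> a \<Longrightarrow> 0 \<le> b \<Longrightarrow> (a + b) ^ n \<le> 2 ^ n * (a ^ n + b ^ n)" for a b :: real
proof -
  assume ab: "0 \<le> a" "0 \<le> b"
  have "(a + b) ^ n \<le> (2 * max a b) ^ n" using ab by (intro power_mono) auto
  also have "\<dots> = 2 ^ n * max a b ^ n" by (rule power_mult_distrib)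
  also have "max a b ^ n \<le> a ^ n + b ^ n" using ab by (auto simp: max_def)
  finally show ?thesis by simp
qed

section \<open>Equations with additive noise\<close>

locale additive_noise = bm_setting M t0 Fil Q W \<kappa> + lipschitz_drift t0 F
  for M :: "'w measure" and t0 Fil and Q :: "'h::{real_inner,banach,second_countable_topology} \<Rightarrow> 'h"
    and W \<kappa> and F :: "real \<Rightarrow> 'k \<Rightarrow> 'k::{real_inner,banach,second_countable_topology}" +
  fixes \<Phi> :: "real \<Rightarrow> ('h \<Rightarrow>\<^sub>L 'k)"
  assumes \<Phi>_measurable: "(\<lambda>s. blinfun_apply (\<Phi> s) h) \<in> borel_measurable (restrict_space borel {t0..T})"
    and \<Phi>_bounded: "\<exists>c\<ge>0. \<forall>s\<in>{t0..T}. hs_sq (\<Phi> s) \<le> ennreal c"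
begin

text \<open>The exceptional set in \<open>strong_solution\<close> depends on the time. The identity
  is therefore collected on countably many dense times and extended by continuity of both sides,
  which yields one null set for all times.\<close>

lemma strong_solution_integral_equation:
  assumes X: "strong_solution M t0 Fil W F (\<lambda>s _. \<Phi> s) x0 X"
    and I: "\<And>t. t0 \<le> t \<Longrightarrow> has_ito_integral M t0 Fil W (\<lambda>s \<omega>. \<Phi> s) t (I t)"
    and Ic: "AE \<omega> in M. continuous_on {t0..} (\<lambda>t. I t \<omega>)"
  shows "AE \<omega> in M. continuous_on {t0..} (\<lambda>t. X t \<omega>) \<and>
    (\<forall>t\<ge>t0. X t \<omega> = x0 + I t \<omega> + (LINT s:{t0..t}|lborel. F s (X s \<omega>)))"
proof -
  have X0: "AE \<omega> in M. X t0 \<omega> = x0" and Xc: "AE \<omega> in M. continuous_on {t0..} (\<lambda>t. X t \<omega>)"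
    using X by (auto simp: strong_solution_def)
  have eq: "AE \<omega> in M. X t \<omega> = x0 + I t \<omega> + (LINT s:{t0..t}|lborel. F s (X s \<omega>))" if t: "t0 \<le> t" for t
  proof -
    obtain I' where I': "has_ito_integral M t0 Fil W (\<lambda>s \<omega>. \<Phi> s) t I'"
      "AE \<omega> in M. X t \<omega> = X t0 \<omega> + (LINT s:{t0..t}|lborel. F s (X s \<omega>)) + I' \<omega>"
      using X t unfolding strong_solution_def by blast
    from ito_integral_unique[OF I[OF t] I'(1) t] I'(2) X0 show ?thesis
      by eventually_elim (simp add: algebra_simps)
  qed
  have "AE \<omega> in M. \<forall>N::nat. \<forall>t\<in>dense_times t0 (t0 + real N).
      X t \<omega> = x0 + I t \<omega> + (LINT s:{t0..t}|lborel. F s (X s \<omega>))"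
    unfolding AE_all_countable
  proof
    fix N :: nat
    show "AE \<omega> in M. \<forall>t\<in>dense_times t0 (t0 + real N). X t \<omega> = x0 + I t \<omega> + (LINT s:{t0..t}|lborel. F s (X s \<omega>))"
      by (intro AE_ball_countable[OF dense_times(1), THEN iffD2] ballI eq)
         (use dense_times(3)[of t0 "t0 + real N"] in auto)
  qed
  with Xc Ic show ?thesis
  proof eventually_elim
    case (elim \<omega>)
    have "X t \<omega> = x0 + I t \<omega> + (LINT s:{t0..t}|lborel. F s (X s \<omega>))" if t: "t0 \<le> t" for t
    proof -
      obtain N :: nat where N: "t - t0 < real N" using reals_Archimedean2 by blast
      let ?S = "dense_times t0 (t0 + real N)"
      have cl: "closure ?S = {t0..t0 + real N}" by (rule dense_times(4)) simp
      have "continuous_on {t0..} (\<lambda>t. X t \<omega> - (x0 + I t \<omega> + (LINT s:{t0..t}|lborel. F s (X s \<omega>))))"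
        by (intro continuous_intros set_integral_Icc_continuous F_path_continuous elim(1,2)) auto
      then have "continuous_on (closure ?S) (\<lambda>t. X t \<omega> - (x0 + I t \<omega> + (LINT s:{t0..t}|lborel. F s (X s \<omega>))))"
        unfolding cl by (rule continuous_on_subset) auto
      then have "X t \<omega> - (x0 + I t \<omega> + (LINT s:{t0..t}|lborel. F s (X s \<omega>))) = 0"
        by (rule continuous_constant_on_closure) (use elim(3) t N cl in auto)
      then show ?thesis by simp
    qed
    with elim(1) show ?case by blast
  qed
qed

lemma additive_noise_solution:
  "\<exists>X. strong_solution M t0 Fil W F (\<lambda>s _. \<Phi> s) x0 X \<and>
    (\<forall>X'. strong_solution M t0 Fil W F (\<lambda>s _. \<Phi> s) x0 X' \<longrightarrow> indistinguishable_from M t0 X X') \<and>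
    (\<forall>\<nu>\<ge>2. X \<in> S_class M t0 Fil \<nu>)"
proof -
  obtain I :: "real \<Rightarrow> 'w \<Rightarrow> 'k" where Im: "\<And>t. t0 \<le> t \<Longrightarrow> I t \<in> borel_measurable (Fil t)"
    and Ic: "AE \<omega> in M. continuous_on {t0..} (\<lambda>t. I t \<omega>)"
    and Iito: "\<And>t. t0 \<le> t \<Longrightarrow> has_ito_integral M t0 Fil W (\<lambda>s \<omega>. \<Phi> s) t (I t)"
    and I0: "\<And>\<omega>. I t0 \<omega> = 0"
    and Imom: "\<And>T j. t0 \<le> T \<Longrightarrow> j > 0 \<Longrightarrow> \<exists>Y\<in>borel_measurable M. (\<integral>\<^sup>+\<omega>. Y \<omega> \<partial>M) < \<infinity> \<and>
       (AE \<omega> in M. \<forall>t\<in>{t0..T}. ennreal (norm (I t \<omega>) ^ (2 * j)) \<le> Y \<omega>)"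
    using ito_integral_version[OF \<Phi>_measurable \<Phi>_bounded] by blast
  obtain I' where I': "progressively_measurable t0 Fil I'"
    "\<And>\<omega> t. continuous_on {t0..} (\<lambda>t. I t \<omega>) \<Longrightarrow> t0 \<le> t \<Longrightarrow> I' t \<omega> = I t \<omega>"
    using progressive_version[OF filt Im] by blast
  \<comment> \<open>Picard iteration runs on the progressive version \<open>I'\<close>, while the
    equation is stated with \<open>I\<close>; they agree at all times on every continuous path of
    \<open>I\<close>.\<close>
  define G where "G t \<omega> = x0 + I' t \<omega>" for t \<omega>
  have G: "progressively_measurable t0 Fil G"
    unfolding progressively_measurable_def
  proof (intro allI impI)
    fix T assume "t0 \<le> T"
    then have "(\<lambda>z. I' (fst z) (snd z)) \<in> borel_measurable (restrict_space borel {t0..T} \<Otimes>\<^sub>M Fil T)"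
      using I'(1) by (simp add: progressively_measurable_def split_beta')
    then have "(\<lambda>z. x0 + I' (fst z) (snd z)) \<in> borel_measurable (restrict_space borel {t0..T} \<Otimes>\<^sub>M Fil T)"
      by (intro borel_measurable_add borel_measurable_const)
    then show "(\<lambda>(s, \<omega>). G s \<omega>) \<in> borel_measurable (restrict_space borel {t0..T} \<Otimes>\<^sub>M Fil T)"
      by (simp add: G_def split_beta')
  qed
  \<comment> \<open>Defined for every sample point, including those on which the iteration may fail
    to converge; this keeps the process progressively measurable.\<close>
  define X where "X t \<omega> = lim (\<lambda>n. picard F t0 (\<lambda>s. G s \<omega>) n t)" for t \<omega>
  have Xprog: "progressively_measurable t0 Fil X"
    unfolding progressively_measurable_def
  proof (intro allI impI)
    fix T assume T: "t0 \<le> T"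
    have "(\<lambda>z. picard F t0 (\<lambda>s. G s (snd z)) n (fst z)) \<in> borel_measurable (restrict_space borel {t0..T} \<Otimes>\<^sub>M Fil T)" for n
      using picard_progressive[OF G, of n] T by (simp add: progressively_measurable_def split_beta')
    then have "(\<lambda>z. lim (\<lambda>n. picard F t0 (\<lambda>s. G s (snd z)) n (fst z))) \<in> borel_measurable (restrict_space borel {t0..T} \<Otimes>\<^sub>M Fil T)"
      by (rule borel_measurable_lim_metric)
    then show "(\<lambda>(s, \<omega>). X s \<omega>) \<in> borel_measurable (restrict_space borel {t0..T} \<Otimes>\<^sub>M Fil T)"
      by (simp add: X_def split_beta')
  qed
  have sol: "AE \<omega> in M. continuous_on {t0..} (\<lambda>t. X t \<omega>) \<and>
    (\<forall>t\<ge>t0. X t \<omega> = x0 + I t \<omega> + (LINT s:{t0..t}|lborel. F s (X s \<omega>)))"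
    using Ic
  proof eventually_elim
    case (elim \<omega>)
    have eq: "G t \<omega> = x0 + I t \<omega>" if "t0 \<le> t" for t
      using I'(2)[OF elim that] by (simp add: G_def)
    have "continuous_on {t0..} (\<lambda>t. x0 + I t \<omega>)"
      using elim by (intro continuous_intros)
    then have c: "continuous_on {t0..} (\<lambda>t. G t \<omega>)"
      by (rule continuous_on_cong[THEN iffD1, OF refl, rotated]) (simp add: eq)
    show ?case
      using picard_converges[OF c] eq unfolding X_def by simp
  qed
  have X0: "AE \<omega> in M. X t0 \<omega> = x0"
    using sol
  proof eventually_elim
    case (elim \<omega>)
    have "(LINT s:{t0..t0}|lborel. F s (X s \<omega>)) = 0"
    proof -
      have "AE s in lborel. s \<noteq> t0" by (rule AE_lborel_singleton)
      then have "AE s in lborel. indicator {t0..t0} s *\<^sub>R F s (X s \<omega>) = 0"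
        by eventually_elim (auto simp: indicator_def)
      then show ?thesis
        unfolding set_lebesgue_integral_def by (rule integral_eq_zero_AE)
    qed
    then show ?case using elim I0 by simp
  qed
  have strong: "strong_solution M t0 Fil W F (\<lambda>s _. \<Phi> s) x0 X"
    unfolding strong_solution_def
  proof (intro conjI allI impI)
    fix t assume t: "t0 \<le> t"
    show "X t \<in> borel_measurable (Fil t)"
      by (rule progressively_measurable_adapted[OF Xprog t])
    obtain c where c: "c \<ge> 0" "\<And>s. s \<in> {t0..t} \<Longrightarrow> hs_sq (\<Phi> s) \<le> ennreal c"
      using \<Phi>_bounded[of t] by blast
    have "(\<integral>\<^sup>+s\<in>{t0..t}. (hs_norm (\<Phi> s))\<^sup>2 \<partial>lborel) \<le> (\<integral>\<^sup>+s\<in>{t0..t}. ennreal c \<partial>lborel)"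
      unfolding hs_norm_power2 using c by (intro nn_integral_mono) (auto simp: indicator_def)
    also have "\<dots> < \<infinity>"
      using t by (simp add: nn_integral_cmult ennreal_mult_less_top)
    finally have fin: "(\<integral>\<^sup>+s\<in>{t0..t}. (hs_norm (\<Phi> s))\<^sup>2 \<partial>lborel) < \<infinity>" .
    show "AE \<omega> in M. set_integrable lborel {t0..t} (\<lambda>s. F s (X s \<omega>)) \<and>
        (\<integral>\<^sup>+s\<in>{t0..t}. (hs_norm (\<Phi> s))\<^sup>2 \<partial>lborel) < \<infinity>"
      using sol
    proof eventually_elim
      case (elim \<omega>)
      then have "continuous_on {t0..t} (\<lambda>s. X s \<omega>)" by (auto intro: continuous_on_subset)
      then have "set_integrable lborel {t0..t} (\<lambda>s. F s (X s \<omega>))"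
        by (intro borel_integrable_atLeastAtMost' F_path_continuous) auto
      with fin show ?case by blast
    qed
    show "\<exists>J. has_ito_integral M t0 Fil W (\<lambda>s \<omega>. \<Phi> s) t J \<and>
        (AE \<omega> in M. X t \<omega> = X t0 \<omega> + (LINT s:{t0..t}|lborel. F s (X s \<omega>)) + J \<omega>)"
    proof (intro exI conjI)
      show "has_ito_integral M t0 Fil W (\<lambda>s \<omega>. \<Phi> s) t (I t)" by (rule Iito[OF t])
      show "AE \<omega> in M. X t \<omega> = X t0 \<omega> + (LINT s:{t0..t}|lborel. F s (X s \<omega>)) + I t \<omega>"
        using sol X0
      proof eventually_elim
        case (elim \<omega>)
        then have "X t \<omega> = x0 + I t \<omega> + (LINT s:{t0..t}|lborel. F s (X s \<omega>))" using t by blast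
        with elim(2) show ?case by (simp only: ac_simps)
      qed
    qed
  next
    show "AE \<omega> in M. X t0 \<omega> = x0" by (rule X0)
    show "AE \<omega> in M. continuous_on {t0..} (\<lambda>t. X t \<omega>)" using sol by eventually_elim blast
  qed
  have unique: "indistinguishable_from M t0 X X'" if X': "strong_solution M t0 Fil W F (\<lambda>s _. \<Phi> s) x0 X'" for X'
  proof -
    have eqX': "AE \<omega> in M. continuous_on {t0..} (\<lambda>t. X' t \<omega>) \<and>
        (\<forall>t\<ge>t0. X' t \<omega> = x0 + I t \<omega> + (LINT s:{t0..t}|lborel. F s (X' s \<omega>)))"
      by (rule strong_solution_integral_equation[OF X' _ Ic]) (rule Iito)
    show ?thesis
      unfolding indistinguishable_from_def
      using sol eqX'
    proof eventually_elim
      case (elim \<omega>)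
      show ?case
      proof (intro allI impI)
        fix t assume t: "t0 \<le> t"
        show "X t \<omega> = X' t \<omega>"
          by (rule integral_equation_unique[of "\<lambda>t. X t \<omega>" "\<lambda>t. x0 + I t \<omega>" "\<lambda>t. X' t \<omega>", OF _ _ _ _ t])
             (use elim in blast)+
      qed
    qed
  qed
  have S: "X \<in> S_class M t0 Fil \<nu>" if \<nu>: "2 \<le> \<nu>" for \<nu>
    unfolding S_class_def
  proof (intro CollectI conjI allI impI)
    show "progressively_measurable t0 Fil X" by (rule Xprog)
    show "AE \<omega> in M. continuous_on {t0..} (\<lambda>t. X t \<omega>)" using sol by eventually_elim blast
    fix T assume T: "t0 \<le> T"
    \<comment> \<open>Moment bounds for the noise are available for the exponents
      \<open>2 * j\<close>; the real exponent \<open>\<nu>\<close> is dominated by one of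
      them.\<close>
    obtain j :: nat where j: "\<nu> \<le> real j" "j > 0"
    proof -
      obtain i :: nat where "max \<nu> 1 < real i" using reals_Archimedean2 by blast
      then have "\<nu> \<le> real i" "i > 0" by auto
      then show thesis by (rule that)
    qed
    obtain a b where ab: "a \<ge> 0" "b \<ge> 0" and bound:
      "\<forall>X g \<rho>. continuous_on {t0..} X \<longrightarrow> 0 \<le> \<rho> \<longrightarrow>
        (\<forall>t\<in>{t0..T}. X t = g t + (LINT s:{t0..t}|lborel. F s (X s))) \<longrightarrow> (\<forall>t\<in>{t0..T}. norm (g t) \<le> \<rho>) \<longrightarrow>
        (\<forall>t\<in>{t0..T}. norm (X t) \<le> a + b * \<rho>)"
      using integral_equation_bound[OF T] by (elim exE conjE) (rule that)
    obtain Y where Ym[measurable]: "Y \<in> borel_measurable M" and Yfin: "(\<integral>\<^sup>+\<omega>. Y \<omega> \<partial>M) < \<infinity>"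
      and Y: "AE \<omega> in M. \<forall>t\<in>{t0..T}. ennreal (norm (I t \<omega>) ^ (2 * j)) \<le> Y \<omega>"
      using Imom[OF T j(2)] by blast
    define A where "A = a + b * norm x0"
    define n where "n = 2 * j"
    have n: "n > 0" "\<nu> \<le> real n" using j by (auto simp: n_def)
    have A: "A \<ge> 0" using ab by (simp add: A_def)
    have "AE \<omega> in M. Y \<omega> \<noteq> \<infinity>"
      by (rule nn_integral_noteq_infinite[OF Ym]) (use Yfin in auto)
    \<comment> \<open>The supremum runs over uncountably many times and its measurability is not
      claimed; its integral is bounded through a measurable majorant.\<close>
    then have le: "AE \<omega> in M. (SUP t\<in>{t0..T}. ennreal (norm (X t \<omega>) powr \<nu>))
        \<le> ennreal (1 + 2 ^ n * A ^ n) + ennreal (2 ^ n * b ^ n) * Y \<omega>"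
      using sol Y
    proof eventually_elim
      case (elim \<omega>)
      obtain r where r: "Y \<omega> = ennreal r" "0 \<le> r" using elim(1) by (cases "Y \<omega>") auto
      define \<rho> where "\<rho> = root n r"
      have \<rho>: "0 \<le> \<rho>" "\<rho> ^ n = r" using n r by (simp_all add: \<rho>_def)
      have I\<rho>: "norm (I t \<omega>) \<le> \<rho>" if "t \<in> {t0..T}" for t
      proof -
        have "ennreal (norm (I t \<omega>) ^ n) \<le> ennreal r" using elim(3) that unfolding r(1) n_def by blast
        then have "norm (I t \<omega>) ^ n \<le> \<rho> ^ n" using r(2) \<rho>(2) by simp
        then show ?thesis using n(1) \<rho>(1) by (simp add: power_mono_iff)
      qed
      have Xb: "norm (X t \<omega>) \<le> A + b * \<rho>" if t: "t \<in> {t0..T}" for t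
      proof -
        have "\<forall>t\<in>{t0..T}. norm (X t \<omega>) \<le> a + b * (norm x0 + \<rho>)"
        proof (rule bound[THEN spec, of "\<lambda>t. X t \<omega>", THEN spec, of "\<lambda>t. x0 + I t \<omega>",
              THEN spec, of "norm x0 + \<rho>", THEN mp, THEN mp, THEN mp, THEN mp])
          show "continuous_on {t0..} (\<lambda>t. X t \<omega>)" using elim(2) by simp
          show "0 \<le> norm x0 + \<rho>" using \<rho>(1) by simp
          show "\<forall>t\<in>{t0..T}. X t \<omega> = x0 + I t \<omega> + (LINT s:{t0..t}|lborel. F s (X s \<omega>))"
            using elim(2) by simp
          show "\<forall>t\<in>{t0..T}. norm (x0 + I t \<omega>) \<le> norm x0 + \<rho>"
            using I\<rho> by (intro ballI norm_triangle_mono order_refl)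
        qed
        with t show ?thesis by (simp add: A_def algebra_simps)
      qed
      show ?case
      proof (rule SUP_least)
        fix t assume t: "t \<in> {t0..T}"
        have p1: "norm (X t \<omega>) powr \<nu> \<le> 1 + norm (X t \<omega>) ^ n"
        proof (cases "norm (X t \<omega>) \<ge> 1")
          case True
          then have "norm (X t \<omega>) powr \<nu> \<le> norm (X t \<omega>) powr real n"
            using n by (intro powr_mono)
          also have "\<dots> = norm (X t \<omega>) ^ n" using True by (intro powr_realpow) auto
          finally show ?thesis by simp
        next
          case False
          then have "norm (X t \<omega>) powr \<nu> \<le> 1" using \<nu> by (intro powr_le1) auto
          then show ?thesis by (simp add: add_increasing2)
        qed
        have "norm (X t \<omega>) ^ n \<le> (A + b * \<rho>) ^ n" by (rule power_mono[OF Xb[OF t] norm_ge_zero])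
        also have "\<dots> \<le> 2 ^ n * (A ^ n + (b * \<rho>) ^ n)"
          by (rule add_power_le[OF A mult_nonneg_nonneg[OF ab(2) \<rho>(1)]])
        also have "\<dots> = 2 ^ n * A ^ n + 2 ^ n * b ^ n * r"
          by (simp add: power_mult_distrib \<rho>(2) distrib_left)
        finally have "norm (X t \<omega>) powr \<nu> \<le> (1 + 2 ^ n * A ^ n) + 2 ^ n * b ^ n * r"
          using p1 by linarith
        then have "ennreal (norm (X t \<omega>) powr \<nu>) \<le> ennreal ((1 + 2 ^ n * A ^ n) + 2 ^ n * b ^ n * r)"
          by (rule ennreal_leI)
        also have "\<dots> = ennreal (1 + 2 ^ n * A ^ n) + ennreal (2 ^ n * b ^ n) * Y \<omega>"
        proof -
          have 1: "0 \<le> 1 + 2 ^ n * A ^ n" "0 \<le> 2 ^ n * b ^ n" using A ab by auto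
          show ?thesis
            unfolding r(1) ennreal_plus[OF 1(1) mult_nonneg_nonneg[OF 1(2) r(2)]] ennreal_mult[OF 1(2) r(2)] ..
        qed
        finally show "ennreal (norm (X t \<omega>) powr \<nu>) \<le> ennreal (1 + 2 ^ n * A ^ n) + ennreal (2 ^ n * b ^ n) * Y \<omega>" .
      qed
    qed
    have "(\<integral>\<^sup>+\<omega>. (SUP t\<in>{t0..T}. ennreal (norm (X t \<omega>) powr \<nu>)) \<partial>M)
        \<le> (\<integral>\<^sup>+\<omega>. ennreal (1 + 2 ^ n * A ^ n) + ennreal (2 ^ n * b ^ n) * Y \<omega> \<partial>M)"
      by (rule nn_integral_mono_AE[OF le])
    also have "\<dots> = ennreal (1 + 2 ^ n * A ^ n) + ennreal (2 ^ n * b ^ n) * (\<integral>\<^sup>+\<omega>. Y \<omega> \<partial>M)"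
      by (simp add: nn_integral_add nn_integral_cmult emeasure_space_1)
    also have "\<dots> < \<infinity>"
      using Yfin by (simp add: ennreal_mult_less_top)
    finally show "(\<integral>\<^sup>+\<omega>. (SUP t\<in>{t0..T}. ennreal (norm (X t \<omega>) powr \<nu>)) \<partial>M) < \<infinity>" .
  qed
  show ?thesis using strong unique S by blast
qed

end

section \<open>The system\<close>

lemma system_drift_lipschitz:
  fixes V :: "'h::{real_inner,banach,second_countable_topology} \<Rightarrow> 'h"
  assumes V: "L-lipschitz_on UNIV V" and \<mu>: "continuous_on {t0..} \<mu>" and \<mu>': "continuous_on {t0..} \<mu>'"
    and \<gamma>: "continuous_on {t0..} \<gamma>"
  shows "lipschitz_drift t0 (system_drift V lam \<mu> \<mu>' \<gamma>)"
proof
  let ?D = "{t0..} \<times> (UNIV :: ('h \<times> 'h) set)"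
  have V': "continuous_on UNIV V" using V by (rule lipschitz_on_continuous_on)
  have time: "continuous_on ?D (\<lambda>p. f (fst p))" if "continuous_on {t0..} f" for f :: "real \<Rightarrow> real"
    by (rule continuous_on_compose2[OF that]) (auto intro!: continuous_intros)
  have vel: "continuous_on ?D (\<lambda>p. V (fst (snd p)))"
    by (rule continuous_on_compose2[OF V']) (auto intro!: continuous_intros)
  show "continuous_on ?D (\<lambda>(s, x). system_drift V lam \<mu> \<mu>' \<gamma> s x)"
    unfolding system_drift_def split_beta'
    by (intro continuous_intros time[OF \<mu>] time[OF \<mu>'] time[OF \<gamma>] vel)
  fix T
  have L: "0 \<le> L" and Lip: "norm (V x - V y) \<le> L * norm (x - y)" for x y
    using lipschitz_onD[OF V, of x y] lipschitz_on_nonneg[OF V] by (auto simp: dist_norm)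
  have bounded: "\<exists>c\<ge>0. \<forall>s\<in>{t0..T}. \<bar>f s\<bar> \<le> c" if "continuous_on {t0..} f" for f :: "real \<Rightarrow> real"
  proof -
    have "continuous_on {t0..T} f" by (rule continuous_on_subset[OF that]) auto
    then have "bounded (f ` {t0..T})" by (intro compact_imp_bounded compact_continuous_image compact_Icc)
    then show ?thesis unfolding bounded_pos by (auto intro: less_imp_le)
  qed
  obtain c where c: "c \<ge> 0" "\<And>s. s \<in> {t0..T} \<Longrightarrow> \<bar>\<mu> s\<bar> \<le> c" using bounded[OF \<mu>] by blast
  have "continuous_on {t0..} (\<lambda>s. lam * \<mu> s - \<gamma> s + \<mu>' s)" by (intro continuous_intros \<mu> \<mu>' \<gamma>)
  from bounded[OF this] obtain d where d: "d \<ge> 0" "\<And>s. s \<in> {t0..T} \<Longrightarrow> \<bar>lam * \<mu> s - \<gamma> s + \<mu>' s\<bar> \<le> d" by blast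
  \<comment> \<open>\<open>1 + c * L\<close> accounts for the first component and
    \<open>\<bar>lam\<bar> + d * L\<close> for the second; the norm of a pair is at most the sum of
    the two norms.\<close>
  define K where "K = 1 + c * L + \<bar>lam\<bar> + d * L"
  have "K > 0" using c(1) d(1) L by (simp add: K_def add_pos_nonneg)
  moreover have "norm (system_drift V lam \<mu> \<mu>' \<gamma> s x - system_drift V lam \<mu> \<mu>' \<gamma> s x') \<le> K * norm (x - x')"
    if s: "s \<in> {t0..T}" for s x x'
  proof -
    obtain y z y' z' where x: "x = (y, z)" "x' = (y', z')" by (cases x, cases x') auto
    define e where "e = lam * \<mu> s - \<gamma> s + \<mu>' s"
    have y: "norm (y - y') \<le> norm (x - x')" and z: "norm (z - z') \<le> norm (x - x')"
      using norm_fst_le[of "y - y'" "z - z'"] norm_snd_le[of "z - z'" "y - y'"] by (auto simp: x)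
    have Vy: "norm (V y - V y') \<le> L * norm (x - x')"
      using Lip[of y y'] mult_left_mono[OF y L] by linarith
    have Vterm: "norm (a *\<^sub>R (V y - V y')) \<le> b * L * norm (x - x')" if "\<bar>a\<bar> \<le> b" for a b
      using mult_mono[OF that Vy] that by (simp add: mult.assoc)
    have "system_drift V lam \<mu> \<mu>' \<gamma> s x - system_drift V lam \<mu> \<mu>' \<gamma> s x'
        = ((z - z') - \<mu> s *\<^sub>R (V y - V y'), - lam *\<^sub>R (z - z') + e *\<^sub>R (V y - V y'))"
      by (simp add: system_drift_def x e_def algebra_simps)
    also have "norm \<dots> \<le> norm ((z - z') - \<mu> s *\<^sub>R (V y - V y')) + norm (- lam *\<^sub>R (z - z') + e *\<^sub>R (V y - V y'))"
      by (rule norm_Pair_le)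
    also have "\<dots> \<le> (norm (x - x') + c * L * norm (x - x')) + (\<bar>lam\<bar> * norm (x - x') + d * L * norm (x - x'))"
    proof -
      have "norm (- lam *\<^sub>R (z - z')) \<le> \<bar>lam\<bar> * norm (x - x')"
        using mult_left_mono[OF z, of "\<bar>lam\<bar>"] by simp
      moreover have "norm (\<mu> s *\<^sub>R (V y - V y')) \<le> c * L * norm (x - x')" by (rule Vterm[OF c(2)[OF s]])
      moreover have "norm (e *\<^sub>R (V y - V y')) \<le> d * L * norm (x - x')"
        unfolding e_def by (rule Vterm[OF d(2)[OF s]])
      moreover note z norm_triangle_ineq4[of "z - z'" "\<mu> s *\<^sub>R (V y - V y')"]
        norm_triangle_ineq[of "- lam *\<^sub>R (z - z')" "e *\<^sub>R (V y - V y')"]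
      ultimately show ?thesis by linarith
    qed
    also have "\<dots> = K * norm (x - x')" by (simp add: K_def algebra_simps)
    finally show ?thesis .
  qed
  ultimately show "\<exists>L>0. \<forall>s\<in>{t0..T}. \<forall>x y. norm (system_drift V lam \<mu> \<mu>' \<gamma> s x - system_drift V lam \<mu> \<mu>' \<gamma> s y) \<le> L * norm (x - y)"
    by blast
qed

lemma hs_sq_system_diffusion: "hs_sq (system_diffusion \<sigma> s x) = hs_sq (\<sigma> s)"
  unfolding hs_sq_def by (simp add: system_diffusion_apply)

theorem theorem3p1:
  fixes M :: "'w measure" and Fil :: "real \<Rightarrow> 'w measure"
    and Q :: "'h::{real_inner,banach,second_countable_topology} \<Rightarrow> 'h"
    and W :: "real \<Rightarrow> 'h \<Rightarrow> 'w \<Rightarrow> real"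
    and V :: "'h \<Rightarrow> 'h" and L t0 lam \<sigma>star :: real
    and \<mu> \<mu>' \<gamma> :: "real \<Rightarrow> real"
    and \<sigma> :: "real \<Rightarrow> ('h \<Rightarrow>\<^sub>L 'h)"
    and Y0 X0 :: 'h
  assumes "prob_space M" and "filtration_from M t0 Fil" and "brownian_motion M t0 Fil Q W"
    and "\<forall>x y. (V y - V x) \<bullet> (y - x) \<ge> 0"
    and "L-lipschitz_on UNIV V"
    and "{y. V y = 0} \<noteq> {}"
    and "t0 \<ge> 0" and "lam > 0"
    and "\<forall>t\<ge>t0. \<mu> t > 0"
    and "\<forall>t\<ge>t0. (\<mu> has_real_derivative \<mu>' t) (at t within {t0..})"
    and "continuous_on {t0..} \<mu>'"
    and "mono_on {t0..} \<mu>"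
    and "\<forall>t\<ge>t0. \<gamma> t > 0" and "continuous_on {t0..} \<gamma>"
    and "\<sigma> \<in> borel_measurable (restrict_space borel {t0..})"
    and "\<forall>t\<ge>t0. hs_norm (\<sigma> t) \<le> ennreal \<sigma>star"
  shows "\<exists>Y Z.
    strong_solution M t0 Fil W (system_drift V lam \<mu> \<mu>' \<gamma>) (system_diffusion \<sigma>)
      (Y0, X0 + \<mu> t0 *\<^sub>R V Y0) (\<lambda>t \<omega>. (Y t \<omega>, Z t \<omega>)) \<and>
    (\<forall>Y' Z'.
      strong_solution M t0 Fil W (system_drift V lam \<mu> \<mu>' \<gamma>) (system_diffusion \<sigma>)
        (Y0, X0 + \<mu> t0 *\<^sub>R V Y0) (\<lambda>t \<omega>. (Y' t \<omega>, Z' t \<omega>)) \<longrightarrow>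
      indistinguishable_from M t0 (\<lambda>t \<omega>. (Y t \<omega>, Z t \<omega>)) (\<lambda>t \<omega>. (Y' t \<omega>, Z' t \<omega>))) \<and>
    (\<forall>\<nu>\<ge>2. (\<lambda>t \<omega>. (Y t \<omega>, Z t \<omega>)) \<in> S_class M t0 Fil \<nu>)"
proof -
  have bm: "brownian_motion M t0 Fil Q W" by fact
  then obtain \<kappa> where \<kappa>: "\<kappa> > 0" "\<And>h. norm (Q h) \<le> norm h * \<kappa>"
    using bounded_linear.pos_bounded[of Q] by (auto simp: brownian_motion_def)
  have "Q h \<bullet> h \<le> \<kappa> * (norm h)\<^sup>2" for h
    using norm_cauchy_schwarz[of "Q h" h] mult_right_mono[OF \<kappa>(2)[of h] norm_ge_zero[of h]]
    by (simp add: power2_eq_square mult_ac)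
  then have setting: "bm_setting M t0 Fil Q W \<kappa>"
    using assms(1,2) bm \<kappa>(1) by (intro bm_setting.intro bm_setting_axioms.intro)
  have "continuous_on {t0..} \<mu>"
    unfolding continuous_on_eq_continuous_within
  proof
    fix t assume "t \<in> {t0..}"
    then have "(\<mu> has_real_derivative \<mu>' t) (at t within {t0..})" using assms(10) by simp
    then show "continuous (at t within {t0..}) \<mu>" by (rule DERIV_continuous)
  qed
  then have drift: "lipschitz_drift t0 (system_drift V lam \<mu> \<mu>' \<gamma>)"
    using assms(5,11,14) by (intro system_drift_lipschitz)
  \<comment> \<open>The diffusion is constant in the state, so its value at 0 represents it
    everywhere.\<close>
  define \<Phi> where "\<Phi> s = system_diffusion \<sigma> s 0" for s
  have \<Phi>: "system_diffusion \<sigma> = (\<lambda>s _. \<Phi> s)"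
    by (simp add: \<Phi>_def system_diffusion_def fun_eq_iff)
  have \<Phi>_meas: "(\<lambda>s. blinfun_apply (\<Phi> s) h) \<in> borel_measurable (restrict_space borel {t0..T})" for h T
  proof -
    \<comment> \<open>Evaluation at a vector is continuous in the operator norm, so measurability of
      \<open>\<sigma>\<close> as an operator-valued map implies the pointwise measurability that the
      integral uses.\<close>
    have "(\<lambda>A :: 'h \<Rightarrow>\<^sub>L 'h. blinfun_apply A h) \<in> borel_measurable borel"
      by (intro borel_measurable_continuous_onI continuous_intros)
    from measurable_compose[OF assms(15) this]
    have "(\<lambda>s. blinfun_apply (\<sigma> s) h) \<in> borel_measurable (restrict_space borel {t0..T})"
      by (rule measurable_restrict_mono) auto
    then show ?thesis
      unfolding \<Phi>_def system_diffusion_apply by (intro borel_measurable_Pair borel_measurable_const)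
  qed
  have \<Phi>_bdd: "\<exists>c\<ge>0. \<forall>s\<in>{t0..T}. hs_sq (\<Phi> s) \<le> ennreal c" for T
  proof (intro exI conjI ballI)
    show "0 \<le> (max \<sigma>star 0)\<^sup>2" by simp
    fix s assume "s \<in> {t0..T}"
    then have "hs_norm (\<sigma> s) \<le> ennreal \<sigma>star" using assms(16) by simp
    \<comment> \<open>A negative \<open>\<sigma>star\<close> is embedded as 0, whereas its square
      would be positive; taking the maximum first keeps the squares consistent.\<close>
    also have "\<dots> \<le> ennreal (max \<sigma>star 0)" by (intro ennreal_leI) simp
    finally have "(hs_norm (\<sigma> s))\<^sup>2 \<le> (ennreal (max \<sigma>star 0))\<^sup>2" by (rule power_mono) simp
    also have "(ennreal (max \<sigma>star 0))\<^sup>2 = ennreal ((max \<sigma>star 0)\<^sup>2)"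
      by (rule ennreal_power) simp
    finally show "hs_sq (\<Phi> s) \<le> ennreal ((max \<sigma>star 0)\<^sup>2)"
      unfolding \<Phi>_def hs_sq_system_diffusion hs_norm_power2 .
  qed
  interpret additive_noise M t0 Fil Q W \<kappa> "system_drift V lam \<mu> \<mu>' \<gamma>" \<Phi>
    using setting drift \<Phi>_meas \<Phi>_bdd by (intro additive_noise.intro additive_noise_axioms.intro)
  obtain X where X: "strong_solution M t0 Fil W (system_drift V lam \<mu> \<mu>' \<gamma>) (\<lambda>s _. \<Phi> s) (Y0, X0 + \<mu> t0 *\<^sub>R V Y0) X"
    "\<forall>X'. strong_solution M t0 Fil W (system_drift V lam \<mu> \<mu>' \<gamma>) (\<lambda>s _. \<Phi> s) (Y0, X0 + \<mu> t0 *\<^sub>R V Y0) X' \<longrightarrow>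
       indistinguishable_from M t0 X X'"
    "\<forall>\<nu>\<ge>2. X \<in> S_class M t0 Fil \<nu>"
    using additive_noise_solution by blast
  \<comment> \<open>A process in the product space is the pair of its components, so quantifying
    over \<open>Y\<close> and \<open>Z\<close> is quantifying over \<open>X\<close>.\<close>
  have "(\<lambda>t \<omega>. (fst (X t \<omega>), snd (X t \<omega>))) = X" by simp
  with X show ?thesis
    unfolding \<Phi> by (intro exI[of _ "\<lambda>t \<omega>. fst (X t \<omega>)"] exI[of _ "\<lambda>t \<omega>. snd (X t \<omega>)"]) auto
qed

end
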